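(* Let $X$ be a metric space and let $\mathcal{H}\subset 2^X$ be an open subspace such that $\mathcal{D}_0(F)\subset\mathcal{H}$ for each $F\in\mathcal{H}$. Then the following conditions are equivalent: (1) $\mathcal{H}$ is an ANR; (2) $\mathcal{H}$ is locally path connected; (3) $\mathcal{H}$ is locally chain connected; (4) $2^X$ is locally chain connected at $\mathcal{D}_0(F)$ for each $F\in\mathcal{H}$; (5) $X$ is uniformly locally chain equi-connected at each $F\in\mathcal{H}$; (6) $X$ is uniformly locally trace equi-connected at each $F\in\mathcal{H}$.
   Context: For a metric space $(X,d)$, $2^X$ is the set of all non-empty closed subsets of $X$ endowed with the metric $\min\{1,d_H\}$ (and the induced topology), where $d_H(A,B)=\max\{\sup_{x\in B}d(x,A),\sup_{x\in A}d(x,B)\}\in[0,\infty]$; subspaces carry the restricted metric. A subset $D\subset X$ is uniformly discrete if there is $\varepsilon>0$ with $|D\cap B(x,\varepsilon)|\le1$ for all $x\in X$, where $B(x,\varepsilon)$ is the open ball. $\mathcal{D}_0(X)$ is the set of all $D\in 2^X$ that are discrete, at most countable, and totally bounded or uniformly discrete in $X$. For closed $F\subset X$, $\mathcal{D}_0(F)=\{D\in\mathcal{D}_0(X):D\subset F\}$. A metric space $Y$ is an ANR if for each metric space $M$ containing $Y$ isometrically as a closed subset there is a (continuous) retraction $r:U\to Y$ from some open neighborhood $U$ of $Y$ in $M$. A space $Y$ is locally path connected if for each $x_0\in Y$ and neighborhood $U$ of $x_0$ there is a neighborhood $V$ of $x_0$ such that each $x\in V$ can be linked with $x_0$ by a continuous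 path $f:[0,1]\to U$, $f(0)=x_0$, $f(1)=x$. Let $(Y,\rho)$ be a metric space and $Y_0\subset Y$. For $\eta>0$, an $\eta$-chain of length $l$ linking $x$ and $y$ is a sequence $x=x_0,\dots,x_l=y$ of points of $Y$ with $\rho(x_i,x_{i-1})<\eta$ for $1\le i\le l$; its diameter is $\operatorname{diam}\{x_0,\dots,x_l\}$. - $Y$ is locally chain connected at $Y_0$ if for each $x_0\in Y_0$ and $\varepsilon>0$ there is $\delta>0$ such that for each $\eta>0$ and each $x\in Y_0$ with $\rho(x,x_0)<\delta$ there is an $\eta$-chain in $Y$ of diameter $<\varepsilon$ linking $x_0$ and $x$. $Y$ is locally chain connected if this holds with $Y_0=Y$. - $Y$ is uniformly locally chain equi-connected at $Y_0$ if $\forall\varepsilon>0\ \exists\delta>0\ \forall\eta>0\ \exists l\in\mathbb{N}$ such that any $x,y\in Y_0$ with $\rho(x,y)<\delta$ can be linked by an $\eta$-chain in $Y$ of diameter $<\varepsilon$ and length $\le l$. - A continuity modulus is a non-decreasing function $\omega:(0,\infty)\to(0,\infty)$ with $\lim_{t\to+0}\omega(t)=0$. For a map $f$ between metric spaces, $\omega_f(t)$ is the supremum of the distances between $f(x)$ and $f(x')$ over all $x,x'$ in the domain at distance $\le t$. $Y$ is uniformly locally trace equi-connected at $Y_0$ if there are $\varepsilon_0>0$ and a continuity modulus $\omega$ such that for any $x,y\in Y_0$ with $\rho(x,y)<\varepsilon_0$ and any countable dense subset $Q\supset\{0,\rho(x,y)\}$ of $[0,\rho(x,y)]$ there is a uniformly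 continuous $f:Q\to Y$ with $f(0)=x$, $f(\rho(x,y))=y$, $\omega_f\le\omega$. *)

theory Defs
  imports "HOL-Analysis.Analysis"
begin

section \<open>The hyperspace of non-empty closed subsets\<close>

definition setdist_pt :: "'a metric \<Rightarrow> 'a \<Rightarrow> 'a set \<Rightarrow> ennreal" where
  "setdist_pt m x A = (INF a\<in>A. ennreal (mdist m x a))"

definition hausdorff_dist :: "'a metric \<Rightarrow> 'a set \<Rightarrow> 'a set \<Rightarrow> ennreal" where
  "hausdorff_dist m A B = max (SUP x\<in>B. setdist_pt m x A) (SUP x\<in>A. setdist_pt m x B)"

definition closed_nonempty :: "'a metric \<Rightarrow> 'a set set" where
  "closed_nonempty m = {A. closedin (mtopology_of m) A \<and> A \<noteq> {}}"

definition hyperspace :: "'a metric \<Rightarrow> 'a set metric" where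
  "hyperspace m = metric (closed_nonempty m, \<lambda>A B. enn2real (min 1 (hausdorff_dist m A B)))"

text \<open>The pair in the definition above is a metric space, so carrier and distance of
  \<^term>\<open>hyperspace m\<close> are the intended ones.\<close>

lemma setdist_pt_le:
  assumes "a \<in> A" shows "setdist_pt m x A \<le> ennreal (mdist m x a)"
  unfolding setdist_pt_def using assms by (rule INF_lower)

lemma setdist_pt_triangle:
  assumes A: "x \<in> mspace m" and B: "B \<subseteq> mspace m" "B \<noteq> {}" and C: "C \<subseteq> mspace m" "C \<noteq> {}"
  shows "setdist_pt m x C \<le> (SUP y\<in>B. setdist_pt m y C) + setdist_pt m x B"
proof -
  let ?e = "SUP y\<in>B. setdist_pt m y C"
  have fin: "setdist_pt m x C \<noteq> top"
  proof -
    obtain c where "c \<in> C" using C by auto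
    from setdist_pt_le[OF this, of m x] show ?thesis
      using ennreal_less_top leD top.not_eq_extremum by fastforce
  qed
  have step: "setdist_pt m x C \<le> ennreal (mdist m x y) + setdist_pt m y C" if y: "y \<in> B" for y
  proof -
    have "setdist_pt m x C - ennreal (mdist m x y) \<le> setdist_pt m y C"
      unfolding setdist_pt_def[of m y C]
    proof (rule INF_greatest)
      fix c assume c: "c \<in> C"
      have "setdist_pt m x C \<le> ennreal (mdist m x c)" using c by (rule setdist_pt_le)
      also have "\<dots> \<le> ennreal (mdist m x y + mdist m y c)"
        using mdist_triangle[of x m y c] A B C c y by (intro ennreal_leI) auto
      also have "\<dots> = ennreal (mdist m x y) + ennreal (mdist m y c)"
        by simp
      finally show "setdist_pt m x C - ennreal (mdist m x y) \<le> ennreal (mdist m y c)"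
        using fin by (simp add: ennreal_minus_le_iff)
    qed
    then show ?thesis using fin by (simp add: ennreal_minus_le_iff)
  qed
  have "setdist_pt m x C - ?e \<le> setdist_pt m x B"
    unfolding setdist_pt_def[of m x B]
  proof (rule INF_greatest)
    fix y assume y: "y \<in> B"
    have "setdist_pt m y C \<le> ?e" using y by (rule SUP_upper)
    then have "setdist_pt m x C \<le> ?e + ennreal (mdist m x y)"
      using step[OF y] by (metis add.commute add_left_mono order_trans)
    then show "setdist_pt m x C - ?e \<le> ennreal (mdist m x y)"
      using fin by (simp add: ennreal_minus_le_iff)
  qed
  then show ?thesis using fin by (simp add: ennreal_minus_le_iff)
qed

lemma hausdorff_dist_commute: "hausdorff_dist m A B = hausdorff_dist m B A"
  by (simp add: hausdorff_dist_def max.commute)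

lemma hausdorff_dist_refl: "hausdorff_dist m A A = 0" if "A \<subseteq> mspace m"
proof -
  have "setdist_pt m x A \<le> 0" if "x \<in> A" for x
    proof -
    have "mdist m x x = 0" using that \<open>A \<subseteq> mspace m\<close> by (simp add: subset_iff)
    then show ?thesis using setdist_pt_le[OF that, of m x] by simp
  qed
  then have "(SUP x\<in>A. setdist_pt m x A) \<le> 0" by (intro SUP_least) auto
  then show ?thesis by (simp add: hausdorff_dist_def)
qed

lemma hausdorff_dist_triangle:
  assumes "A \<subseteq> mspace m" "A \<noteq> {}" "B \<subseteq> mspace m" "B \<noteq> {}" "C \<subseteq> mspace m" "C \<noteq> {}"
  shows "hausdorff_dist m A C \<le> hausdorff_dist m A B + hausdorff_dist m B C"
proof -
  have *: "(SUP x\<in>A. setdist_pt m x C) \<le> hausdorff_dist m A B + hausdorff_dist m B C"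
    if "A \<subseteq> mspace m" "B \<subseteq> mspace m" "B \<noteq> {}" "C \<subseteq> mspace m" "C \<noteq> {}" for A C
  proof (rule SUP_least)
    fix x assume x: "x \<in> A"
    have "setdist_pt m x C \<le> (SUP y\<in>B. setdist_pt m y C) + setdist_pt m x B"
      using that x by (intro setdist_pt_triangle) auto
    also have "\<dots> \<le> hausdorff_dist m B C + hausdorff_dist m A B"
      unfolding hausdorff_dist_def using x by (intro add_mono max.coboundedI2 SUP_upper order_refl)
    finally show "setdist_pt m x C \<le> hausdorff_dist m A B + hausdorff_dist m B C"
      by (simp add: add.commute)
  qed
  have "(SUP x\<in>C. setdist_pt m x A) \<le> hausdorff_dist m C B + hausdorff_dist m B A"
    using assms by (intro *)
  then have "(SUP x\<in>C. setdist_pt m x A) \<le> hausdorff_dist m A B + hausdorff_dist m B C"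
    by (simp add: hausdorff_dist_commute[of m C B] hausdorff_dist_commute[of m B A] add.commute)
  moreover have "(SUP x\<in>A. setdist_pt m x C) \<le> hausdorff_dist m A B + hausdorff_dist m B C"
    using assms by (intro *)
  ultimately show ?thesis
    unfolding hausdorff_dist_def[of m A C] by simp
qed

lemma setdist_pt_eq_0D:
  assumes "closedin (mtopology_of m) A" "A \<noteq> {}" "x \<in> mspace m" "setdist_pt m x A = 0"
  shows "x \<in> A"
proof (rule ccontr)
  assume "x \<notin> A"
  then have x: "x \<in> mspace m - A" using assms by simp
  interpret M: Metric_space "mspace m" "mdist m" by simp
  have "openin M.mtopology (mspace m - A)"
    using assms(1) by (simp add: closedin_def mtopology_of_def)
  then obtain r where r: "r > 0" "M.mball x r \<subseteq> mspace m - A"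
    using x by (auto simp: M.openin_mtopology)
  have "ennreal r \<le> setdist_pt m x A"
    unfolding setdist_pt_def
  proof (rule INF_greatest)
    fix a assume a: "a \<in> A"
    then have "a \<in> mspace m" using assms(1) closedin_subset by fastforce
    then have "\<not> mdist m x a < r" using r a assms(3) by auto
    then show "ennreal r \<le> ennreal (mdist m x a)" by (simp add: ennreal_leI)
  qed
  then show False using r assms(4) by simp
qed

lemma Metric_space_hyperspace:
  "Metric_space (closed_nonempty m) (\<lambda>A B. enn2real (min 1 (hausdorff_dist m A B)))"
proof
  fix A B C :: "'a set"
  have fin: "min 1 z < (top :: ennreal)" for z
    by (metis ennreal_one_less_top min.strict_coboundedI1)
  show "0 \<le> enn2real (min 1 (hausdorff_dist m A B))" by simp
  show "enn2real (min 1 (hausdorff_dist m A B)) = enn2real (min 1 (hausdorff_dist m B A))"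
    by (simp add: hausdorff_dist_commute)
  assume AB: "A \<in> closed_nonempty m" "B \<in> closed_nonempty m"
  have sub: "D \<subseteq> mspace m" "D \<noteq> {}" if "D \<in> closed_nonempty m" for D
    using that closedin_subset[of "mtopology_of m" D] by (auto simp: closed_nonempty_def)
  show "enn2real (min 1 (hausdorff_dist m A B)) = 0 \<longleftrightarrow> A = B"
  proof
    assume "enn2real (min 1 (hausdorff_dist m A B)) = 0"
    then have "min 1 (hausdorff_dist m A B) = 0"
      using fin[of "hausdorff_dist m A B"] by (auto simp: enn2real_eq_0_iff)
    then have 0: "hausdorff_dist m A B = 0"
      by (auto simp: min_def split: if_splits)
    have "A' \<subseteq> B'" if "A' \<in> closed_nonempty m" "B' \<in> closed_nonempty m"
      "hausdorff_dist m A' B' = 0" for A' B'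
    proof
      fix x assume x: "x \<in> A'"
      have "setdist_pt m x B' \<le> (SUP x\<in>A'. setdist_pt m x B')" using x by (rule SUP_upper)
      also have "\<dots> \<le> 0" using that(3) by (metis hausdorff_dist_def max.cobounded2)
      finally have "setdist_pt m x B' = 0" by simp
      then show "x \<in> B'" using x that(1,2) sub(1)[OF that(1)] setdist_pt_eq_0D[of m B' x]
        unfolding closed_nonempty_def by blast
    qed
    from this[of A B] this[of B A] show "A = B"
      using AB 0 by (auto simp: hausdorff_dist_commute[of m B A])
  next
    assume "A = B" then show "enn2real (min 1 (hausdorff_dist m A B)) = 0"
      using sub[OF AB(1)] by (simp add: hausdorff_dist_refl)
  qed
  assume C: "C \<in> closed_nonempty m"
  have min1: "min 1 c \<le> min 1 a + min 1 b" if "c \<le> a + b" for a b c :: ennreal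
  proof (cases "1 \<le> a \<or> 1 \<le> b")
    case True
    then have "1 \<le> min 1 a + min 1 b"
      by (metis add_increasing add_increasing2 min.absorb1 order_refl zero_le)
    then show ?thesis by (rule min.coboundedI1)
  next
    case False
    then have "min 1 a = a" "min 1 b = b" by (simp_all add: min_def)
    then show ?thesis using that by (simp add: min.coboundedI2)
  qed
  have "min 1 (hausdorff_dist m A C)
      \<le> min 1 (hausdorff_dist m A B) + min 1 (hausdorff_dist m B C)"
    by (intro min1 hausdorff_dist_triangle sub AB C)
  then have "enn2real (min 1 (hausdorff_dist m A C))
      \<le> enn2real (min 1 (hausdorff_dist m A B) + min 1 (hausdorff_dist m B C))"
    by (rule enn2real_mono) (use fin in simp)
  also have "\<dots> = enn2real (min 1 (hausdorff_dist m A B)) + enn2real (min 1 (hausdorff_dist m B C))"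
    by (intro enn2real_plus fin)
  finally show "enn2real (min 1 (hausdorff_dist m A C))
      \<le> enn2real (min 1 (hausdorff_dist m A B)) + enn2real (min 1 (hausdorff_dist m B C))" .
qed

lemma mspace_hyperspace [simp]: "mspace (hyperspace m) = closed_nonempty m"
  unfolding hyperspace_def by (rule Metric_space.mspace_metric[OF Metric_space_hyperspace])

lemma mdist_hyperspace:
  "mdist (hyperspace m) A B = enn2real (min 1 (hausdorff_dist m A B))"
  unfolding hyperspace_def by (simp add: Metric_space.mdist_metric[OF Metric_space_hyperspace])

definition uniformly_discrete_in :: "'a metric \<Rightarrow> 'a set \<Rightarrow> bool" where
  "uniformly_discrete_in m D \<longleftrightarrow>
     (\<exists>\<epsilon>>0. \<forall>x\<in>mspace m. finite (D \<inter> mball_of m x \<epsilon>) \<and> card (D \<inter> mball_of m x \<epsilon>) \<le> 1)"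

definition D0 :: "'a metric \<Rightarrow> 'a set set" where
  "D0 m = {D \<in> closed_nonempty m.
     subtopology (mtopology_of m) D = discrete_topology D \<and> countable D \<and>
     (Metric_space.mtotally_bounded (mspace m) (mdist m) D \<or> uniformly_discrete_in m D)}"

definition D0_in :: "'a metric \<Rightarrow> 'a set \<Rightarrow> 'a set set" where
  "D0_in m F = {D \<in> D0 m. D \<subseteq> F}"


section \<open>Absolute neighbourhood retracts\<close>

text \<open>HOL cannot quantify over types inside a formula, so the ambient spaces \<open>M\<close> range over the
  metric spaces with points in the type \<^typ>\<open>'u\<close> given by the first argument; \<open>e\<close> is the
  isometric inclusion. For a space \<open>Y\<close> over \<^typ>\<open>'a\<close>, the type should contain
  \<^typ>\<open>'a \<Rightarrow> real\<close>: it then hosts the convex hull of the Kuratowski image of \<open>Y\<close> (for a bounded metric),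
  in which that image is closed (Wojdyslawski). Instantiating the argument with
  \<^typ>\<open>('a \<Rightarrow> real) + 'u\<close> for a schematic \<^typ>\<open>'u\<close> therefore covers ambient spaces over
  every type and keeps the condition strong enough for each single \<^typ>\<open>'u\<close>.\<close>

definition metric_ANR :: "'u itself \<Rightarrow> 'a metric \<Rightarrow> bool" where
  "metric_ANR T Y \<longleftrightarrow>
     (\<forall>(M :: 'u metric) e.
        e ` mspace Y \<subseteq> mspace M \<and>
        (\<forall>x\<in>mspace Y. \<forall>y\<in>mspace Y. mdist M (e x) (e y) = mdist Y x y) \<and>
        closedin (mtopology_of M) (e ` mspace Y) \<longrightarrow>
        (\<exists>U. openin (mtopology_of M) U \<and> e ` mspace Y \<subseteq> U \<and>
             e ` mspace Y retract_of_space subtopology (mtopology_of M) U))"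


section \<open>Local path connectedness\<close>

text \<open>The library notion amounts to the pointwise condition with paths from the base
  point to each point of a small neighbourhood.\<close>

lemma locally_path_connected_space_iff_paths:
  "locally_path_connected_space T \<longleftrightarrow>
     (\<forall>x0\<in>topspace T. \<forall>U. openin T U \<and> x0 \<in> U \<longrightarrow>
        (\<exists>V. openin T V \<and> x0 \<in> V \<and>
             (\<forall>x\<in>V. \<exists>f. pathin (subtopology T U) f \<and> f 0 = x0 \<and> f 1 = x)))"
  (is "?L \<longleftrightarrow> ?R")
proof
  assume L: ?L
  show ?R
  proof (intro ballI allI impI)
    fix x0 U assume "x0 \<in> topspace T" and U: "openin T U \<and> x0 \<in> U"
    from locally_path_connected_space_im_kleinen[THEN iffD1, OF L, THEN spec, THEN spec, THEN mp, OF U]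
    obtain V where V': "openin T V \<and> x0 \<in> V \<and> V \<subseteq> U \<and>
      (\<forall>y\<in>V. \<exists>C. path_connectedin T C \<and> C \<subseteq> U \<and> x0 \<in> C \<and> y \<in> C)" ..
    note V = conjunct1[OF V'] V'[THEN conjunct2, THEN conjunct1]
      V'[THEN conjunct2, THEN conjunct2, THEN conjunct2]
    have "\<exists>f. pathin (subtopology T U) f \<and> f 0 = x0 \<and> f 1 = y" if yV: "y \<in> V" for y
    proof -
      obtain C where C: "path_connectedin T C" "C \<subseteq> U" "x0 \<in> C" "y \<in> C" using bspec[OF V(3) yV] by blast
      then obtain g where "pathin T g" "g \<in> {0..1} \<rightarrow> C" "g 0 = x0" "g 1 = y"
        unfolding path_connectedin by blast
      then have "pathin (subtopology T U) g"
        using C by (auto simp: pathin_subtopology)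
      then show ?thesis using \<open>g 0 = x0\<close> \<open>g 1 = y\<close> by blast
    qed
    then show "\<exists>V. openin T V \<and> x0 \<in> V \<and>
        (\<forall>x\<in>V. \<exists>f. pathin (subtopology T U) f \<and> f 0 = x0 \<and> f 1 = x)"
      using V by blast
  qed
next
  assume R: ?R
  show ?L
    unfolding locally_path_connected_space_im_kleinen
  proof (intro allI impI)
    fix U x0 assume U: "openin T U \<and> x0 \<in> U"
    then have "x0 \<in> topspace T" using openin_subset by blast
    from bspec[OF R this, THEN spec, THEN mp, OF U] obtain V where V': "openin T V \<and> x0 \<in> V \<and>
      (\<forall>x\<in>V. \<exists>f. pathin (subtopology T U) f \<and> f 0 = x0 \<and> f 1 = x)" ..
    note V = conjunct1[OF V'] V'[THEN conjunct2, THEN conjunct1]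
      V'[THEN conjunct2, THEN conjunct2]
    have "\<exists>C. path_connectedin T C \<and> C \<subseteq> U \<and> x0 \<in> C \<and> y \<in> C" if yV: "y \<in> V" for y
    proof -
      obtain f where f: "pathin (subtopology T U) f" "f 0 = x0" "f 1 = y" using bspec[OF V(3) yV] by blast
      then have "pathin T f" "f ` {0..1} \<subseteq> U"
        by (auto simp: pathin_subtopology)
      moreover from this have "path_connectedin T (f ` {0..1})"
        by (intro path_connectedin_path_image)
      moreover have "x0 \<in> f ` {0..1}" "y \<in> f ` {0..1}"
        using f by force+
      ultimately show ?thesis by blast
    qed
    then have "\<forall>y\<in>V \<inter> U. \<exists>C. path_connectedin T C \<and> C \<subseteq> U \<and> x0 \<in> C \<and> y \<in> C" by blast
    then show "\<exists>W. openin T W \<and> x0 \<in> W \<and> W \<subseteq> U \<and>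
        (\<forall>y\<in>W. \<exists>C. path_connectedin T C \<and> C \<subseteq> U \<and> x0 \<in> C \<and> y \<in> C)"
      using V U by (intro exI[of _ "V \<inter> U"]) auto
  qed
qed


section \<open>Chain and trace conditions\<close>

definition chain_linking :: "'a metric \<Rightarrow> real \<Rightarrow> nat \<Rightarrow> (nat \<Rightarrow> 'a) \<Rightarrow> 'a \<Rightarrow> 'a \<Rightarrow> bool" where
  "chain_linking m \<eta> l c x y \<longleftrightarrow>
     c 0 = x \<and> c l = y \<and> (\<forall>i\<in>{0..l}. c i \<in> mspace m) \<and>
     (\<forall>i\<in>{1..l}. mdist m (c i) (c (i - 1)) < \<eta>)"

definition chain_diam :: "'a metric \<Rightarrow> nat \<Rightarrow> (nat \<Rightarrow> 'a) \<Rightarrow> real" where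
  "chain_diam m l c = Max {mdist m (c i) (c j) | i j. i \<in> {0..l} \<and> j \<in> {0..l}}"

definition locally_chain_connected_at :: "'a metric \<Rightarrow> 'a set \<Rightarrow> bool" where
  "locally_chain_connected_at m Y0 \<longleftrightarrow>
     (\<forall>x0\<in>Y0. \<forall>\<epsilon>>0. \<exists>\<delta>>0. \<forall>\<eta>>0. \<forall>x\<in>Y0. mdist m x x0 < \<delta> \<longrightarrow>
        (\<exists>l c. chain_linking m \<eta> l c x0 x \<and> chain_diam m l c < \<epsilon>))"

definition locally_chain_connected :: "'a metric \<Rightarrow> bool" where
  "locally_chain_connected m \<longleftrightarrow> locally_chain_connected_at m (mspace m)"

definition uniformly_locally_chain_equiconnected_at :: "'a metric \<Rightarrow> 'a set \<Rightarrow> bool" where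
  "uniformly_locally_chain_equiconnected_at m Y0 \<longleftrightarrow>
     (\<forall>\<epsilon>>0. \<exists>\<delta>>0. \<forall>\<eta>>0. \<exists>l. \<forall>x\<in>Y0. \<forall>y\<in>Y0. mdist m x y < \<delta> \<longrightarrow>
        (\<exists>k c. k \<le> l \<and> chain_linking m \<eta> k c x y \<and> chain_diam m k c < \<epsilon>))"

definition continuity_modulus :: "(real \<Rightarrow> real) \<Rightarrow> bool" where
  "continuity_modulus \<omega> \<longleftrightarrow>
     (\<forall>t>0. \<omega> t > 0) \<and> mono_on {0<..} \<omega> \<and> (\<omega> \<longlongrightarrow> 0) (at_right 0)"

definition modulus_of :: "'a metric \<Rightarrow> 'b metric \<Rightarrow> ('a \<Rightarrow> 'b) \<Rightarrow> real \<Rightarrow> ennreal" where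
  "modulus_of m m' f t =
     (SUP (x, x')\<in>{(x, x'). x \<in> mspace m \<and> x' \<in> mspace m \<and> mdist m x x' \<le> t}.
        ennreal (mdist m' (f x) (f x')))"

definition uniformly_locally_trace_equiconnected_at :: "'a metric \<Rightarrow> 'a set \<Rightarrow> bool" where
  "uniformly_locally_trace_equiconnected_at m Y0 \<longleftrightarrow>
     (\<exists>\<epsilon>0>0. \<exists>\<omega>. continuity_modulus \<omega> \<and>
        (\<forall>x\<in>Y0. \<forall>y\<in>Y0. mdist m x y < \<epsilon>0 \<longrightarrow>
          (\<forall>Q. countable Q \<and> {0, mdist m x y} \<subseteq> Q \<and> Q \<subseteq> {0..mdist m x y} \<and>
               {0..mdist m x y} \<subseteq> closure Q \<longrightarrow>
             (\<exists>f. uniformly_continuous_map (submetric euclidean_metric Q) m f \<and>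
                  f 0 = x \<and> f (mdist m x y) = y \<and>
                  (\<forall>t>0. modulus_of (submetric euclidean_metric Q) m f t \<le> ennreal (\<omega> t))))))"

end

theory Submission
  imports Defs
begin

text \<open>
  The conditions are linked in a cycle. Two steps carry the weight: local chain connectedness of the
  hyperspace forces chains of uniformly bounded length between points of \<open>X\<close>, and traces between
  points of \<open>X\<close> are flexible enough to retract a neighbourhood in any ambient space onto \<open>H\<close>.

  From sets to points: let \<open>D = A 0, \<dots>, A k\<close> be a chain of sets with Hausdorff steps below
  \<open>\<eta>\<close>. Every point of \<open>A k\<close> is joined to a point of \<open>D\<close> by \<open>k\<close> steps below \<open>\<eta>\<close>
  (\<open>trace_chain_of_sets\<close>). One chain of sets thus bounds the lengths of infinitely many chains of
  points, and this is how a pointwise condition on the hyperspace becomes a uniform condition on \<open>X\<close>.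
  If chains in \<open>X\<close> near \<open>F\<close> cannot be bounded, infinitely many bad pairs of points are
  collected into a set \<open>D\<close> and a small perturbation \<open>D'\<close> of it, and a chain from \<open>D\<close> to
  \<open>D'\<close> gives a contradiction. Both sets must lie in \<open>D0\<close>. Every sequence has a Cauchy or a
  uniformly separated subsequence, so \<open>D\<close> can be a separated set, a single point, or a Cauchy sequence
  without a limit, and these do belong to \<open>D0\<close> (\<open>chain_equiconnected\<close>).

  From chains to traces: the links of a chain are replaced by finer and finer chains. As \<open>H\<close> is
  open, a closed neighbourhood \<open>G\<close> of \<open>F\<close> belongs to \<open>H\<close>, and the refinements are made
  in \<open>G\<close>. They define a map on a countable dense grid in \<open>[0, 1]\<close>. A countable set \<open>Q\<close>
  is carried into that grid by a Lipschitz map with constant 2 (\<open>lipschitz_into_dense\<close>), so that the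
  modulus is independent of \<open>Q\<close> (\<open>chain_equiconnected_imp_trace_equiconnected\<close>).

  From traces to retractions: pushing the points of a closed set \<open>y\<close> along their traces to nearby
  points of \<open>z\<close> makes \<open>y\<close> grow continuously to a set that contains \<open>z\<close> (\<open>growth_exists\<close>).
  The hyperspace has closures of arbitrary unions, so a point \<open>x\<close> of the ambient space can be sent to
  the closure of the union of all growths between sets \<open>y, z \<in> H\<close> whose distance from \<open>x\<close> is
  comparable to the distance from \<open>x\<close> to \<open>H\<close>. This single formula takes the place of the nerve of
  a covering in the usual proofs that a space is an ANR, and its continuity follows from the moduli of the
  growths (\<open>neighbourhood_retract\<close>). These moduli depend on the member of \<open>H\<close> that supplies the
  traces; a locally finite choice of these members (\<open>locally_finite_choice\<close>) makes them locally uniform.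

  An ANR is a neighbourhood retract of a space in which its points are joined by segments, hence it is
  locally path connected, and a path is cut into chains by uniform continuity.
\<close>

section \<open>Metric topologies by points and distances\<close>

lemma mdist_self [simp]: "x \<in> mspace m \<Longrightarrow> mdist m x x = 0"
  by simp

lemma openin_mtopology_of_iff:
  "openin (mtopology_of m) U \<longleftrightarrow>
     U \<subseteq> mspace m \<and> (\<forall>x\<in>U. \<exists>r>0. \<forall>y\<in>mspace m. mdist m x y < r \<longrightarrow> y \<in> U)"
proof -
  interpret M: Metric_space "mspace m" "mdist m" by simp
  show ?thesis
    unfolding mtopology_of_def M.openin_mtopology by (fastforce simp: subset_iff)
qed

lemma closure_of_mtopology_of_iff:
  "x \<in> mtopology_of m closure_of S \<longleftrightarrow>
     x \<in> mspace m \<and> (\<forall>r>0. \<exists>y\<in>S. y \<in> mspace m \<and> mdist m x y < r)"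
proof -
  interpret M: Metric_space "mspace m" "mdist m" by simp
  show ?thesis
    unfolding mtopology_of_def M.metric_closure_of by auto
qed

lemma continuous_map_metric_iff:
  assumes "S \<subseteq> mspace m" "T \<subseteq> mspace m'"
  shows "continuous_map (subtopology (mtopology_of m) S) (subtopology (mtopology_of m') T) f \<longleftrightarrow>
    f ` S \<subseteq> T \<and>
    (\<forall>x\<in>S. \<forall>e>0. \<exists>d>0. \<forall>y\<in>S. mdist m x y < d \<longrightarrow> mdist m' (f x) (f y) < e)"
proof -
  have "mtopology_of (submetric m S) = subtopology (mtopology_of m) S"
    "mtopology_of (submetric m' T) = subtopology (mtopology_of m') T"
    by (simp_all add: mtopology_of_submetric)
  moreover
  interpret A: Metric_space "mspace (submetric m S)" "mdist (submetric m S)" by (rule Metric_space_mspace_mdist)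
  interpret B: Metric_space "mspace (submetric m' T)" "mdist (submetric m' T)" by (rule Metric_space_mspace_mdist)
  have "continuous_map A.mtopology B.mtopology f \<longleftrightarrow> f ` S \<subseteq> T \<and>
    (\<forall>x\<in>S. \<forall>e>0. \<exists>d>0. \<forall>y\<in>S. mdist m x y < d \<longrightarrow> mdist m' (f x) (f y) < e)"
    unfolding A.metric_continuous_map[OF Metric_space_mspace_mdist]
    using assms by (simp add: Int_absorb2 inf_absorb1 image_subset_iff Ball_def imp_conjL)
  ultimately show ?thesis by (simp add: mtopology_of_def)
qed

section \<open>The Hausdorff metric by points\<close>

lemma closed_nonempty_subset: "A \<in> closed_nonempty m \<Longrightarrow> A \<subseteq> mspace m"
  using closedin_subset[of "mtopology_of m" A] by (auto simp: closed_nonempty_def)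

lemma closed_nonemptyD: "A \<in> closed_nonempty m \<Longrightarrow> a \<in> A \<Longrightarrow> a \<in> mspace m"
  using closed_nonempty_subset by blast

lemma closed_nonempty_closure:
  assumes "S \<subseteq> mspace m" "S \<noteq> {}"
  shows "mtopology_of m closure_of S \<in> closed_nonempty m"
proof -
  have "S \<subseteq> mtopology_of m closure_of S"
    using assms by (intro closure_of_subset) simp
  then show ?thesis using assms by (auto simp: closed_nonempty_def)
qed

lemma closed_nonempty_limit:
  assumes "A \<in> closed_nonempty m" "x \<in> mspace m" "\<And>r. r > 0 \<Longrightarrow> \<exists>y\<in>A. mdist m x y < r"
  shows "x \<in> A"
proof -
  have "\<exists>y\<in>A. y \<in> mspace m \<and> mdist m x y < r" if "r > 0" for r
    using assms(3)[OF that] closed_nonemptyD[OF assms(1)] by auto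
  then have "x \<in> mtopology_of m closure_of A"
    unfolding closure_of_mtopology_of_iff using assms(2) by simp
  then show ?thesis
    using assms(1) by (simp add: closed_nonempty_def closure_of_closedin)
qed

text \<open>The bound \<open>t \<le> 1\<close> is essential: the truncated metric says nothing about points
  at distance 1 or more.\<close>
lemma hyperspace_point_near:
  assumes "A \<in> closed_nonempty m" "B \<in> closed_nonempty m"
    and "mdist (hyperspace m) A B < t" "t \<le> 1" "a \<in> A"
  obtains b where "b \<in> B" "mdist m a b < t"
proof -
  have fin: "min 1 (hausdorff_dist m A B) < (top :: ennreal)"
    by (metis ennreal_one_less_top min.strict_coboundedI1)
  have t: "0 < t" using assms(3) mdist_nonneg[of "hyperspace m" A B] by linarith
  have "min 1 (hausdorff_dist m A B) < ennreal t"
    using assms(3) t fin unfolding mdist_hyperspace by (metis ennreal_enn2real ennreal_lessI)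
  moreover have "ennreal t \<le> 1" using assms(4) by (simp add: ennreal_le_1)
  ultimately have "hausdorff_dist m A B < ennreal t" by (auto simp: min_def split: if_splits)
  moreover have "setdist_pt m a B \<le> hausdorff_dist m A B"
    unfolding hausdorff_dist_def using assms(5) by (intro max.coboundedI2 SUP_upper)
  ultimately have "(INF b\<in>B. ennreal (mdist m a b)) < ennreal t"
    unfolding setdist_pt_def by (rule le_less_trans[rotated])
  then obtain b where "b \<in> B" "ennreal (mdist m a b) < ennreal t"
    by (auto simp: INF_less_iff)
  then show thesis using that t by (simp add: ennreal_less_iff)
qed

lemma hyperspace_dist_le:
  assumes "\<And>a. a \<in> A \<Longrightarrow> \<exists>b\<in>B. mdist m a b \<le> t" "\<And>b. b \<in> B \<Longrightarrow> \<exists>a\<in>A. mdist m b a \<le> t" "0 \<le> t"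
  shows "mdist (hyperspace m) A B \<le> t"
proof -
  have "setdist_pt m a C \<le> ennreal t" if "c \<in> C" "mdist m a c \<le> t" for a c C
    using setdist_pt_le[OF that(1), of m a] that(2) by (meson ennreal_leI order_trans)
  then have "hausdorff_dist m A B \<le> ennreal t"
    unfolding hausdorff_dist_def using assms(1,2)
    by (intro max.boundedI SUP_least) blast+
  then have "enn2real (min 1 (hausdorff_dist m A B)) \<le> enn2real (ennreal t)"
    by (intro enn2real_mono) (auto intro: min.coboundedI2)
  then show ?thesis using assms(3) by (simp add: mdist_hyperspace)
qed

lemma hyperspace_dist_le_1: "mdist (hyperspace m) A B \<le> 1"
  unfolding mdist_hyperspace by (rule enn2real_leI) auto

text \<open>Members of the hyperspace are built below as closures of unions. Passing to the closure costs an
  arbitrarily small amount, so distances can be estimated on the sets before they are closed.\<close>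
lemma hyperspace_dist_closure_le:
  assumes S: "S \<subseteq> mspace m" and T: "T \<subseteq> mspace m"
    and "\<And>a. a \<in> S \<Longrightarrow> \<exists>b\<in>T. mdist m a b \<le> t" "\<And>b. b \<in> T \<Longrightarrow> \<exists>a\<in>S. mdist m b a \<le> t"
    and t: "0 \<le> t"
  shows "mdist (hyperspace m) (mtopology_of m closure_of S) (mtopology_of m closure_of T) \<le> t"
proof (rule field_le_epsilon)
  fix e :: real assume e: "e > 0"
  have *: "\<exists>b\<in>mtopology_of m closure_of T. mdist m a b \<le> t + e"
    if S: "S \<subseteq> mspace m" and T: "T \<subseteq> mspace m" and st: "\<And>a. a \<in> S \<Longrightarrow> \<exists>b\<in>T. mdist m a b \<le> t"
      and a: "a \<in> mtopology_of m closure_of S" for S T a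
  proof -
    obtain s where s: "s \<in> S" "mdist m a s < e"
      using a e unfolding closure_of_mtopology_of_iff by blast
    obtain b where b: "b \<in> T" "mdist m s b \<le> t" using st s by blast
    have "mdist m a b \<le> mdist m a s + mdist m s b"
      using a S T s b by (intro mdist_triangle) (auto simp: closure_of_mtopology_of_iff)
    moreover have "b \<in> mtopology_of m closure_of T"
      using b T closure_of_subset[of T "mtopology_of m"] by auto
    ultimately show ?thesis using s b by (intro bexI[of _ b]) auto
  qed
  show "mdist (hyperspace m) (mtopology_of m closure_of S) (mtopology_of m closure_of T) \<le> t + e"
    by (rule hyperspace_dist_le) (use *[of S T] *[of T S] assms e in auto)
qed

lemma hyperspace_dist_closure_le_left:
  assumes "S \<subseteq> mspace m" and B: "B \<in> closed_nonempty m"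
    and "\<And>a. a \<in> S \<Longrightarrow> \<exists>b\<in>B. mdist m a b \<le> t" "\<And>b. b \<in> B \<Longrightarrow> \<exists>a\<in>S. mdist m b a \<le> t" "0 \<le> t"
  shows "mdist (hyperspace m) (mtopology_of m closure_of S) B \<le> t"
proof -
  have "mtopology_of m closure_of B = B"
    using B by (simp add: closed_nonempty_def closure_of_closedin)
  then show ?thesis
    using hyperspace_dist_closure_le[OF assms(1) closed_nonempty_subset[OF B] assms(3,4,5)] by simp
qed

text \<open>This is where the openness of \<open>H\<close> enters: conditions assumed for the members of \<open>H\<close> can be
  used on a whole neighbourhood of a member, so that auxiliary points outside it do no harm.\<close>
lemma closed_neighbourhood_in_open:
  assumes H: "openin (mtopology_of (hyperspace m)) H" and F: "F \<in> H"
  obtains r G where "r > 0" "r \<le> 1" "G \<in> H"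
    "\<And>a x. a \<in> F \<Longrightarrow> x \<in> mspace m \<Longrightarrow> mdist m a x < r \<Longrightarrow> x \<in> G"
proof -
  have Fc: "F \<in> closed_nonempty m"
    using H F openin_subset by fastforce
  obtain r where r: "r > 0" "\<And>G. G \<in> closed_nonempty m \<Longrightarrow> mdist (hyperspace m) F G < r \<Longrightarrow> G \<in> H"
    using H F unfolding openin_mtopology_of_iff by auto
  define s where "s = min 1 (r/2)"
  have s: "s > 0" "s \<le> 1" "s < r" using r by (auto simp: s_def)
  define S where "S = {x \<in> mspace m. \<exists>a\<in>F. mdist m a x < s}"
  have FS: "F \<subseteq> S"
    using closed_nonemptyD[OF Fc] s mdist_self unfolding S_def by force
  have Sm: "S \<subseteq> mspace m" by (auto simp: S_def)
  have Fne: "F \<noteq> {}" using Fc by (auto simp: closed_nonempty_def)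
  have "mdist (hyperspace m) (mtopology_of m closure_of S) F \<le> s"
  proof (rule hyperspace_dist_closure_le_left[OF Sm Fc])
    fix b assume "b \<in> F"
    then show "\<exists>a\<in>S. mdist m b a \<le> s"
      using FS s closed_nonemptyD[OF Fc] by (intro bexI[of _ b]) auto
  next
    fix a assume "a \<in> S"
    then obtain b where "b \<in> F" "mdist m b a < s" by (auto simp: S_def)
    then show "\<exists>b\<in>F. mdist m a b \<le> s"
      by (intro bexI[of _ b]) (simp_all add: mdist_commute)
  qed (use s in auto)
  then have "mdist (hyperspace m) F (mtopology_of m closure_of S) < r"
    using s by (simp add: mdist_commute)
  then have "mtopology_of m closure_of S \<in> H"
    using FS Fne Sm by (intro r closed_nonempty_closure) auto
  moreover have "x \<in> mtopology_of m closure_of S" if "a \<in> F" "x \<in> mspace m" "mdist m a x < s" for a x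
  proof -
    have "x \<in> S" using that by (auto simp: S_def)
    then show ?thesis using closure_of_subset[of S "mtopology_of m"] Sm by auto
  qed
  ultimately show thesis using that s by blast
qed

section \<open>Chains as powers of a relation\<close>

text \<open>A chain with \<open>k\<close> steps below \<open>\<eta>\<close> in \<open>S\<close> is a pair in the \<open>k\<close>-th power of
  this relation. Chains then concatenate by composition, and containment in \<open>S\<close> replaces the
  bound on the diameter.\<close>
definition close_rel :: "'a metric \<Rightarrow> real \<Rightarrow> 'a set \<Rightarrow> ('a \<times> 'a) set" where
  "close_rel m \<eta> S = {(x, y). x \<in> S \<and> y \<in> S \<and> mdist m x y < \<eta>}"

lemma close_rel_power_sym: "(x, y) \<in> close_rel m \<eta> S ^^ k \<Longrightarrow> (y, x) \<in> close_rel m \<eta> S ^^ k"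
proof (induction k arbitrary: y)
  case (Suc k)
  then obtain z where "(x, z) \<in> close_rel m \<eta> S ^^ k" "(z, y) \<in> close_rel m \<eta> S" by auto
  moreover from this have "(y, z) \<in> close_rel m \<eta> S" by (auto simp: close_rel_def mdist_commute)
  ultimately show ?case using Suc.IH by (meson relpow_Suc_I2)
qed auto

lemma close_rel_power_mono:
  assumes "(x, y) \<in> close_rel m \<eta> S ^^ k" "\<eta> \<le> \<eta>'" "S \<subseteq> S'"
  shows "(x, y) \<in> close_rel m \<eta>' S' ^^ k"
proof -
  have "close_rel m \<eta> S \<subseteq> close_rel m \<eta>' S'" using assms(2,3) by (auto simp: close_rel_def)
  then show ?thesis using assms(1) unfolding relpow_fun_conv by blast
qed

text \<open>Repeating the endpoint makes chains longer, so bounds on lengths can be handled as exact lengths.\<close>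
lemma close_rel_power_pad:
  assumes "(x, y) \<in> close_rel m \<eta> S ^^ k" "k \<le> n" "y \<in> S" "S \<subseteq> mspace m" "\<eta> > 0"
  shows "(x, y) \<in> close_rel m \<eta> S ^^ n"
  using assms(2)
proof (induction rule: dec_induct)
  case base show ?case by fact
next
  case (step n)
  have "(y, y) \<in> close_rel m \<eta> S"
    using assms(3-5) mdist_self[of y m] unfolding close_rel_def by auto
  then show ?case using step.IH by auto
qed

lemma close_rel_power_trans:
  "(x, y) \<in> close_rel m \<eta> S ^^ k \<Longrightarrow> (y, z) \<in> close_rel m \<eta> S ^^ n \<Longrightarrow> (x, z) \<in> close_rel m \<eta> S ^^ (k + n)"
  by (rule relpow_trans)

lemma chain_diam_less_iff:
  "chain_diam m l c < e \<longleftrightarrow> (\<forall>i\<le>l. \<forall>j\<le>l. mdist m (c i) (c j) < e)"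
proof -
  have "{mdist m (c i) (c j) | i j. i \<in> {0..l} \<and> j \<in> {0..l}} = (\<lambda>(i,j). mdist m (c i) (c j)) ` ({0..l} \<times> {0..l})"
    by auto blast
  then have "chain_diam m l c = Max ((\<lambda>(i,j). mdist m (c i) (c j)) ` ({0..l} \<times> {0..l}))"
    unfolding chain_diam_def by simp
  then have "chain_diam m l c < e \<longleftrightarrow> (\<forall>z\<in>(\<lambda>(i,j). mdist m (c i) (c j)) ` ({0..l} \<times> {0..l}). z < e)"
    by simp
  then show ?thesis by auto
qed

lemma close_rel_power_imp_chain:
  assumes "(x, y) \<in> close_rel m \<eta> S ^^ k" "x \<in> S" "S \<subseteq> mspace m"
    "\<And>p q. p \<in> S \<Longrightarrow> q \<in> S \<Longrightarrow> mdist m p q < e"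
  obtains c where "chain_linking m \<eta> k c x y" "chain_diam m k c < e"
proof -
  obtain c where c: "c 0 = x" "c k = y" "\<And>i. i < k \<Longrightarrow> (c i, c (Suc i)) \<in> close_rel m \<eta> S"
    using assms(1) by (auto simp: relpow_fun_conv)
  have S: "c i \<in> S" if "i \<le> k" for i
  proof (cases i)
    case (Suc j) then show ?thesis using c(3)[of j] that by (auto simp: close_rel_def)
  qed (use c assms in auto)
  have "chain_linking m \<eta> k c x y"
    unfolding chain_linking_def
  proof (intro conjI ballI)
    fix i assume "i \<in> {1..k}"
    then show "mdist m (c i) (c (i - 1)) < \<eta>"
      using c(3)[of "i - 1"] by (auto simp: close_rel_def mdist_commute)
  qed (use c S assms in auto)
  moreover have "chain_diam m k c < e"
    unfolding chain_diam_less_iff using S assms by auto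
  ultimately show thesis by (rule that)
qed

definition chain_linked :: "'a metric \<Rightarrow> real \<Rightarrow> real \<Rightarrow> nat \<Rightarrow> 'a \<Rightarrow> 'a \<Rightarrow> bool" where
  "chain_linked m \<epsilon> \<eta> l x y \<longleftrightarrow> (\<exists>k c. k \<le> l \<and> chain_linking m \<eta> k c x y \<and> chain_diam m k c < \<epsilon>)"

lemma equiconnected_iff_chain_linked:
  "uniformly_locally_chain_equiconnected_at m Y0 \<longleftrightarrow>
    (\<forall>\<epsilon>>0. \<exists>\<delta>>0. \<forall>\<eta>>0. \<exists>l. \<forall>x\<in>Y0. \<forall>y\<in>Y0. mdist m x y < \<delta> \<longrightarrow> chain_linked m \<epsilon> \<eta> l x y)"
  unfolding uniformly_locally_chain_equiconnected_at_def chain_linked_def ..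


section \<open>Absolute neighbourhood retracts are locally path connected\<close>

text \<open>The ambient space is the union of all segments between points of the Kuratowski image
  \<open>x \<mapsto> mdist Y x\<close> in the bounded functions. The image is closed in it: a function on the inner part of a
  segment with distinct ends \<open>x, y\<close> is bounded below by \<open>min t (1 - t) * mdist Y x y\<close>, whereas the image of
  \<open>z\<close> vanishes at \<open>z\<close>. Segments between two points suffice, because paths are needed only from a
  base point to a nearby point.\<close>
locale bounded_metric =
  fixes Y :: "'b metric"
  assumes le_1: "\<And>x y. mdist Y x y \<le> 1"
begin

definition seg :: "'b \<Rightarrow> 'b \<Rightarrow> real \<Rightarrow> 'b \<Rightarrow> real" where
  "seg x y t z = (if z \<in> mspace Y then (1 - t) * mdist Y x z + t * mdist Y y z else 0)"

definition segs :: "('b \<Rightarrow> real) set" where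
  "segs = {seg x y t | x y t. x \<in> mspace Y \<and> y \<in> mspace Y \<and> 0 \<le> t \<and> t \<le> 1}"

text \<open>The truncation at 1 has no effect on the functions in \<^term>\<open>segs\<close>; it keeps the supremum bounded for
  all pairs of functions, so that the distance is nonnegative outside the carrier too.\<close>
definition sup_dist :: "('b \<Rightarrow> real) \<Rightarrow> ('b \<Rightarrow> real) \<Rightarrow> real" where
  "sup_dist f g = (SUP z. min 1 \<bar>f z - g z\<bar>)"

lemma seg_in: "x \<in> mspace Y \<Longrightarrow> y \<in> mspace Y \<Longrightarrow> 0 \<le> t \<Longrightarrow> t \<le> 1 \<Longrightarrow> seg x y t \<in> segs"
  unfolding segs_def by blast

lemma segs_bounds: assumes "f \<in> segs" shows "0 \<le> f z \<and> f z \<le> 1"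
proof -
  obtain x y t where f: "f = seg x y t" "0 \<le> t" "t \<le> 1" using assms unfolding segs_def by blast
  have "(1 - t) * mdist Y x z + t * mdist Y y z \<le> (1 - t) * 1 + t * 1"
    using f le_1 by (intro add_mono mult_left_mono) auto
  then show ?thesis using f by (auto simp: seg_def)
qed

lemma bdd: "bdd_above (range (\<lambda>z. min 1 \<bar>f z - g z\<bar>))" for f g :: "'b \<Rightarrow> real"
  by (rule bdd_aboveI2[of _ _ 1]) simp

lemma sup_dist_le: "(\<And>z. \<bar>f z - g z\<bar> \<le> c) \<Longrightarrow> sup_dist f g \<le> c"
  unfolding sup_dist_def by (rule cSUP_least) (auto intro: min.coboundedI2)

lemma sup_dist_nonneg: "0 \<le> sup_dist f g"
  unfolding sup_dist_def by (rule cSUP_upper2[OF bdd]) auto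

lemma le_sup_dist: assumes "f \<in> segs" "g \<in> segs" shows "\<bar>f z - g z\<bar> \<le> sup_dist f g"
proof -
  have "\<bar>f z - g z\<bar> \<le> 1"
    using segs_bounds[OF assms(1), of z] segs_bounds[OF assms(2), of z] by (simp add: abs_le_iff)
  moreover have "min 1 \<bar>f z - g z\<bar> \<le> sup_dist f g"
    unfolding sup_dist_def by (rule cSUP_upper[OF _ bdd]) simp
  ultimately show ?thesis by simp
qed

definition ambient :: "(('b \<Rightarrow> real) + 'u) metric" where
  "ambient = metric (Inl ` segs, \<lambda>p q. sup_dist (projl p) (projl q))"

lemma Metric_space_ambient: "Metric_space (Inl ` segs :: (('b \<Rightarrow> real) + 'u) set) (\<lambda>p q. sup_dist (projl p) (projl q))"
proof
  fix p q r :: "('b \<Rightarrow> real) + 'u"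
  show "0 \<le> sup_dist (projl p) (projl q)" by (rule sup_dist_nonneg)
  show "sup_dist (projl p) (projl q) = sup_dist (projl q) (projl p)"
    by (simp add: sup_dist_def abs_minus_commute)
  assume "p \<in> Inl ` segs" "q \<in> Inl ` segs"
  then obtain f g where fg: "p = Inl f" "q = Inl g" "f \<in> segs" "g \<in> segs" by blast
  show "sup_dist (projl p) (projl q) = 0 \<longleftrightarrow> p = q"
  proof
    assume "sup_dist (projl p) (projl q) = 0"
    then have "\<bar>f z - g z\<bar> \<le> 0" for z using le_sup_dist[OF fg(3,4), of z] fg by simp
    then have "f = g" by (intro ext) simp
    then show "p = q" using fg by simp
  next
    assume "p = q"
    then have "sup_dist (projl p) (projl q) \<le> 0" by (intro sup_dist_le) simp
    then show "sup_dist (projl p) (projl q) = 0" using sup_dist_nonneg[of "projl p" "projl q"] by simp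
  qed
  assume "r \<in> Inl ` segs"
  then obtain h where h: "r = Inl h" "h \<in> segs" by blast
  have "\<bar>f z - h z\<bar> \<le> sup_dist f g + sup_dist g h" for z
    using le_sup_dist[OF fg(3,4), of z] le_sup_dist[OF fg(4) h(2), of z] by linarith
  then show "sup_dist (projl p) (projl r) \<le> sup_dist (projl p) (projl q) + sup_dist (projl q) (projl r)"
    using fg h by (simp add: sup_dist_le)
qed

lemma mspace_ambient: "mspace ambient = Inl ` segs"
  unfolding ambient_def by (rule Metric_space.mspace_metric[OF Metric_space_ambient])

lemma mdist_ambient: "mdist ambient p q = sup_dist (projl p) (projl q)"
  unfolding ambient_def by (simp add: Metric_space.mdist_metric[OF Metric_space_ambient])

definition emb :: "'b \<Rightarrow> ('b \<Rightarrow> real) + 'u" where "emb x = Inl (seg x x 0)"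

lemma emb_in: "x \<in> mspace Y \<Longrightarrow> emb x \<in> mspace ambient"
  unfolding emb_def mspace_ambient by (intro imageI seg_in) auto

lemma seg_dist:
  assumes x: "x \<in> mspace Y" "y \<in> mspace Y" and t: "0 \<le> t" "t \<le> 1" and s: "0 \<le> s" "s \<le> 1"
  shows "sup_dist (seg x y t) (seg x y s) \<le> \<bar>t - s\<bar> * mdist Y x y"
proof (rule sup_dist_le)
  fix z
  have "\<bar>mdist Y y z - mdist Y x z\<bar> \<le> mdist Y x y" if z: "z \<in> mspace Y"
    using mdist_triangle[of y Y x z] mdist_triangle[of x Y y z] x z by (simp add: mdist_commute[of Y y x] abs_le_iff)
  moreover have "seg x y t z - seg x y s z = (t - s) * (mdist Y y z - mdist Y x z)" if "z \<in> mspace Y"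
    using that by (simp add: seg_def algebra_simps)
  ultimately show "\<bar>seg x y t z - seg x y s z\<bar> \<le> \<bar>t - s\<bar> * mdist Y x y"
    by (cases "z \<in> mspace Y") (simp_all add: abs_mult mult_left_mono seg_def)
qed

lemma seg_ends: "seg x y 0 = seg x x 0" "seg x y 1 = seg y y 0"
  by (auto simp: seg_def)

lemma emb_isometry:
  assumes x: "x \<in> mspace Y" "y \<in> mspace Y"
  shows "mdist ambient (emb x) (emb y) = mdist Y x y"
proof (rule antisym)
  have "sup_dist (seg x y 0) (seg x y 1) \<le> \<bar>0 - 1\<bar> * mdist Y x y" using x by (intro seg_dist) auto
  then show "mdist ambient (emb x) (emb y) \<le> mdist Y x y"
    by (simp add: mdist_ambient emb_def seg_ends[of x y])
  have "\<bar>seg x x 0 y - seg y y 0 y\<bar> \<le> sup_dist (seg x x 0) (seg y y 0)"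
    using x by (intro le_sup_dist seg_in) auto
  then show "mdist Y x y \<le> mdist ambient (emb x) (emb y)"
    using x by (simp add: mdist_ambient emb_def seg_def)
qed

lemma emb_closed: "closedin (mtopology_of ambient) (emb ` mspace Y)"
proof -
  have "openin (mtopology_of ambient) (mspace ambient - emb ` mspace Y)"
    unfolding openin_mtopology_of_iff
  proof (intro conjI ballI)
    fix p assume p: "p \<in> mspace ambient - emb ` mspace Y"
    then obtain x y t where x: "p = Inl (seg x y t)" "x \<in> mspace Y" "y \<in> mspace Y" "0 \<le> t" "t \<le> 1"
      unfolding mspace_ambient segs_def by blast
    have emb: "emb z \<in> emb ` mspace Y" if "z \<in> mspace Y" for z using that by blast
    have ne: "t \<noteq> 0" "t \<noteq> 1" "x \<noteq> y"
    proof -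
      show "t \<noteq> 0" using p x emb[of x] seg_ends[of x y] by (auto simp: emb_def)
      show "t \<noteq> 1" using p x emb[of y] seg_ends[of x y] by (auto simp: emb_def)
      have "seg x x t = seg x x 0" by (auto simp: seg_def algebra_simps)
      then show "x \<noteq> y" using p x emb[of x] by (auto simp: emb_def)
    qed
    define c where "c = min t (1 - t) * mdist Y x y"
    have t: "0 < min t (1 - t)" using ne x by auto
    have dxy: "0 < mdist Y x y" using ne(3) x(2,3) by (simp add: less_le)
    have c: "c > 0" unfolding c_def using t dxy by (rule mult_pos_pos)
    have "\<not> mdist ambient p q < c" if q: "q \<in> emb ` mspace Y" for q
    proof -
      obtain z where z: "z \<in> mspace Y" "q = emb z" using q by blast
      have "c \<le> min t (1 - t) * (mdist Y x z + mdist Y y z)"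
        unfolding c_def using t mdist_triangle[of x Y z y] x z by (intro mult_left_mono) (auto simp: mdist_commute)
      also have "\<dots> = min t (1 - t) * mdist Y x z + min t (1 - t) * mdist Y y z" by (simp add: algebra_simps)
      also have "\<dots> \<le> (1 - t) * mdist Y x z + t * mdist Y y z"
        by (intro add_mono mult_right_mono) auto
      also have "\<dots> = \<bar>seg x y t z - seg z z 0 z\<bar>" using z x by (simp add: seg_def)
      also have "\<dots> \<le> sup_dist (seg x y t) (seg z z 0)" using x z by (intro le_sup_dist seg_in) auto
      also have "\<dots> = mdist ambient p q" using x z by (simp add: mdist_ambient emb_def)
      finally show ?thesis by simp
    qed
    then show "\<exists>r>0. \<forall>q\<in>mspace ambient. mdist ambient p q < r \<longrightarrow> q \<in> mspace ambient - emb ` mspace Y"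
      using c by (intro exI[of _ c]) blast
  qed auto
  then show ?thesis using emb_in by (auto simp: closedin_def)
qed

text \<open>Segments from \<open>emb x0\<close> to \<open>emb x\<close> are short when \<open>x\<close> is near \<open>x0\<close>; the
  retraction carries them to paths that stay near \<open>x0\<close>.\<close>
theorem metric_ANR_imp_locally_path_connected:
  assumes "metric_ANR TYPE(('b \<Rightarrow> real) + 'u) Y"
  shows "locally_path_connected_space (mtopology_of Y)"
proof -
  let ?M = "ambient :: (('b \<Rightarrow> real) + 'u) metric"
  let ?e = "emb :: 'b \<Rightarrow> ('b \<Rightarrow> real) + 'u"
  have iso: "mdist ?M (?e x) (?e y) = mdist Y x y" if "x \<in> mspace Y" "y \<in> mspace Y" for x y
    using emb_isometry[OF that] .
  have "?e ` mspace Y \<subseteq> mspace ?M \<and>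
        (\<forall>x\<in>mspace Y. \<forall>y\<in>mspace Y. mdist ?M (?e x) (?e y) = mdist Y x y) \<and>
        closedin (mtopology_of ?M) (?e ` mspace Y)"
    using emb_in iso emb_closed by blast
  from assms[unfolded metric_ANR_def, THEN spec, THEN spec, THEN mp, OF this]
  obtain W where W: "openin (mtopology_of ?M) W" "?e ` mspace Y \<subseteq> W"
    and ret: "?e ` mspace Y retract_of_space subtopology (mtopology_of ?M) W" by (elim exE conjE)
  have Wm: "W \<subseteq> mspace ?M" using openin_subset[OF W(1)] by simp
  obtain r where "continuous_map (subtopology (mtopology_of ?M) W) (subtopology (subtopology (mtopology_of ?M) W) (?e ` mspace Y)) r"
    and rid: "\<forall>x\<in>?e ` mspace Y. r x = x"
    using ret unfolding retract_of_space_def by blast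
  then have cont: "continuous_map (subtopology (mtopology_of ?M) W) (subtopology (mtopology_of ?M) (?e ` mspace Y)) r"
    using W(2) by (simp add: subtopology_subtopology Int_absorb1)
  have eYm: "?e ` mspace Y \<subseteq> mspace ?M" using W(2) Wm by blast
  have r: "r ` W \<subseteq> ?e ` mspace Y"
    and rc: "\<And>x \<epsilon>. x \<in> W \<Longrightarrow> \<epsilon> > 0 \<Longrightarrow> \<exists>\<delta>>0. \<forall>y\<in>W. mdist ?M x y < \<delta> \<longrightarrow> mdist ?M (r x) (r y) < \<epsilon>"
    using cont unfolding continuous_map_metric_iff[OF Wm eYm] by simp_all
  \<comment> \<open>The retraction, read as a map into \<open>Y\<close>.\<close>
  define pr where "pr p = (SOME y. y \<in> mspace Y \<and> ?e y = r p)" for p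
  have pr: "pr p \<in> mspace Y" "?e (pr p) = r p" if "p \<in> W" for p
  proof -
    have "\<exists>y. y \<in> mspace Y \<and> ?e y = r p" using r that by force
    from someI_ex[OF this] show "pr p \<in> mspace Y" "?e (pr p) = r p" unfolding pr_def by blast+
  qed
  have e_inj: "x = y" if "x \<in> mspace Y" "y \<in> mspace Y" "?e x = ?e y" for x y
  proof -
    have "mdist Y x y = mdist ?M (?e x) (?e x)" using iso[OF that(1,2)] that(3) by simp
    also have "\<dots> = 0" using eYm that(1) by (intro mdist_self) blast
    finally show ?thesis using that by simp
  qed
  have pr_e: "pr (?e x) = x" if "x \<in> mspace Y" for x
  proof (rule e_inj)
    have "?e x \<in> W" using W(2) that by blast
    then show "pr (?e x) \<in> mspace Y" "?e (pr (?e x)) = ?e x" using pr rid that by auto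
  qed fact
  show ?thesis
    unfolding locally_path_connected_space_iff_paths
  proof (intro ballI allI impI)
    fix x0 U assume "x0 \<in> topspace (mtopology_of Y)" and U: "openin (mtopology_of Y) U \<and> x0 \<in> U"
    then have x0: "x0 \<in> mspace Y" by simp
    obtain \<epsilon> where \<epsilon>: "\<epsilon> > 0" "\<forall>y\<in>mspace Y. mdist Y x0 y < \<epsilon> \<longrightarrow> y \<in> U"
      using U unfolding openin_mtopology_of_iff by blast
    have Um: "U \<subseteq> mspace Y" using U openin_subset by fastforce
    have ex0: "?e x0 \<in> W" using W(2) x0 by blast
    obtain \<delta>1 where \<delta>1: "\<delta>1 > 0" "\<forall>y\<in>mspace ?M. mdist ?M (?e x0) y < \<delta>1 \<longrightarrow> y \<in> W"
      using W(1) ex0 unfolding openin_mtopology_of_iff by blast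
    obtain \<delta>2 where \<delta>2: "\<delta>2 > 0" "\<forall>y\<in>W. mdist ?M (?e x0) y < \<delta>2 \<longrightarrow> mdist ?M (r (?e x0)) (r y) < \<epsilon>"
      using rc[OF ex0 \<epsilon>(1)] by blast
    define \<delta> where "\<delta> = min \<delta>1 \<delta>2"
    have \<delta>: "\<delta> > 0" "\<delta> \<le> \<delta>1" "\<delta> \<le> \<delta>2" using \<delta>1 \<delta>2 by (auto simp: \<delta>_def)
    define V where "V = {x \<in> mspace Y. mdist Y x0 x < \<delta>}"
    have "\<exists>f. pathin (subtopology (mtopology_of Y) U) f \<and> f 0 = x0 \<and> f 1 = x" if xV: "x \<in> V" for x
    proof -
      have x: "x \<in> mspace Y" "mdist Y x0 x < \<delta>" using xV by (auto simp: V_def)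
      define s :: "real \<Rightarrow> ('b \<Rightarrow> real) + 'u" where "s t = Inl (seg x0 x t)" for t
      have sm: "s t \<in> mspace ?M" if "t \<in> {0..1}" for t
        unfolding s_def mspace_ambient using x0 x that by (intro imageI seg_in) auto
      have sd: "mdist ?M (s t) (s t') \<le> \<bar>t - t'\<bar> * mdist Y x0 x" if "t \<in> {0..1}" "t' \<in> {0..1}" for t t'
        using seg_dist[OF x0 x(1), of t t'] that by (simp add: mdist_ambient s_def)
      have s0: "s 0 = ?e x0" "s 1 = ?e x" by (simp_all add: s_def emb_def seg_ends[of x0 x])
      have near: "mdist ?M (?e x0) (s t) < \<delta>" if "t \<in> {0..1}" for t
      proof -
        have "mdist ?M (s 0) (s t) \<le> \<bar>0 - t\<bar> * mdist Y x0 x" using that by (intro sd) auto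
        also have "\<dots> \<le> 1 * mdist Y x0 x" using that by (intro mult_right_mono) auto
        finally show ?thesis using x(2) s0 by simp
      qed
      have sW: "s t \<in> W" if "t \<in> {0..1}" for t using \<delta>1(2) sm[OF that] near[OF that] \<delta>(2) by force
      define f where "f t = pr (s t)" for t
      have fm: "f t \<in> mspace Y" if "t \<in> {0..1}" for t using pr(1)[OF sW[OF that]] by (simp add: f_def)
      have fd: "mdist Y (f t) (f t') = mdist ?M (r (s t)) (r (s t'))" if "t \<in> {0..1}" "t' \<in> {0..1}" for t t'
        using iso[OF fm[OF that(1)] fm[OF that(2)]] pr(2)[OF sW[OF that(1)]] pr(2)[OF sW[OF that(2)]] by (simp add: f_def)
      have f0: "f 0 = x0" "f 1 = x" using s0 pr_e x0 x by (simp_all add: f_def)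
      have fU: "f t \<in> U" if "t \<in> {0..1}" for t
      proof -
        have "mdist ?M (r (?e x0)) (r (s t)) < \<epsilon>" using \<delta>2(2) sW[OF that] near[OF that] \<delta>(3) by force
        then have "mdist Y (f 0) (f t) < \<epsilon>" using fd[of 0 t] that s0 by simp
        then show ?thesis using \<epsilon>(2) fm[OF that] f0 by simp
      qed
      have "continuous_map (subtopology (mtopology_of euclidean_metric) {0..1::real}) (subtopology (mtopology_of Y) U) f"
      proof (subst continuous_map_metric_iff)
        show "f ` {0..1} \<subseteq> U \<and> (\<forall>x\<in>{0..1}. \<forall>e>0. \<exists>d>0. \<forall>y\<in>{0..1}. mdist euclidean_metric x y < d \<longrightarrow> mdist Y (f x) (f y) < e)"
        proof (intro conjI ballI allI impI)
          show "f ` {0..1} \<subseteq> U" using fU by blast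
          fix t e :: real assume t: "t \<in> {0..1}" and e: "e > 0"
          obtain d where d: "d > 0" "\<forall>y\<in>W. mdist ?M (s t) y < d \<longrightarrow> mdist ?M (r (s t)) (r y) < e"
            using rc[OF sW[OF t] e] by blast
          have "mdist Y (f t) (f t') < e" if t': "t' \<in> {0..1}" "dist t t' < d" for t'
          proof -
            have "mdist ?M (s t) (s t') \<le> \<bar>t - t'\<bar> * mdist Y x0 x" by (rule sd[OF t t'(1)])
            also have "\<dots> \<le> \<bar>t - t'\<bar> * 1" using le_1 by (intro mult_left_mono) auto
            finally have "mdist ?M (s t) (s t') < d" using t'(2) by (simp add: dist_real_def)
            then show ?thesis using d(2) sW[OF t'(1)] fd[OF t t'(1)] by simp
          qed
          then show "\<exists>d>0. \<forall>y\<in>{0..1}. mdist euclidean_metric t y < d \<longrightarrow> mdist Y (f t) (f y) < e"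
            using d(1) by auto
        qed
      qed (use Um in auto)
      then have "pathin (subtopology (mtopology_of Y) U) f" by (simp add: pathin_def)
      then show ?thesis using f0 by blast
    qed
    moreover have "openin (mtopology_of Y) V"
      unfolding openin_mtopology_of_iff
    proof (intro conjI ballI)
      fix x assume "x \<in> V"
      then have x: "x \<in> mspace Y" "mdist Y x0 x < \<delta>" by (auto simp: V_def)
      have "y \<in> V" if "y \<in> mspace Y" "mdist Y x y < \<delta> - mdist Y x0 x" for y
        using mdist_triangle[OF x0 x(1) that(1)] that by (simp add: V_def)
      then show "\<exists>r>0. \<forall>y\<in>mspace Y. mdist Y x y < r \<longrightarrow> y \<in> V"
        using x by (intro exI[of _ "\<delta> - mdist Y x0 x"]) auto
    qed (auto simp: V_def)
    moreover have "x0 \<in> V" using x0 \<delta> by (simp add: V_def)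
    ultimately show "\<exists>V. openin (mtopology_of Y) V \<and> x0 \<in> V \<and>
          (\<forall>x\<in>V. \<exists>f. pathin (subtopology (mtopology_of Y) U) f \<and> f 0 = x0 \<and> f 1 = x)"
      by blast
  qed
qed

end

section \<open>From paths to chains\<close>

theorem locally_path_connected_imp_locally_chain_connected:
  assumes lpc: "locally_path_connected_space (mtopology_of m)"
  shows "locally_chain_connected m"
  unfolding locally_chain_connected_def locally_chain_connected_at_def
proof (intro ballI allI impI)
  fix x0 and \<epsilon> :: real assume x0: "x0 \<in> mspace m" and \<epsilon>: "\<epsilon> > 0"
  define U where "U = {x \<in> mspace m. mdist m x0 x < \<epsilon> / 2}"
  have "openin (mtopology_of m) U"
    unfolding openin_mtopology_of_iff
  proof (intro conjI ballI)
    fix x assume "x \<in> U"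
    then have x: "x \<in> mspace m" "mdist m x0 x < \<epsilon> / 2" by (auto simp: U_def)
    have "y \<in> U" if "y \<in> mspace m" "mdist m x y < \<epsilon> / 2 - mdist m x0 x" for y
      using mdist_triangle[OF x0 x(1) that(1)] that by (simp add: U_def)
    then show "\<exists>r>0. \<forall>y\<in>mspace m. mdist m x y < r \<longrightarrow> y \<in> U"
      using x by (intro exI[of _ "\<epsilon> / 2 - mdist m x0 x"]) auto
  qed (auto simp: U_def)
  moreover have "x0 \<in> U" using x0 \<epsilon> by (simp add: U_def)
  ultimately obtain V where V: "openin (mtopology_of m) V" "x0 \<in> V"
    "\<forall>x\<in>V. \<exists>f. pathin (subtopology (mtopology_of m) U) f \<and> f 0 = x0 \<and> f 1 = x"
    using lpc x0 unfolding locally_path_connected_space_iff_paths by (metis topspace_mtopology_of)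
  obtain \<delta> where \<delta>: "\<delta> > 0" "\<forall>y\<in>mspace m. mdist m x0 y < \<delta> \<longrightarrow> y \<in> V"
    using V(1,2) unfolding openin_mtopology_of_iff by blast
  have "\<exists>l c. chain_linking m \<eta> l c x0 x \<and> chain_diam m l c < \<epsilon>"
    if \<eta>: "\<eta> > 0" and x: "x \<in> mspace m" "mdist m x x0 < \<delta>" for \<eta> x
  proof -
    have "x \<in> V" using \<delta>(2) x by (simp add: mdist_commute)
    then obtain f where f: "pathin (subtopology (mtopology_of m) U) f" "f 0 = x0" "f 1 = x" using V(3) by blast
    let ?I = "submetric euclidean_metric {0..1::real}"
    have top: "mtopology_of ?I = subtopology euclidean {0..1}" by (simp add: mtopology_of_submetric)
    have "continuous_map (mtopology_of ?I) (mtopology_of m) f" "f ` {0..1} \<subseteq> U"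
      using f(1) unfolding top pathin_def by (auto simp: continuous_map_in_subtopology)
    moreover have "compact_space (mtopology_of ?I)"
      unfolding top by (simp add: compact_space_subtopology)
    ultimately have "uniformly_continuous_map ?I m f" by (intro continuous_imp_uniformly_continuous_map) simp
    then obtain d where d: "d > 0" "\<forall>s\<in>{0..1}. \<forall>t\<in>{0..1}. dist t s < d \<longrightarrow> mdist m (f t) (f s) < \<eta>"
      using \<eta> unfolding uniformly_continuous_map_def by auto
    obtain N where N: "inverse (real (Suc N)) < d" using reals_Archimedean[OF d(1)] by blast
    define c where "c i = f (real i / real (Suc N))" for i
    have cI: "real i / real (Suc N) \<in> {0..1}" if "i \<le> Suc N" for i using that by auto
    have cU: "c i \<in> U" if "i \<le> Suc N" for i
      using \<open>f ` {0..1} \<subseteq> U\<close> cI[OF that] unfolding c_def by blast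
    have "chain_linking m \<eta> (Suc N) c x0 x"
      unfolding chain_linking_def
    proof (intro conjI ballI)
      show "c 0 = x0" "c (Suc N) = x" using f by (simp_all add: c_def)
      show "c i \<in> mspace m" if "i \<in> {0..Suc N}" for i using cU that by (auto simp: U_def)
      fix i assume i: "i \<in> {1..Suc N}"
      have "real i / real (Suc N) - real (i - 1) / real (Suc N) = inverse (real (Suc N))"
        using i by (simp add: of_nat_diff diff_divide_distrib[symmetric] inverse_eq_divide)
      then have "dist (real i / real (Suc N)) (real (i - 1) / real (Suc N)) < d"
        using N by (simp add: dist_real_def)
      then show "mdist m (c i) (c (i - 1)) < \<eta>"
        unfolding c_def using d(2) cI[of i] cI[of "i - 1"] i by auto
    qed
    moreover have "chain_diam m (Suc N) c < \<epsilon>"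
      unfolding chain_diam_less_iff
    proof (intro allI impI)
      fix i j assume "i \<le> Suc N" "j \<le> Suc N"
      then have "c i \<in> U" "c j \<in> U" using cU by auto
      then show "mdist m (c i) (c j) < \<epsilon>"
        using mdist_triangle[of "c i" m x0 "c j"] x0 by (auto simp: U_def mdist_commute)
    qed
    ultimately show ?thesis by blast
  qed
  then show "\<exists>\<delta>>0. \<forall>\<eta>>0. \<forall>x\<in>mspace m. mdist m x x0 < \<delta> \<longrightarrow>
      (\<exists>l c. chain_linking m \<eta> l c x0 x \<and> chain_diam m l c < \<epsilon>)"
    using \<delta>(1) by blast
qed

lemma locally_chain_connected_at_of_submetric:
  assumes "locally_chain_connected (submetric m H)" "A \<subseteq> H" "H \<subseteq> mspace m"
  shows "locally_chain_connected_at m A"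
  unfolding locally_chain_connected_at_def
proof (intro ballI allI impI)
  fix x0 and \<epsilon> :: real assume "x0 \<in> A" "\<epsilon> > 0"
  have sp: "mspace (submetric m H) = H" using assms(3) by auto
  have lift: "chain_linking m \<eta> l c x y \<and> chain_diam m l c < \<epsilon>"
    if "chain_linking (submetric m H) \<eta> l c x y \<and> chain_diam (submetric m H) l c < \<epsilon>" for \<eta> l c x y
    using that assms(3) by (auto simp: chain_linking_def chain_diam_def)
  obtain \<delta> where \<delta>: "\<delta> > 0" "\<forall>\<eta>>0. \<forall>x\<in>H. mdist m x x0 < \<delta> \<longrightarrow>
      (\<exists>l c. chain_linking (submetric m H) \<eta> l c x0 x \<and> chain_diam (submetric m H) l c < \<epsilon>)"
    using assms(1)[unfolded locally_chain_connected_def locally_chain_connected_at_def sp, THEN bspec, of x0, THEN spec, of \<epsilon>]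
      \<open>x0 \<in> A\<close> \<open>\<epsilon> > 0\<close> assms(2) by auto
  have "\<exists>l c. chain_linking m \<eta> l c x0 x \<and> chain_diam m l c < \<epsilon>" if "\<eta> > 0" "x \<in> A" "mdist m x x0 < \<delta>" for \<eta> x
  proof -
    have "x \<in> H" using that assms(2) by blast
    from \<delta>(2)[THEN spec, THEN mp, OF that(1), THEN bspec, OF this, THEN mp, OF that(3)]
    show ?thesis using lift by (elim exE) (intro exI, blast)
  qed
  then show "\<exists>\<delta>>0. \<forall>\<eta>>0. \<forall>x\<in>A. mdist m x x0 < \<delta> \<longrightarrow>
      (\<exists>l c. chain_linking m \<eta> l c x0 x \<and> chain_diam m l c < \<epsilon>)"
    using \<delta>(1) by blast
qed


section \<open>Sequences that are Cauchy or separated\<close>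

definition separated :: "'a metric \<Rightarrow> real \<Rightarrow> 'a set \<Rightarrow> bool" where
  "separated m s D \<longleftrightarrow> (\<forall>x\<in>D. \<forall>y\<in>D. x \<noteq> y \<longrightarrow> s \<le> mdist m x y)"

definition cauchy_seq :: "'a metric \<Rightarrow> (nat \<Rightarrow> 'a) \<Rightarrow> bool" where
  "cauchy_seq m c \<longleftrightarrow> (\<forall>e>0. \<exists>N. \<forall>i\<ge>N. \<forall>j\<ge>N. mdist m (c i) (c j) < e)"

lemma mdist_triangle_less:
  assumes "mdist m x y < a" "mdist m y z < b" "x \<in> mspace m" "y \<in> mspace m" "z \<in> mspace m"
  shows "mdist m x z < a + b"
  using mdist_triangle[OF assms(3,4,5)] assms(1,2) by linarith

text \<open>A range that is not totally bounded escapes, for some \<open>s\<close>, from every finite union of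
  \<open>s\<close>-balls; a separated subsequence is then picked greedily.\<close>
lemma cauchy_or_separated_subsequence:
  fixes p :: "nat \<Rightarrow> 'a"
  assumes p: "\<And>l. p l \<in> mspace m"
  obtains r :: "nat \<Rightarrow> nat" where "strict_mono r" "cauchy_seq m (p \<circ> r)"
  | r :: "nat \<Rightarrow> nat" and s where "strict_mono r" "s > 0" "\<And>i j. i \<noteq> j \<Longrightarrow> s \<le> mdist m (p (r i)) (p (r j))"
proof -
  interpret M: Metric_space "mspace m" "mdist m" by simp
  show thesis
  proof (cases "M.mtotally_bounded (range p)")
    case True
    then obtain r where "strict_mono r" "M.MCauchy (p \<circ> r)"
      unfolding M.mtotally_bounded_sequentially by blast
    then show thesis using that(1) by (auto simp: M.MCauchy_def cauchy_seq_def)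
  next
    case False
    then have "\<exists>s>0. \<not> (\<exists>K. finite K \<and> K \<subseteq> range p \<and> range p \<subseteq> (\<Union>x\<in>K. M.mball x s))"
      by (simp only: M.mtotally_bounded_def not_all not_imp)
    then obtain s where s: "s > 0" "\<not> (\<exists>K. finite K \<and> K \<subseteq> range p \<and> range p \<subseteq> (\<Union>x\<in>K. M.mball x s))"
      by (elim exE conjE)
    have ex: "\<exists>l. \<forall>i\<le>n. i < l \<and> s \<le> mdist m (p i) (p l)" for n
    proof -
      have "finite (p ` {..n})" "p ` {..n} \<subseteq> range p" by auto
      then have "\<not> range p \<subseteq> (\<Union>x\<in>p ` {..n}. M.mball x s)" using s(2) by metis
      then obtain l where l: "p l \<notin> (\<Union>x\<in>p ` {..n}. M.mball x s)"
        unfolding subset_iff by (simp only: not_all not_imp image_iff) fast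
      have far: "s \<le> mdist m (p i) (p l)" if "i \<le> n" for i
      proof -
        have "p l \<notin> M.mball (p i) s" using l that by blast
        then show ?thesis using p by simp
      qed
      have "i < l" if "i \<le> n" for i
      proof (rule ccontr)
        assume "\<not> i < l"
        then have "s \<le> mdist m (p l) (p l)" using far[of l] that by simp
        then show False using s p by simp
      qed
      then show ?thesis using far by blast
    qed
    have "\<exists>r. \<forall>n. True \<and> (\<forall>i\<le>r n. i < r (Suc n) \<and> s \<le> mdist m (p i) (p (r (Suc n))))"
      by (rule dependent_nat_choice) (use ex in auto)
    then obtain r where r: "\<And>n i. i \<le> r n \<Longrightarrow> i < r (Suc n) \<and> s \<le> mdist m (p i) (p (r (Suc n)))"
      by blast
    have mono: "strict_mono r" unfolding strict_mono_Suc_iff using r by blast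
    have "s \<le> mdist m (p (r i)) (p (r j))" if ij: "i < j" for i j
    proof -
      obtain k where k: "j = Suc k" using ij by (cases j) auto
      then have "r i \<le> r k" using ij mono by (simp add: strict_mono_less_eq)
      then show ?thesis using r k by blast
    qed
    then have sep: "s \<le> mdist m (p (r i)) (p (r j))" if "i \<noteq> j" for i j
      using that by (metis linorder_neq_iff mdist_commute)
    show thesis by (rule that(2)[OF mono s(1)]) (rule sep)
  qed
qed

section \<open>Members of D0\<close>

text \<open>A set without accumulation points in the whole space is closed and discrete.\<close>
lemma D0_in_I:
  assumes D: "D \<subseteq> F" "F \<subseteq> mspace m" "D \<noteq> {}" "countable D"
    and iso: "\<And>x. x \<in> mspace m \<Longrightarrow> \<exists>r>0. \<forall>y\<in>D. mdist m x y < r \<longrightarrow> y = x"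
    and tb: "Metric_space.mtotally_bounded (mspace m) (mdist m) D \<or> uniformly_discrete_in m D"
  shows "D \<in> D0_in m F"
proof -
  have Dm: "D \<subseteq> mspace m" using D by blast
  have op: "openin (mtopology_of m) (mspace m - E)" if "E \<subseteq> D" for E
    unfolding openin_mtopology_of_iff
  proof (intro conjI ballI)
    fix x assume x: "x \<in> mspace m - E"
    then obtain r where "r > 0" "\<forall>y\<in>D. mdist m x y < r \<longrightarrow> y = x" using iso by blast
    then show "\<exists>r>0. \<forall>y\<in>mspace m. mdist m x y < r \<longrightarrow> y \<in> mspace m - E"
      using x that by (intro exI[of _ r]) auto
  qed auto
  have "closedin (mtopology_of m) D"
    using op[of D] Dm by (simp add: closedin_def)
  moreover have "subtopology (mtopology_of m) D = discrete_topology D"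
  proof -
    have "openin (subtopology (mtopology_of m) D) {x}" if "x \<in> D" for x
      using op[of "D - {x}"] that Dm by (auto simp: openin_subtopology intro!: exI[of _ "mspace m - (D - {x})"])
    then show ?thesis
      using discrete_topology_unique[of D "subtopology (mtopology_of m) D"] Dm
      by (auto simp: Int_absorb1)
  qed
  ultimately show ?thesis
    using D tb by (auto simp: D0_in_def D0_def closed_nonempty_def)
qed

lemma separated_mono: "separated m s D \<Longrightarrow> t \<le> s \<Longrightarrow> E \<subseteq> D \<Longrightarrow> separated m t E"
  unfolding separated_def by (meson order_trans subsetD)

text \<open>A ball of radius \<open>s/2\<close> contains at most one point of an \<open>s\<close>-separated set.\<close>
lemma separated_in_D0:
  assumes D: "D \<subseteq> F" "F \<subseteq> mspace m" "D \<noteq> {}" "countable D" and s: "s > 0" "separated m s D"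
  shows "D \<in> D0_in m F"
proof (rule D0_in_I[OF D])
  have close: "y = z" if "x \<in> mspace m" "y \<in> D" "z \<in> D" "mdist m x y < s/2" "mdist m x z < s/2" for x y z
  proof (rule ccontr)
    assume "y \<noteq> z"
    then have "s \<le> mdist m y z" using s that unfolding separated_def by blast
    moreover have "mdist m y z < s/2 + s/2"
      using that D by (intro mdist_triangle_less[of _ _ x]) (auto simp: mdist_commute)
    ultimately show False by simp
  qed
  {
    fix x assume x: "x \<in> mspace m"
    show "\<exists>r>0. \<forall>y\<in>D. mdist m x y < r \<longrightarrow> y = x"
    proof (cases "\<exists>y\<in>D. mdist m x y < s/2 \<and> y \<noteq> x")
      case True
      then obtain y where y: "y \<in> D" "mdist m x y < s/2" "y \<noteq> x" by blast
      have "mdist m x y > 0"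
        using y x D mdist_zero[of x m y] mdist_nonneg[of m x y] by (metis less_eq_real_def subsetD)
      moreover have "\<not> mdist m x z < mdist m x y" if "z \<in> D" for z
        using close[OF x that y(1)] y(2) that by (cases "z = y") auto
      ultimately show ?thesis by blast
    next
      case False
      then show ?thesis using s by (intro exI[of _ "s/2"]) auto
    qed
  }
  have "uniformly_discrete_in m D"
    unfolding uniformly_discrete_in_def
  proof (intro exI[of _ "s/2"] conjI ballI)
    fix x assume x: "x \<in> mspace m"
    have "\<forall>y\<in>D \<inter> mball_of m x (s/2). \<forall>z\<in>D \<inter> mball_of m x (s/2). y = z"
      using close[OF x] by auto
    then have "\<exists>a. D \<inter> mball_of m x (s/2) \<subseteq> {a}" by blast
    then obtain a where a: "D \<inter> mball_of m x (s/2) \<subseteq> {a}" by blast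
    show "finite (D \<inter> mball_of m x (s/2))" using a finite_subset by blast
    show "card (D \<inter> mball_of m x (s/2)) \<le> 1" using card_mono[OF _ a] by simp
  qed (use s in auto)
  then show "Metric_space.mtotally_bounded (mspace m) (mdist m) D \<or> uniformly_discrete_in m D" by blast
qed

lemma separated_insertI:
  assumes "separated m t D" "\<And>z. z \<in> D \<Longrightarrow> z \<noteq> x \<Longrightarrow> t \<le> mdist m x z"
  shows "separated m t (insert x D)"
  unfolding separated_def
proof (intro ballI impI)
  fix y z assume "y \<in> insert x D" "z \<in> insert x D" "y \<noteq> z"
  then consider "y = x" "z \<in> D" "z \<noteq> x" | "z = x" "y \<in> D" "y \<noteq> x" | "y \<in> D" "z \<in> D" "y \<noteq> z"
    by auto
  then show "t \<le> mdist m y z"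
  proof cases
    case 2 then show ?thesis using assms(2)[of y] mdist_commute[of m x y] by simp
  next
    case 3 then show ?thesis using assms(1) unfolding separated_def by blast
  qed (use assms in auto)
qed

lemma mdist_pos: "x \<in> mspace m \<Longrightarrow> y \<in> mspace m \<Longrightarrow> x \<noteq> y \<Longrightarrow> 0 < mdist m x y"
  by (simp add: less_le)

text \<open>At most one point of an \<open>s\<close>-separated set lies within \<open>s/2\<close> of \<open>x\<close>; its
  distance from \<open>x\<close> is the new constant. If there is no such point other than \<open>x\<close>, then \<open>s/2\<close> will do.\<close>
lemma separated_insert:
  assumes "separated m s D" "s > 0" "D \<subseteq> mspace m" "x \<in> mspace m"
  obtains t where "t > 0" "separated m t (insert x D)"
proof (cases "\<exists>y\<in>D. mdist m x y < s/2 \<and> y \<noteq> x")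
  case True
  then obtain y where y: "y \<in> D" "mdist m x y < s/2" "y \<noteq> x" by blast
  define t where "t = mdist m x y"
  have t: "0 < t" "t < s/2"
    using y assms mdist_zero[of x m y] mdist_nonneg[of m x y] unfolding t_def
    by (metis less_eq_real_def subsetD)+
  have "t \<le> mdist m x z" if "z \<in> D" "z \<noteq> x" for z
  proof (rule ccontr)
    assume n: "\<not> t \<le> mdist m x z"
    then have "y \<noteq> z" by (auto simp: t_def)
    then have "s \<le> mdist m y z" using assms that y unfolding separated_def by blast
    moreover have "mdist m y z < s/2 + s/2"
      using that y n t assms by (intro mdist_triangle_less[of _ _ x]) (auto simp: mdist_commute)
    ultimately show False by simp
  qed
  then have "separated m t (insert x D)"
    using separated_mono[OF assms(1)] t by (intro separated_insertI) auto
  then show thesis using that t by blast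
next
  case False
  then have "separated m (s/2) (insert x D)"
    using separated_mono[OF assms(1)] assms(2) by (intro separated_insertI) force+
  then show thesis using that assms by (meson half_gt_zero)
qed

lemma separated_finite_Un:
  assumes "finite K" "K \<subseteq> mspace m" "separated m s D" "s > 0" "D \<subseteq> mspace m"
  shows "\<exists>t>0. separated m t (K \<union> D)"
  using assms(1,2)
proof (induction K rule: finite_induct)
  case empty then show ?case using assms by auto
next
  case (insert x K)
  then obtain t where t: "t > 0" "separated m t (K \<union> D)" by auto
  obtain u where "u > 0" "separated m u (insert x (K \<union> D))"
    using separated_insert[OF t(2,1)] insert.prems assms(5) by (metis Un_subset_iff insert_subset)
  then show ?case by auto
qed

text \<open>Every subset of the range is totally bounded, and it has no accumulation point because a Cauchy
  sequence can only accumulate at its limit.\<close>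
lemma cauchy_range_in_D0:
  assumes c: "\<And>n. c n \<in> F" and F: "F \<subseteq> mspace m" and cau: "cauchy_seq m c"
    and nonconv: "\<And>x. x \<in> mspace m \<Longrightarrow> \<exists>r>0. \<exists>N. \<forall>n\<ge>N. r \<le> mdist m x (c n)"
    and I: "I \<noteq> {}"
  shows "c ` I \<in> D0_in m F"
proof (rule D0_in_I)
  interpret M: Metric_space "mspace m" "mdist m" by simp
  fix x assume x: "x \<in> mspace m"
  obtain r N where r: "r > 0" "\<And>n. n \<ge> N \<Longrightarrow> r \<le> mdist m x (c n)" using nonconv[OF x] by blast
  define K where "K = insert r ((\<lambda>n. mdist m x (c n)) ` {n. n < N \<and> c n \<noteq> x})"
  have K: "finite K" "K \<noteq> {}" by (auto simp: K_def)
  have "k > 0" if "k \<in> K" for k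
  proof -
    have "k = r \<or> (\<exists>n. c n \<noteq> x \<and> k = mdist m x (c n))" using that by (auto simp: K_def)
    moreover have "c n \<in> mspace m" for n using c F by blast
    ultimately show ?thesis using r(1) mdist_pos[OF x] by metis
  qed
  then have "Min K > 0" using K by simp
  moreover have "y = x" if yc: "y \<in> c ` I" and ylt: "mdist m x y < Min K" for y
  proof (rule ccontr)
    assume ne: "y \<noteq> x"
    obtain n where n: "y = c n" using yc by blast
    have "mdist m x y \<in> K \<or> r \<le> mdist m x y"
      using n ne r unfolding K_def by (cases "n < N") auto
    moreover have "Min K \<le> r" using K by (auto simp: K_def)
    ultimately show False using ylt Min_le[OF K(1), of "mdist m x y"] by linarith
  qed
  ultimately show "\<exists>r>0. \<forall>y\<in>c ` I. mdist m x y < r \<longrightarrow> y = x" by blast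
next
  interpret M: Metric_space "mspace m" "mdist m" by simp
  have "M.mtotally_bounded (range c)"
    unfolding M.mtotally_bounded_def
  proof (intro allI impI)
    fix e :: real assume "e > 0"
    then obtain N where N: "\<And>i j. i \<ge> N \<Longrightarrow> j \<ge> N \<Longrightarrow> mdist m (c i) (c j) < e"
      using cau unfolding cauchy_seq_def by blast
    have "range c \<subseteq> (\<Union>x\<in>c ` {..N}. M.mball x e)"
    proof
      fix y assume "y \<in> range c"
      then obtain n where n: "y = c n" by blast
      have ms: "c i \<in> mspace m" for i using c F by blast
      have "y \<in> M.mball (c (min n N)) e"
        using n N[of N n] ms \<open>e > 0\<close> by (auto simp: min_def)
      then show "y \<in> (\<Union>x\<in>c ` {..N}. M.mball x e)" by (intro UN_I[of "c (min n N)"]) auto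
    qed
    then show "\<exists>K. finite K \<and> K \<subseteq> range c \<and> range c \<subseteq> (\<Union>x\<in>K. M.mball x e)"
      by (intro exI[of _ "c ` {..N}"]) auto
  qed
  then have "M.mtotally_bounded (c ` I)"
    by (rule M.mtotally_bounded_subset) auto
  then show "M.mtotally_bounded (c ` I) \<or> uniformly_discrete_in m (c ` I)" by blast
qed (use assms in auto)

section \<open>Tracing chains of sets back to chains of points\<close>

definition around :: "'a metric \<Rightarrow> 'a set \<Rightarrow> real \<Rightarrow> 'a set" where
  "around m D e = {x \<in> mspace m. \<exists>y\<in>D. mdist m y x < e}"

lemma in_around: "x \<in> D \<Longrightarrow> x \<in> mspace m \<Longrightarrow> e > 0 \<Longrightarrow> x \<in> around m D e"
  unfolding around_def by (auto intro!: bexI[of _ x])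

lemma around_subset [simp]: "around m D e \<subseteq> mspace m"
  by (auto simp: around_def)

definition near_sets :: "'a metric \<Rightarrow> real \<Rightarrow> 'a set \<Rightarrow> 'a set \<Rightarrow> bool" where
  "near_sets m d D D' \<longleftrightarrow> (\<forall>x\<in>D. \<exists>y\<in>D'. mdist m x y < d) \<and> (\<forall>y\<in>D'. \<exists>x\<in>D. mdist m y x < d)"

definition traced :: "'a metric \<Rightarrow> real \<Rightarrow> 'a set \<Rightarrow> 'a set \<Rightarrow> bool" where
  "traced m e D D' \<longleftrightarrow> (\<forall>\<eta>>0. \<exists>k. \<forall>p\<in>D'. \<exists>q\<in>D. (q, p) \<in> close_rel m \<eta> (around m D e) ^^ k)"

locale lcc_hyperspace =
  fixes m :: "'a metric" and F :: "'a set"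
  assumes F: "F \<in> closed_nonempty m"
    and lcc: "locally_chain_connected_at (hyperspace m) (D0_in m F)"
begin

lemma Fm: "F \<subseteq> mspace m" using F by (rule closed_nonempty_subset)

text \<open>In a chain of sets each point has a neighbour in the preceding set. Following these neighbours back
  to the start keeps the number of steps of the chain of sets, whatever the point.\<close>
lemma trace_chain_of_sets:
  assumes D: "D \<in> D0_in m F" and e: "e > 0"
  shows "\<exists>\<delta>>0. \<forall>D'\<in>D0_in m F. near_sets m \<delta> D D' \<longrightarrow> traced m e D D'"
proof -
  have e1: "min e 1 > 0" using e by simp
  from bspec[OF lcc[unfolded locally_chain_connected_at_def] D, rule_format, OF e1]
  obtain \<delta>0 where d0: "\<delta>0 > 0" "\<And>\<eta> D'. \<eta> > 0 \<Longrightarrow> D' \<in> D0_in m F \<Longrightarrow> mdist (hyperspace m) D' D < \<delta>0 \<Longrightarrow>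
      (\<exists>l c. chain_linking (hyperspace m) \<eta> l c D D' \<and> chain_diam (hyperspace m) l c < min e 1)"
    by blast
  show ?thesis
    unfolding traced_def
  proof (intro exI[of _ "\<delta>0/2"] conjI ballI allI impI)
    show "\<delta>0/2 > 0" using d0 by simp
    fix D' and \<eta> :: real assume D': "D' \<in> D0_in m F" and \<eta>: "\<eta> > 0" and "near_sets m (\<delta>0/2) D D'"
    then have n1: "\<forall>x\<in>D. \<exists>y\<in>D'. mdist m x y < \<delta>0/2" and n2: "\<forall>y\<in>D'. \<exists>x\<in>D. mdist m y x < \<delta>0/2"
      by (simp_all add: near_sets_def)
    have "mdist (hyperspace m) D' D \<le> \<delta>0/2"
      by (rule hyperspace_dist_le) (use n1 n2 d0 in \<open>meson less_imp_le half_gt_zero\<close>)+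
    then have "mdist (hyperspace m) D' D < \<delta>0" "min \<eta> 1 > 0" using d0 \<eta> by auto
    then obtain l c where c: "chain_linking (hyperspace m) (min \<eta> 1) l c D D'"
      "chain_diam (hyperspace m) l c < min e 1"
      using d0(2)[OF _ D'] by blast
    have cn: "c i \<in> closed_nonempty m" if "i \<le> l" for i
      using c(1) that by (auto simp: chain_linking_def)
    have c0: "c 0 = D" "c l = D'" using c(1) by (auto simp: chain_linking_def)
    have near: "p \<in> around m D e" if p: "p \<in> c i" "i \<le> l" for i p
    proof -
      have h: "mdist (hyperspace m) (c i) (c 0) < min e 1"
        using c(2) p unfolding chain_diam_less_iff by blast
      obtain y where "y \<in> c 0" "mdist m p y < min e 1"
        by (rule hyperspace_point_near[OF cn[OF p(2)] cn[of 0] h _ p(1)]) auto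
      then have "y \<in> D" "mdist m y p < e" using c0 by (auto simp: mdist_commute)
      then show ?thesis
        using closed_nonemptyD[OF cn[OF p(2)] p(1)] by (auto simp: around_def)
    qed
    have "\<forall>p\<in>c i. \<exists>q\<in>D. (q, p) \<in> close_rel m \<eta> (around m D e) ^^ i" if "i \<le> l" for i
      using that
    proof (induction i)
      case 0 then show ?case using c0 by auto
    next
      case (Suc i)
      show ?case
      proof
        fix p assume p: "p \<in> c (Suc i)"
        have "\<forall>i\<in>{1..l}. mdist (hyperspace m) (c i) (c (i - 1)) < min \<eta> 1"
          using c(1) unfolding chain_linking_def by (elim conjE)
        from bspec[OF this, of "Suc i"] have h: "mdist (hyperspace m) (c (Suc i)) (c i) < min \<eta> 1"
          using Suc.prems by simp
        have i: "i \<le> l" using Suc.prems by simp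
        obtain p' where p': "p' \<in> c i" "mdist m p p' < min \<eta> 1"
          by (rule hyperspace_point_near[OF cn[OF Suc.prems] cn[OF i] h _ p]) auto
        obtain q where "q \<in> D" "(q, p') \<in> close_rel m \<eta> (around m D e) ^^ i"
          using Suc p' by auto
        moreover have "(p', p) \<in> close_rel m \<eta> (around m D e)"
          using near p p' Suc.prems by (auto simp: close_rel_def mdist_commute)
        ultimately show "\<exists>q\<in>D. (q, p) \<in> close_rel m \<eta> (around m D e) ^^ Suc i" by auto
      qed
    qed
    from this[of l] show "\<exists>k. \<forall>p\<in>D'. \<exists>q\<in>D. (q, p) \<in> close_rel m \<eta> (around m D e) ^^ k"
      using c0 by auto
  qed
qed

end

text \<open>The \<open>e\<close>-neighbourhoods of distinct points of \<open>D\<close> are too far apart for a step below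
  \<open>\<eta> \<le> e\<close> to lead from one to another.\<close>
lemma chain_around_separated:
  assumes "separated m s D" "3 * e \<le> s" "\<eta> \<le> e" "e > 0" "q \<in> D" "D \<subseteq> mspace m"
    and "(q, p) \<in> close_rel m \<eta> (around m D e) ^^ k"
  shows "(q, p) \<in> close_rel m \<eta> (around m {q} e) ^^ k \<and> p \<in> around m {q} e"
  using assms(7)
proof (induction k arbitrary: p)
  case 0 then show ?case using assms by (auto simp: around_def)
next
  case (Suc k)
  then obtain x where x: "(q, x) \<in> close_rel m \<eta> (around m D e) ^^ k" "(x, p) \<in> close_rel m \<eta> (around m D e)"
    by auto
  note IH = Suc.IH[OF x(1)]
  obtain y where y: "y \<in> D" "mdist m y p < e" "p \<in> mspace m"
    using x(2) by (auto simp: close_rel_def around_def)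
  have xp: "mdist m x p < \<eta>" "x \<in> mspace m" "mdist m q x < e"
    using x(2) IH by (auto simp: close_rel_def around_def)
  have "q = y"
  proof (rule ccontr)
    assume "q \<noteq> y"
    then have "s \<le> mdist m q y" using assms y unfolding separated_def by blast
    moreover have ms: "q \<in> mspace m" "y \<in> mspace m" using assms y by auto
    have "mdist m q y \<le> mdist m q p + mdist m p y" "mdist m q p \<le> mdist m q x + mdist m x p"
      using ms xp y by (auto intro: mdist_triangle)
    ultimately show False using assms xp y by (simp add: mdist_commute[of m p y])
  qed
  then have "p \<in> around m {q} e" using y by (auto simp: around_def)
  moreover from this have "(x, p) \<in> close_rel m \<eta> (around m {q} e)"
    using IH xp by (auto simp: close_rel_def)
  ultimately show ?case using IH by auto
qed

text \<open>For separated \<open>D\<close> the chains of points inherit a bound on their diameters, which the chain of sets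
  alone does not provide.\<close>
lemma (in lcc_hyperspace) trace_to_separated:
  assumes D: "D \<subseteq> F" "D \<noteq> {}" "countable D" and s: "s > 0" "separated m s D" and e: "e > 0" "3 * e \<le> s"
  shows "\<exists>\<delta>>0. \<forall>D'\<in>D0_in m F. near_sets m \<delta> D D' \<longrightarrow> (\<forall>\<eta>>0. \<exists>k. \<forall>p\<in>D'. \<exists>q\<in>D.
      (q, p) \<in> close_rel m \<eta> (around m {q} e) ^^ k \<and> mdist m q p < e)"
proof -
  have "D \<in> D0_in m F" using D Fm s by (intro separated_in_D0) auto
  from trace_chain_of_sets[OF this e(1)] obtain \<delta> where \<delta>: "\<delta> > 0"
    "\<forall>D'\<in>D0_in m F. near_sets m \<delta> D D' \<longrightarrow> traced m e D D'" by blast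
  have "\<exists>k. \<forall>p\<in>D'. \<exists>q\<in>D. (q, p) \<in> close_rel m \<eta> (around m {q} e) ^^ k \<and> mdist m q p < e"
    if "D' \<in> D0_in m F" "near_sets m \<delta> D D'" and \<eta>: "\<eta> > 0" for D' \<eta>
  proof -
    have t: "traced m e D D'" "min \<eta> e > 0" using \<delta>(2) that e by auto
    then obtain k where k: "\<forall>p\<in>D'. \<exists>q\<in>D. (q, p) \<in> close_rel m (min \<eta> e) (around m D e) ^^ k"
      unfolding traced_def by blast
    have "\<exists>q\<in>D. (q, p) \<in> close_rel m \<eta> (around m {q} e) ^^ k \<and> mdist m q p < e" if "p \<in> D'" for p
    proof -
      obtain q where q: "q \<in> D" "(q, p) \<in> close_rel m (min \<eta> e) (around m D e) ^^ k" using k \<open>p \<in> D'\<close> by blast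
      have l: "(q, p) \<in> close_rel m (min \<eta> e) (around m {q} e) ^^ k \<and> p \<in> around m {q} e"
        by (rule chain_around_separated[OF s(2) e(2) _ e(1) q(1) _ q(2)]) (use D Fm in auto)
      from l have "(q, p) \<in> close_rel m \<eta> (around m {q} e) ^^ k"
        by (intro close_rel_power_mono[OF conjunct1[OF l]]) auto
      then show ?thesis using q(1) l by (auto simp: around_def)
    qed
    then show ?thesis by blast
  qed
  then show ?thesis using \<delta>(1) by blast
qed


section \<open>Local chain connectedness of the hyperspace makes chains uniform\<close>

text \<open>The number \<open>k\<close> of steps may depend on \<open>\<eta>\<close> but not on the point of \<open>P\<close>.\<close>
definition linked_set :: "'a metric \<Rightarrow> real \<Rightarrow> 'a \<Rightarrow> 'a set \<Rightarrow> bool" where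
  "linked_set m e c P \<longleftrightarrow> (\<forall>\<eta>>0. \<exists>k. \<forall>p\<in>P. (c, p) \<in> close_rel m \<eta> (around m {c} e) ^^ k)"

text \<open>Sets \<open>P n\<close> of points that approach the centres \<open>c n\<close>. The lemmas below find an index at which
  the centre is uniformly linked with its set. The sets for different \<open>n\<close> are unrelated, so each may be
  chosen as a counterexample to uniform linking at its own scale.\<close>
definition shrinking :: "'a metric \<Rightarrow> 'a set \<Rightarrow> (nat \<Rightarrow> 'a) \<Rightarrow> (nat \<Rightarrow> 'a set) \<Rightarrow> bool" where
  "shrinking m F c P \<longleftrightarrow> (\<forall>n. c n \<in> F \<and> P n \<subseteq> F \<and> countable (P n) \<and> P n \<noteq> {} \<and> (\<exists>t>0. separated m t (P n))) \<and>
    (\<forall>\<epsilon>>0. eventually (\<lambda>n. \<forall>p\<in>P n. mdist m (c n) p < \<epsilon>) sequentially)"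

lemma shrinkingD:
  assumes "shrinking m F c P"
  shows "c n \<in> F" "P n \<subseteq> F" "countable (P n)" "P n \<noteq> {}" "\<exists>t>0. separated m t (P n)"
    "\<epsilon> > 0 \<Longrightarrow> eventually (\<lambda>n. \<forall>p\<in>P n. mdist m (c n) p < \<epsilon>) sequentially"
  using assms unfolding shrinking_def by blast+

context lcc_hyperspace
begin

text \<open>Each row \<open>x n\<close> eventually leaves all \<open>s\<close>-balls, so indices \<open>L n j \<ge> j\<close> can be
  chosen such that all points \<open>x n (L n j)\<close> together form an \<open>s\<close>-separated set \<open>D\<close>. Replacing its
  row \<open>n\<close> by the corresponding points of \<open>y n\<close> moves \<open>D\<close> by at most \<open>\<delta> n\<close>. For large
  \<open>n\<close> a chain between the two sets exists, and it links all pairs in row \<open>n\<close> in one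
  number \<open>k\<close> of steps, whereas the pair with index \<open>L n k \<ge> k\<close> is among them.\<close>
lemma separated_family_linked:
  assumes x: "\<And>n l. x n l \<in> F" and y: "\<And>n l. y n l \<in> F"
    and xy: "\<And>n l. mdist m (x n l) (y n l) < \<delta> n" and \<delta>: "\<delta> \<longlonglongrightarrow> 0"
    and s: "s > 0" and fin: "\<And>n u. u \<in> mspace m \<Longrightarrow> finite {l. mdist m (x n l) u < s}"
    and e: "e > 0"
  shows "\<exists>n. \<forall>\<eta>>0. \<exists>k. \<exists>l\<ge>k. (x n l, y n l) \<in> close_rel m \<eta> (around m {x n l} e) ^^ k"
proof -
  have xm: "x n l \<in> mspace m" and ym: "y n l \<in> mspace m" for n l using x y Fm by auto
  have "\<exists>f. \<forall>t. snd (prod_decode t) \<le> f t \<and>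
      (\<forall>u<t. s \<le> mdist m (x (fst (prod_decode t)) (f t)) (x (fst (prod_decode u)) (f u)))"
  proof (rule dependent_wf_choice[where R = "{(u, t). u < t}"])
    show "wf {(u::nat, t). u < t}" by (rule wf)
  next
    fix t and f :: "nat \<Rightarrow> nat"
    let ?n = "fst (prod_decode t)"
    have "finite (\<Union>u<t. {l. mdist m (x ?n l) (x (fst (prod_decode u)) (f u)) < s})"
      using fin xm by auto
    then have "finite ((\<Union>u<t. {l. mdist m (x ?n l) (x (fst (prod_decode u)) (f u)) < s}) \<union> {..snd (prod_decode t)})"
      by simp
    then obtain l where "l \<notin> (\<Union>u<t. {l. mdist m (x ?n l) (x (fst (prod_decode u)) (f u)) < s}) \<union> {..snd (prod_decode t)}"
      using ex_new_if_finite infinite_UNIV_nat by blast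
    then show "\<exists>r. snd (prod_decode t) \<le> r \<and> (\<forall>u<t. s \<le> mdist m (x ?n r) (x (fst (prod_decode u)) (f u)))"
      by (intro exI[of _ l]) force
  qed auto
  then obtain f where f: "\<And>t. snd (prod_decode t) \<le> f t"
    "\<And>t u. u < t \<Longrightarrow> s \<le> mdist m (x (fst (prod_decode t)) (f t)) (x (fst (prod_decode u)) (f u))"
    by blast
  define L where "L n j = f (prod_encode (n, j))" for n j
  have L1: "j \<le> L n j" for n j using f(1)[of "prod_encode (n, j)"] by (simp add: L_def)
  have L2: "s \<le> mdist m (x n (L n j)) (x n' (L n' j'))" if "(n, j) \<noteq> (n', j')" for n j n' j'
  proof -
    have "prod_encode (n, j) \<noteq> prod_encode (n', j')" using that by auto
    then consider "prod_encode (n, j) < prod_encode (n', j')" | "prod_encode (n', j') < prod_encode (n, j)" by linarith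
    then show ?thesis
      using f(2)[of "prod_encode (n, j)" "prod_encode (n', j')"] f(2)[of "prod_encode (n', j')" "prod_encode (n, j)"]
      by cases (simp_all add: L_def mdist_commute)
  qed
  define D where "D = (\<lambda>(n, j). x n (L n j)) ` UNIV"
  have Dsep: "separated m s D"
    unfolding separated_def D_def using L2 by auto metis
  have DF: "D \<subseteq> F" "D \<noteq> {}" "countable D" unfolding D_def using x by auto
  define e' where "e' = min e (s/8)"
  have e': "e' > 0" "e' \<le> e" "8 * e' \<le> s" "3 * e' \<le> s" using e s by (auto simp: e'_def)
  from trace_to_separated[OF DF s Dsep e'(1,4)] obtain d where d: "d > 0"
    "\<forall>D'\<in>D0_in m F. near_sets m d D D' \<longrightarrow> (\<forall>\<eta>>0. \<exists>k. \<forall>p\<in>D'. \<exists>q\<in>D.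
      (q, p) \<in> close_rel m \<eta> (around m {q} e') ^^ k \<and> mdist m q p < e')"
    by (elim exE conjE)
  have "min d e' > 0" using d e' by simp
  from order_tendstoD(2)[OF \<delta> this] obtain n where "\<delta> n < d" "\<delta> n < e'"
    unfolding eventually_sequentially by auto
  then have yn: "mdist m (x n l) (y n l) < d" "mdist m (x n l) (y n l) < e'" for l
    using xy[of n l] by auto
  show ?thesis
  proof (rule exI[of _ n], intro allI impI)
    fix \<eta> :: real assume \<eta>: "\<eta> > 0"
    \<comment> \<open>Enumerate the points of the family with row \<open>n\<close> exchanged.\<close>
    define z where "z n' j = (if n' = n then y n (L n j) else x n' (L n' j))" for n' j
    define D' where "D' = (\<lambda>(n, j). z n j) ` UNIV"
    have zx: "mdist m (x n' (L n' j)) (z n' j) < d" "mdist m (x n' (L n' j)) (z n' j) < e'" for n' j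
      using yn d e' xm by (auto simp: z_def)
    have zF: "z n' j \<in> F" and zm: "z n' j \<in> mspace m" for n' j using x y xm ym by (auto simp: z_def)
    have "s - 2 * e' \<le> mdist m (z i j) (z i' j')" if "(i, j) \<noteq> (i', j')" for i j i' j'
    proof -
      have "mdist m (x i (L i j)) (x i' (L i' j')) \<le> mdist m (x i (L i j)) (z i j) + mdist m (z i j) (x i' (L i' j'))"
        "mdist m (z i j) (x i' (L i' j')) \<le> mdist m (z i j) (z i' j') + mdist m (z i' j') (x i' (L i' j'))"
        using xm zm by (auto intro: mdist_triangle)
      then show ?thesis
        using L2[OF that] zx(2)[of i j] zx(2)[of i' j'] by (simp add: mdist_commute[of m "z i' j'"])
    qed
    then have "separated m (s - 2 * e') D'"
      unfolding separated_def D'_def by auto metis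
    then have "D' \<in> D0_in m F"
      using zF Fm e' by (intro separated_in_D0[of _ _ _ "s - 2 * e'"]) (auto simp: D'_def)
    moreover have "\<forall>p\<in>D. \<exists>q\<in>D'. mdist m p q < d" unfolding D_def D'_def using zx by auto
    moreover have "\<forall>q\<in>D'. \<exists>p\<in>D. mdist m q p < d"
      unfolding D_def D'_def using zx(1)[unfolded mdist_commute[of m "x _ _"]] by auto
    ultimately have "D' \<in> D0_in m F" "near_sets m d D D'" by (simp_all add: near_sets_def)
    then obtain k where k: "\<forall>p\<in>D'. \<exists>q\<in>D. (q, p) \<in> close_rel m \<eta> (around m {q} e') ^^ k \<and> mdist m q p < e'"
      using d(2) \<eta> by blast
    have "y n (L n k) \<in> D'" unfolding D'_def z_def by (rule image_eqI[of _ _ "(n, k)"]) auto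
    then obtain q where q: "q \<in> D" "(q, y n (L n k)) \<in> close_rel m \<eta> (around m {q} e') ^^ k"
      "mdist m q (y n (L n k)) < e'"
      using k by blast
    have "q = x n (L n k)"
    proof (rule ccontr)
      assume "q \<noteq> x n (L n k)"
      moreover have "x n (L n k) \<in> D" unfolding D_def by (rule image_eqI[of _ _ "(n, k)"]) auto
      ultimately have "s \<le> mdist m q (x n (L n k))" using Dsep q unfolding separated_def by blast
      also have "\<dots> \<le> mdist m q (y n (L n k)) + mdist m (y n (L n k)) (x n (L n k))"
        using q DF Fm xm ym by (intro mdist_triangle) auto
      also have "\<dots> < e' + e'"
        using q(3) yn(2)[of "L n k"] by (simp add: mdist_commute)
      finally show False using e' by linarith
    qed
    then have "(x n (L n k), y n (L n k)) \<in> close_rel m \<eta> (around m {x n (L n k)} e') ^^ k"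
      using q(2) by simp
    then have "(x n (L n k), y n (L n k)) \<in> close_rel m \<eta> (around m {x n (L n k)} e) ^^ k"
      by (rule close_rel_power_mono) (use e' in \<open>auto simp: around_def\<close>)
    then show "\<exists>k. \<exists>l\<ge>k. (x n l, y n l) \<in> close_rel m \<eta> (around m {x n l} e) ^^ k"
      using L1 by blast
  qed
qed

text \<open>\<open>D\<close> is the set of all centres, and the nearby set arises from it by replacing \<open>c n\<close> by
  \<open>P n\<close>. Separation makes every chain that starts in \<open>P n\<close> end at \<open>c n\<close>.\<close>
lemma separated_centres_linked:
  assumes sh: "shrinking m F c P"
    and s: "s > 0" "\<And>i j. i \<noteq> j \<Longrightarrow> s \<le> mdist m (c i) (c j)"
    and e: "e > 0"
  shows "\<exists>n. linked_set m e (c n) (P n)"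
proof -
  note c = shrinkingD(1)[OF sh] and P = shrinkingD(2-4)[OF sh] and Psep = shrinkingD(5)[OF sh]
  have cm: "c n \<in> mspace m" for n using c Fm by auto
  have Pm: "p \<in> mspace m" if "p \<in> P n" for n p using that P(1)[of n] Fm by blast
  define D where "D = range c"
  have Dsep: "separated m s D"
    unfolding separated_def D_def using s by auto metis
  have DF: "D \<subseteq> F" "D \<noteq> {}" "countable D" unfolding D_def using c by auto
  define e' where "e' = min e (s/8)"
  have e': "e' > 0" "e' \<le> e" "8 * e' \<le> s" "3 * e' \<le> s" using e s by (auto simp: e'_def)
  from trace_to_separated[OF DF s(1) Dsep e'(1,4)] obtain d where d: "d > 0"
    "\<forall>D'\<in>D0_in m F. near_sets m d D D' \<longrightarrow> (\<forall>\<eta>>0. \<exists>k. \<forall>p\<in>D'. \<exists>q\<in>D.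
      (q, p) \<in> close_rel m \<eta> (around m {q} e') ^^ k \<and> mdist m q p < e')"
    by (elim exE conjE)
  have "min d e' > 0" using d e' by simp
  from shrinkingD(6)[OF sh this] obtain n where "\<forall>p\<in>P n. mdist m (c n) p < min d e'"
    unfolding eventually_sequentially by blast
  then have yn: "mdist m (c n) p < d" "mdist m (c n) p < e'" if "p \<in> P n" for p
    using that by auto
  show ?thesis
    unfolding linked_set_def
  proof (rule exI[of _ n], intro allI impI)
    fix \<eta> :: real assume \<eta>: "\<eta> > 0"
    define D' where "D' = (D - {c n}) \<union> P n"
    obtain t where t: "t > 0" "separated m t (P n)" using Psep by blast
    have far: "s - e' \<le> mdist m q p" if "q \<in> D - {c n}" "p \<in> P n" for q p
    proof -
      have "s \<le> mdist m q (c n)" using that Dsep unfolding separated_def D_def by blast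
      also have "\<dots> \<le> mdist m q p + mdist m p (c n)"
        using that DF Fm cm Pm by (intro mdist_triangle) auto
      finally show ?thesis using yn(2)[OF that(2)] by (simp add: mdist_commute[of m p])
    qed
    have "separated m (min (s - e') t) D'"
      unfolding separated_def
    proof (intro ballI impI)
      fix p q assume "p \<in> D'" "q \<in> D'" "p \<noteq> q"
      then consider "p \<in> D" "q \<in> D" | "p \<in> P n" "q \<in> P n" | "p \<in> D - {c n}" "q \<in> P n" | "q \<in> D - {c n}" "p \<in> P n"
        by (auto simp: D'_def)
      then show "min (s - e') t \<le> mdist m p q"
      proof cases
        case 1
        then have "s \<le> mdist m p q" using Dsep \<open>p \<noteq> q\<close> unfolding separated_def by blast
        then show ?thesis using e' by simp
      next
        case 2
        then have "t \<le> mdist m p q" using t \<open>p \<noteq> q\<close> unfolding separated_def by blast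
        then show ?thesis by simp
      next
        case 3 then show ?thesis using far[of p q] by simp
      next
        case 4 then show ?thesis using far[of q p] by (simp add: mdist_commute[of m p])
      qed
    qed
    then have "D' \<in> D0_in m F"
      using P DF Fm e' t by (intro separated_in_D0[of _ _ _ "min (s - e') t"]) (auto simp: D'_def)
    moreover have "\<forall>p\<in>D. \<exists>q\<in>D'. mdist m p q < d"
    proof
      fix p assume p: "p \<in> D"
      show "\<exists>q\<in>D'. mdist m p q < d"
      proof (cases "p = c n")
        case True
        obtain q where "q \<in> P n" using P by blast
        then show ?thesis using yn True by (auto simp: D'_def)
      next
        case False
        then show ?thesis using p d DF Fm by (intro bexI[of _ p]) (auto simp: D'_def)
      qed
    qed
    moreover have "\<forall>q\<in>D'. \<exists>p\<in>D. mdist m q p < d"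
    proof
      fix q assume q: "q \<in> D'"
      show "\<exists>p\<in>D. mdist m q p < d"
      proof (cases "q \<in> P n")
        case True
        then show ?thesis using yn[OF True] by (auto simp: D_def mdist_commute)
      next
        case False
        then show ?thesis using q d DF Fm by (intro bexI[of _ q]) (auto simp: D'_def)
      qed
    qed
    ultimately have "D' \<in> D0_in m F" "near_sets m d D D'" by (simp_all add: near_sets_def)
    then obtain k where k: "\<forall>p\<in>D'. \<exists>q\<in>D. (q, p) \<in> close_rel m \<eta> (around m {q} e') ^^ k \<and> mdist m q p < e'"
      using d(2) \<eta> by blast
    have "(c n, p) \<in> close_rel m \<eta> (around m {c n} e) ^^ k" if p: "p \<in> P n" for p
    proof -
      obtain q where q: "q \<in> D" "(q, p) \<in> close_rel m \<eta> (around m {q} e') ^^ k" "mdist m q p < e'"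
        using k p unfolding D'_def by blast
      have "\<not> s - e' \<le> mdist m q p" using q(3) e' by linarith
      then have "q = c n" using far[of q p] q(1) p by blast
      then have "(c n, p) \<in> close_rel m \<eta> (around m {c n} e') ^^ k" using q(2) by simp
      then show ?thesis by (rule close_rel_power_mono) (use e' in \<open>auto simp: around_def\<close>)
    qed
    then show "\<exists>k. \<forall>p\<in>P n. (c n, p) \<in> close_rel m \<eta> (around m {c n} e) ^^ k" by blast
  qed
qed

text \<open>With \<open>D = {a}\<close> all chains end at \<open>a\<close>. The perturbed set contains \<open>c n\<close> as well as
  \<open>P n\<close>, so both are linked to \<open>a\<close>.\<close>
lemma convergent_centres_linked:
  assumes sh: "shrinking m F c P"
    and a: "a \<in> F" "(\<lambda>n. mdist m (c n) a) \<longlonglongrightarrow> 0"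
    and e: "e > 0"
  shows "\<exists>n. linked_set m e (c n) (P n)"
proof -
  note c = shrinkingD(1)[OF sh] and P = shrinkingD(2-4)[OF sh] and Psep = shrinkingD(5)[OF sh]
  have cm: "c n \<in> mspace m" for n using c Fm by auto
  have am: "a \<in> mspace m" using a Fm by auto
  have D0: "{a} \<in> D0_in m F" using a Fm by (intro separated_in_D0[of _ _ _ 1]) (auto simp: separated_def)
  have e2: "e/2 > 0" using e by simp
  from trace_chain_of_sets[OF D0 e2] obtain d where d: "d > 0"
    "\<forall>D'\<in>D0_in m F. near_sets m d {a} D' \<longrightarrow> traced m (e/2) {a} D'"
    by (elim exE conjE)
  have "eventually (\<lambda>n. mdist m (c n) a < min (d/2) (e/2)) sequentially"
    using a(2) d e by (intro order_tendstoD(2)) auto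
  moreover have "eventually (\<lambda>n. \<forall>p\<in>P n. mdist m (c n) p < d/2) sequentially"
    using shrinkingD(6)[OF sh, of "d/2"] d by simp
  ultimately have "eventually (\<lambda>n. mdist m (c n) a < min (d/2) (e/2) \<and> (\<forall>p\<in>P n. mdist m (c n) p < d/2)) sequentially"
    by eventually_elim simp
  then obtain n where n: "mdist m (c n) a < d/2" "mdist m (c n) a < e/2" "\<forall>p\<in>P n. mdist m (c n) p < d/2"
    unfolding eventually_sequentially by auto
  show ?thesis
    unfolding linked_set_def
  proof (rule exI[of _ n], intro allI impI)
    fix \<eta> :: real assume \<eta>: "\<eta> > 0"
    define D' where "D' = insert (c n) (P n)"
    obtain t where t: "t > 0" "separated m t (P n)" using Psep by blast
    obtain u where u: "u > 0" "separated m u D'"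
      unfolding D'_def
    proof (rule separated_insert[OF t(2,1) _ cm[of n]])
      show "P n \<subseteq> mspace m" using P Fm by blast
    qed
    have near: "mdist m p a < d" if "p \<in> D'" for p
    proof -
      have pm: "p \<in> mspace m" using that P(1)[of n] Fm cm by (auto simp: D'_def)
      have "mdist m (c n) p < d/2"
      proof (cases "p = c n")
        case True then show ?thesis using d cm by simp
      next
        case False then show ?thesis using that n by (auto simp: D'_def)
      qed
      then have "mdist m p a < d/2 + d/2"
        using n cm am pm by (intro mdist_triangle_less[of _ _ "c n"]) (auto simp: mdist_commute)
      then show ?thesis by simp
    qed
    have D'0: "D' \<in> D0_in m F"
      using P c Fm u by (intro separated_in_D0[of _ _ _ u]) (auto simp: D'_def)
    have n1: "\<forall>x\<in>{a}. \<exists>y\<in>D'. mdist m x y < d"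
      using near[of "c n"] by (auto simp: D'_def mdist_commute)
    have n2: "\<forall>y\<in>D'. \<exists>x\<in>{a}. mdist m y x < d" using near by auto
    from n1 n2 have "near_sets m d {a} D'" unfolding near_sets_def ..
    then have "traced m (e/2) {a} D'" using d(2) D'0 by blast
    then obtain k where "\<forall>p\<in>D'. \<exists>q\<in>{a}. (q, p) \<in> close_rel m \<eta> (around m {a} (e/2)) ^^ k"
      using \<eta> unfolding traced_def by blast
    then have k: "(a, p) \<in> close_rel m \<eta> (around m {a} (e/2)) ^^ k" if "p \<in> D'" for p using that by simp
    have sub: "around m {a} (e/2) \<subseteq> around m {c n} e"
    proof
      fix x assume "x \<in> around m {a} (e/2)"
      then have "x \<in> mspace m" "mdist m a x < e/2" by (auto simp: around_def)
      then have "mdist m (c n) x < e/2 + e/2" using n cm am by (intro mdist_triangle_less[of _ _ a]) auto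
      then show "x \<in> around m {c n} e" using \<open>x \<in> mspace m\<close> by (auto simp: around_def)
    qed
    have "(c n, p) \<in> close_rel m \<eta> (around m {c n} e) ^^ (k + k)" if "p \<in> P n" for p
    proof -
      have "(c n, a) \<in> close_rel m \<eta> (around m {a} (e/2)) ^^ k" "(a, p) \<in> close_rel m \<eta> (around m {a} (e/2)) ^^ k"
        using close_rel_power_sym[OF k[of "c n"]] k[of p] that by (auto simp: D'_def)
      then have "(c n, p) \<in> close_rel m \<eta> (around m {a} (e/2)) ^^ (k + k)" by (rule close_rel_power_trans)
      then show ?thesis using sub by (rule close_rel_power_mono[OF _ order_refl])
    qed
    then show "\<exists>k. \<forall>p\<in>P n. (c n, p) \<in> close_rel m \<eta> (around m {c n} e) ^^ k" by blast
  qed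
qed

end


context lcc_hyperspace
begin

text \<open>For given \<open>\<eta>\<close> the tail of the sequence lies in one class of points linked by
  \<open>\<eta>\<close>-chains, but the point where the tail begins may depend on \<open>\<eta>\<close>. If it did,
  some \<open>c i\<close> with arbitrarily large \<open>i\<close> would be separated from the tail by suitable
  \<open>\<eta>\<close>, and one could choose a subsequence \<open>c (b t)\<close> and a decreasing sequence \<open>h t\<close> such that
  \<open>c (b t)\<close> is not linked by \<open>h t\<close>-chains to any later point. Let \<open>D\<close> consist of the points with
  even index, and obtain \<open>D'\<close> by replacing those beyond \<open>2 * J\<close> by the single point
  \<open>c (b (2 * J + 1))\<close>. A chain from \<open>D\<close> to \<open>D'\<close> links this point to an even one, earlier or
  later, and both are excluded.\<close>
lemma cauchy_eventually_linked:
  assumes c: "\<And>n. c n \<in> F" and cau: "cauchy_seq m c"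
    and nonconv: "\<And>x. x \<in> mspace m \<Longrightarrow> \<exists>r>0. \<exists>N. \<forall>n\<ge>N. r \<le> mdist m x (c n)"
    and S: "S \<subseteq> mspace m" and e: "e > 0" and sub: "around m (range c) e \<subseteq> S"
  shows "\<exists>N. \<forall>i\<ge>N. \<forall>j\<ge>N. \<forall>\<eta>>0. \<exists>k. (c i, c j) \<in> close_rel m \<eta> S ^^ k"
proof (rule ccontr)
  define lk where "lk \<eta> i j \<longleftrightarrow> (\<exists>k. (c i, c j) \<in> close_rel m \<eta> S ^^ k)" for \<eta> i j
  have cm: "c n \<in> mspace m" for n using c Fm by auto
  have cS: "c n \<in> S" for n 
    using subsetD[OF sub, OF in_around[of "c n"]] cm e by simp
  have lk_sym: "lk \<eta> j i" if "lk \<eta> i j" for \<eta> i j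
    using that unfolding lk_def by (elim exE) (rule exI, erule close_rel_power_sym)
  have lk_trans: "lk \<eta> i j" if "lk \<eta> i h" "lk \<eta> h j" for \<eta> i j h
    using that unfolding lk_def by (elim exE) (rule exI, erule close_rel_power_trans)
  have lk_mono: "lk \<eta>' i j" if "lk \<eta> i j" "\<eta> \<le> \<eta>'" for \<eta> \<eta>' i j
    using that unfolding lk_def by (elim exE) (rule exI, erule close_rel_power_mono, auto)
  have tail: "\<exists>N. \<forall>i\<ge>N. \<forall>j\<ge>N. lk \<eta> i j" if \<eta>: "\<eta> > 0" for \<eta>
  proof -
    obtain N where N: "\<forall>i\<ge>N. \<forall>j\<ge>N. mdist m (c i) (c j) < \<eta>"
      using cau \<eta> unfolding cauchy_seq_def by blast
    have "lk \<eta> i j" if "i \<ge> N" "j \<ge> N" for i j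
    proof -
      have "(c i, c j) \<in> close_rel m \<eta> S ^^ 1" using N that cS by (auto simp: close_rel_def)
      then show ?thesis unfolding lk_def by blast
    qed
    then show ?thesis by blast
  qed
  assume "\<not> (\<exists>N. \<forall>i\<ge>N. \<forall>j\<ge>N. \<forall>\<eta>>0. \<exists>k. (c i, c j) \<in> close_rel m \<eta> S ^^ k)"
  then have bad: "\<exists>i\<ge>N. \<exists>j\<ge>N. \<exists>\<eta>>0. \<not> lk \<eta> i j" for N unfolding lk_def by blast
  have bad': "\<exists>i\<ge>N. \<exists>\<eta>. 0 < \<eta> \<and> (\<exists>M. \<forall>j\<ge>M. \<not> lk \<eta> i j)" for N
  proof -
    obtain i j \<eta> where ij: "i \<ge> N" "j \<ge> N" "\<eta> > 0" "\<not> lk \<eta> i j" using bad by blast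
    obtain M where M: "\<forall>i\<ge>M. \<forall>j\<ge>M. lk \<eta> i j" using tail ij by blast
    have "\<not> lk \<eta> i M \<or> \<not> lk \<eta> j M" using ij lk_sym lk_trans by blast
    then obtain h where h: "h \<ge> N" "\<not> lk \<eta> h M" using ij by blast
    have "\<not> lk \<eta> h j" if "j \<ge> M" for j
      using h M that lk_trans by blast
    then show ?thesis using h ij by blast
  qed
  have "\<exists>f. \<forall>t. (case f t of (i, \<eta>, M) \<Rightarrow> (0::real) < \<eta> \<and> i < M \<and> (\<forall>j\<ge>M. \<not> lk \<eta> i j)) \<and>
      (case f t of (i, \<eta>, M) \<Rightarrow> case f (Suc t) of (i', \<eta>', M') \<Rightarrow> M \<le> i' \<and> M \<le> M' \<and> \<eta>' \<le> \<eta>)"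
  proof (rule dependent_nat_choice)
    obtain i \<eta> M where "0 < \<eta>" "\<forall>j\<ge>M. \<not> lk \<eta> i j" using bad' by blast
    then show "\<exists>x. case x of (i, \<eta>, M) \<Rightarrow> (0::real) < \<eta> \<and> i < M \<and> (\<forall>j\<ge>M. \<not> lk \<eta> i j)"
      by (intro exI[of _ "(i, \<eta>, max M (Suc i))"]) auto
  next
    fix x :: "nat \<times> real \<times> nat" and t :: nat
    obtain i \<eta> M where x: "x = (i, \<eta>, M)" by (cases x) auto
    assume "case x of (i, \<eta>, M) \<Rightarrow> 0 < \<eta> \<and> i < M \<and> (\<forall>j\<ge>M. \<not> lk \<eta> i j)"
    then have \<eta>: "0 < \<eta>" using x by simp
    obtain i' \<eta>' M' where "i' \<ge> M" "0 < \<eta>'" "\<forall>j\<ge>M'. \<not> lk \<eta>' i' j" using bad' by blast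
    moreover have "\<not> lk (min \<eta> \<eta>') i' j" if "\<not> lk \<eta>' i' j" for j
      using that lk_mono[of "min \<eta> \<eta>'" i' j \<eta>'] by auto
    ultimately have "0 < min \<eta> \<eta>'" "i' < max M (max M' (Suc i'))" "M \<le> i'"
      "\<forall>j\<ge>max M (max M' (Suc i')). \<not> lk (min \<eta> \<eta>') i' j"
      using \<eta> by auto
    then show "\<exists>y. (case y of (i, \<eta>, M) \<Rightarrow> 0 < \<eta> \<and> i < M \<and> (\<forall>j\<ge>M. \<not> lk \<eta> i j)) \<and>
        (case x of (i, \<eta>, M) \<Rightarrow> case y of (i', \<eta>', M') \<Rightarrow> M \<le> i' \<and> M \<le> M' \<and> \<eta>' \<le> \<eta>)"
      unfolding x by (intro exI[of _ "(i', min \<eta> \<eta>', max M (max M' (Suc i')))"]) auto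
  qed
  then obtain f where f: "\<And>t. (case f t of (i, \<eta>, M) \<Rightarrow> (0::real) < \<eta> \<and> i < M \<and> (\<forall>j\<ge>M. \<not> lk \<eta> i j)) \<and>
      (case f t of (i, \<eta>, M) \<Rightarrow> case f (Suc t) of (i', \<eta>', M') \<Rightarrow> M \<le> i' \<and> M \<le> M' \<and> \<eta>' \<le> \<eta>)"
    by blast
  define b where "b t = fst (f t)" for t
  define h where "h t = fst (snd (f t))" for t
  define M where "M t = snd (snd (f t))" for t
  have f1: "0 < h t" "b t < M t" "\<And>j. j \<ge> M t \<Longrightarrow> \<not> lk (h t) (b t) j"
    "M t \<le> b (Suc t)" "M t \<le> M (Suc t)" "h (Suc t) \<le> h t" for t
    using f[of t] by (auto simp: b_def h_def M_def split: prod.splits)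
  have M_mono: "M t \<le> M u" if "t \<le> u" for t u using f1(5) that by (rule lift_Suc_mono_le)
  have h_anti: "h u \<le> h t" if "t \<le> u" for t u using f1(6) that by (rule lift_Suc_antimono_le)
  have b_less: "M t \<le> b u" if "t < u" for t u
  proof -
    obtain v where "u = Suc v" using \<open>t < u\<close> by (cases u) auto
    then show ?thesis using that M_mono[of t v] f1(4)[of v] by simp
  qed
  have b_ge: "t \<le> b t" for t
  proof (induction t)
    case (Suc t) then show ?case using f1(2)[of t] f1(4)[of t] by linarith
  qed simp
  have unlinked: "\<not> lk (h u) (b t) (b v)" if "t < v" "t \<le> u" for t u v
    using f1(3)[OF b_less[OF that(1)]] lk_mono h_anti[OF that(2)] by blast
  define D where "D = c ` range (\<lambda>t. b (2 * t))"
  have D0: "D \<in> D0_in m F"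
    unfolding D_def using c Fm cau nonconv by (rule cauchy_range_in_D0) auto
  from trace_chain_of_sets[OF D0 e] obtain d where d: "d > 0"
    "\<forall>D'\<in>D0_in m F. near_sets m d D D' \<longrightarrow> traced m e D D'"
    by (elim exE conjE)
  obtain J where J: "\<forall>i\<ge>J. \<forall>j\<ge>J. mdist m (c i) (c j) < d"
    using cau d unfolding cauchy_seq_def by blast
  have Jb: "mdist m (c (b i)) (c (b j)) < d" if "i \<ge> J" "j \<ge> J" for i j
    using J that b_ge le_trans by blast
  \<comment> \<open>Up to \<open>d\<close> the removed points coincide with the new one, as the sequence is Cauchy.\<close>
  define D' where "D' = c ` (insert (b (2 * J + 1)) ((\<lambda>t. b (2 * t)) ` {..J}))"
  have "D' \<in> D0_in m F"
    unfolding D'_def using c Fm cau nonconv by (rule cauchy_range_in_D0) auto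
  moreover have "\<forall>x\<in>D. \<exists>y\<in>D'. mdist m x y < d"
  proof
    fix x assume "x \<in> D"
    then obtain t where t: "x = c (b (2 * t))" by (auto simp: D_def)
    show "\<exists>y\<in>D'. mdist m x y < d"
    proof (cases "t \<le> J")
      case True
      then show ?thesis using t d cm by (intro bexI[of _ x]) (auto simp: D'_def)
    next
      case False
      then show ?thesis using t Jb[of "2 * t" "2 * J + 1"] by (auto simp: D'_def)
    qed
  qed
  moreover have "\<forall>y\<in>D'. \<exists>x\<in>D. mdist m y x < d"
  proof
    fix y assume "y \<in> D'"
    then consider "y = c (b (2 * J + 1))" | t where "y = c (b (2 * t))" by (auto simp: D'_def)
    then show "\<exists>x\<in>D. mdist m y x < d"
    proof cases
      case 1 then show ?thesis using Jb[of "2 * J + 1" "2 * J"] by (auto simp: D_def)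
    next
      case 2 then show ?thesis using d cm by (intro bexI[of _ y]) (auto simp: D_def)
    qed
  qed
  ultimately have "traced m e D D'" using d(2) unfolding near_sets_def by blast
  then obtain k where k: "\<forall>p\<in>D'. \<exists>q\<in>D. (q, p) \<in> close_rel m (h (2 * J + 1)) (around m D e) ^^ k"
    using f1(1)[of "2 * J + 1"] unfolding traced_def by blast
  have "c (b (2 * J + 1)) \<in> D'" by (auto simp: D'_def)
  then obtain q where q: "q \<in> D" "(q, c (b (2 * J + 1))) \<in> close_rel m (h (2 * J + 1)) (around m D e) ^^ k"
    using k by blast
  then obtain t where t: "q = c (b (2 * t))" by (auto simp: D_def)
  have "around m D e \<subseteq> S" using sub by (auto simp: around_def D_def)
  then have "(q, c (b (2 * J + 1))) \<in> close_rel m (h (2 * J + 1)) S ^^ k"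
    by (rule close_rel_power_mono[OF q(2) order_refl])
  then have l: "lk (h (2 * J + 1)) (b (2 * t)) (b (2 * J + 1))"
    unfolding lk_def t by blast
  show False
  proof (cases "t \<le> J")
    case True then show False using unlinked[of "2 * t" "2 * J + 1" "2 * J + 1"] l by simp
  next
    case False then show False using unlinked[of "2 * J + 1" "2 * t" "2 * J + 1"] lk_sym[OF l] by simp
  qed
qed

text \<open>\<open>D\<close> is a tail of the centres, and \<open>D'\<close> keeps finitely many of them and adds the set
  \<open>P\<close> belonging to the last one. This keeps \<open>D'\<close> separated although \<open>D\<close> is not. A chain between
  them links every point of \<open>P\<close> to some centre, and \<open>cauchy_eventually_linked\<close> leads on to the
  desired one; the number of steps is bounded because all but finitely many centres are within one step of
  each other.\<close>
lemma cauchy_centres_linked: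
  assumes sh: "shrinking m F c P" and cau: "cauchy_seq m c"
    and nonconv: "\<And>x. x \<in> mspace m \<Longrightarrow> \<exists>r>0. \<exists>N. \<forall>n\<ge>N. r \<le> mdist m x (c n)"
    and e: "e > 0"
  shows "\<exists>n. linked_set m e (c n) (P n)"
proof -
  note c = shrinkingD(1)[OF sh] and P = shrinkingD(2-4)[OF sh] and Psep = shrinkingD(5)[OF sh]
  have cm: "c n \<in> mspace m" for n using c Fm by auto
  have e2: "e/2 > 0" using e by simp
  obtain N1 where N1: "\<forall>i\<ge>N1. \<forall>j\<ge>N1. mdist m (c i) (c j) < e/2"
    using cau e2 unfolding cauchy_seq_def by blast
  define c' where "c' n = c (n + N1)" for n
  have c'c: "mdist m (c' i) (c' j) < e/2" for i j using N1 by (simp add: c'_def)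
  have c': "c' n \<in> F" for n using c by (simp add: c'_def)
  have c'm: "c' n \<in> mspace m" for n using c' Fm by auto
  have cau': "cauchy_seq m c'"
    unfolding cauchy_seq_def
  proof (intro allI impI)
    fix a :: real assume "a > 0"
    then obtain N where "\<forall>i\<ge>N. \<forall>j\<ge>N. mdist m (c i) (c j) < a" using cau unfolding cauchy_seq_def by blast
    then show "\<exists>N. \<forall>i\<ge>N. \<forall>j\<ge>N. mdist m (c' i) (c' j) < a"
      by (intro exI[of _ N]) (simp add: c'_def)
  qed
  have nonconv': "\<exists>r>0. \<exists>N. \<forall>n\<ge>N. r \<le> mdist m x (c' n)" if x: "x \<in> mspace m" for x
  proof -
    obtain r N where "r > 0" "\<forall>n\<ge>N. r \<le> mdist m x (c n)" using nonconv[OF x] by blast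
    then show ?thesis by (intro exI[of _ r] conjI exI[of _ N]) (simp_all add: c'_def)
  qed
  define S where "S = around m (range c') (e/2)"
  have S: "S \<subseteq> mspace m" by (simp add: S_def)
  have c'S: "c' n \<in> S" for n unfolding S_def using c'm e2 by (intro in_around) auto
  have Sn: "S \<subseteq> around m {c' n} e" for n
  proof
    fix x assume "x \<in> S"
    then obtain i where "x \<in> mspace m" "mdist m (c' i) x < e/2" by (auto simp: S_def around_def)
    then have "mdist m (c' n) x < e/2 + e/2" using c'c c'm by (intro mdist_triangle_less[of _ _ "c' i"]) auto
    then show "x \<in> around m {c' n} e" using \<open>x \<in> mspace m\<close> by (auto simp: around_def)
  qed
  obtain N where N: "\<forall>i\<ge>N. \<forall>j\<ge>N. \<forall>\<eta>>0. \<exists>k. (c' i, c' j) \<in> close_rel m \<eta> S ^^ k"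
    using cauchy_eventually_linked[OF c' cau' nonconv' S e2] S_def by blast
  define D where "D = c' ` {N..}"
  have D0: "D \<in> D0_in m F"
    unfolding D_def using c' Fm cau' nonconv' by (rule cauchy_range_in_D0) auto
  from trace_chain_of_sets[OF D0 e2] obtain d where d: "d > 0"
    "\<forall>D'\<in>D0_in m F. near_sets m d D D' \<longrightarrow> traced m (e/2) D D'"
    by (elim exE conjE)
  obtain J where J: "\<forall>i\<ge>J. \<forall>j\<ge>J. mdist m (c' i) (c' j) < d/2"
    using cau' d unfolding cauchy_seq_def by (meson half_gt_zero)
  have "d/2 > 0" using d by simp
  from shrinkingD(6)[OF sh this] obtain J' where J': "\<And>n. n \<ge> J' \<Longrightarrow> \<forall>p\<in>P n. mdist m (c n) p < d/2"
    unfolding eventually_sequentially by auto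
  define n where "n = max N (max J J')"
  have n: "n \<ge> N" "n \<ge> J" "\<forall>p\<in>P (n + N1). mdist m (c (n + N1)) p < d/2" using J' by (auto simp: n_def)
  define Q where "Q = P (n + N1)"
  have Q: "Q \<subseteq> F" "countable Q" "Q \<noteq> {}"
    using P[of "n + N1"] unfolding Q_def by auto
  have Qn: "mdist m (c' n) p < d/2" if "p \<in> Q" for p
    using that n(3) unfolding Q_def c'_def by blast
  have Qm: "p \<in> mspace m" if "p \<in> Q" for p using that Q(1) Fm by auto
  define D' where "D' = c' ` {N..n} \<union> Q"
  have "\<exists>t>0. separated m t D'"
  proof -
    obtain t where "t > 0" "separated m t Q" using Psep unfolding Q_def by blast
    then show ?thesis
      unfolding D'_def using c'm Qm by (intro separated_finite_Un) auto
  qed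
  then obtain t where "t > 0" "separated m t D'" by blast
  then have D'0: "D' \<in> D0_in m F"
    using c' Fm Q by (intro separated_in_D0[of _ _ _ t]) (auto simp: D'_def)
  have near1: "\<forall>x\<in>D. \<exists>y\<in>D'. mdist m x y < d"
  proof
    fix x assume "x \<in> D"
    then obtain i where i: "x = c' i" "i \<ge> N" by (auto simp: D_def)
    have "mdist m (c' i) (c' (min i n)) < d"
    proof (cases "i \<le> n")
      case True then show ?thesis using d c'm by (simp add: min_def)
    next
      case False
      then have "mdist m (c' i) (c' n) < d/2" using J n by auto
      then show ?thesis using d False by (simp add: min_def)
    qed
    then show "\<exists>y\<in>D'. mdist m x y < d"
      using i n by (intro bexI[of _ "c' (min i n)"]) (auto simp: D'_def)
  qed
  have near2: "\<forall>y\<in>D'. \<exists>x\<in>D. mdist m y x < d"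
  proof
    fix y assume "y \<in> D'"
    then consider i where "y = c' i" "i \<ge> N" | "y \<in> Q" by (auto simp: D'_def)
    then show "\<exists>x\<in>D. mdist m y x < d"
    proof cases
      case 1 then show ?thesis using d c'm by (intro bexI[of _ y]) (auto simp: D_def)
    next
      case 2
      then have "mdist m y (c' n) < d" using Qn[OF 2] d by (simp add: mdist_commute)
      then show ?thesis using n by (auto simp: D_def)
    qed
  qed
  have tra: "traced m (e/2) D D'" using d(2) D'0 near1 near2 unfolding near_sets_def by blast
  show ?thesis
    unfolding linked_set_def
  proof (rule exI[of _ "n + N1"], intro allI impI)
    fix \<eta> :: real assume \<eta>: "\<eta> > 0"
    obtain k where k: "\<forall>p\<in>D'. \<exists>q\<in>D. (q, p) \<in> close_rel m \<eta> (around m D (e/2)) ^^ k"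
      using tra \<eta> unfolding traced_def by blast
    obtain M0 where M0: "\<forall>i\<ge>M0. \<forall>j\<ge>M0. mdist m (c' i) (c' j) < \<eta>"
      using cau' \<eta> unfolding cauchy_seq_def by blast
    define M where "M = max M0 N"
    have "\<exists>K. \<forall>i. (c' n, c' (max i N)) \<in> close_rel m \<eta> S ^^ (K i)"
      using N \<eta> n by (intro choice) auto
    then obtain K where K: "\<And>i. (c' n, c' (max i N)) \<in> close_rel m \<eta> S ^^ (K i)" by blast
    \<comment> \<open>One more step leads from \<open>c' M\<close> to every later centre.\<close>
    define B where "B = Suc (Max (K ` {..M}))"
    have KB: "K i \<le> B" "Suc (K i) \<le> B" if "i \<le> M" for i
    proof -
      have "K i \<le> Max (K ` {..M})" using that by (intro Max_ge) auto
      then show "K i \<le> B" "Suc (K i) \<le> B" by (simp_all add: B_def)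
    qed
    have uni: "(c' n, c' i) \<in> close_rel m \<eta> S ^^ B" if "i \<ge> N" for i
    proof (cases "i \<le> M")
      case True
      then show ?thesis
        using close_rel_power_pad[OF K[of i] KB(1)[OF True] c'S S \<eta>] that by (simp add: max_def)
    next
      case False
      have "(c' n, c' M) \<in> close_rel m \<eta> S ^^ (K M)" using K[of M] by (simp add: M_def)
      moreover have "(c' M, c' i) \<in> close_rel m \<eta> S"
        using M0 False c'S by (auto simp: close_rel_def M_def)
      ultimately have "(c' n, c' i) \<in> close_rel m \<eta> S ^^ Suc (K M)" by auto
      then show ?thesis using close_rel_power_pad[OF _ KB(2) c'S S \<eta>] by simp
    qed
    have DS: "around m D (e/2) \<subseteq> S" by (auto simp: D_def S_def around_def)
    have "(c' n, p) \<in> close_rel m \<eta> (around m {c' n} e) ^^ (B + k)" if p: "p \<in> Q" for p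
    proof -
      obtain q where q: "q \<in> D" "(q, p) \<in> close_rel m \<eta> (around m D (e/2)) ^^ k"
        using k p by (auto simp: D'_def)
      have "(c' n, q) \<in> close_rel m \<eta> S ^^ B" using q(1) uni by (auto simp: D_def)
      moreover have "(q, p) \<in> close_rel m \<eta> S ^^ k"
        using DS by (rule close_rel_power_mono[OF q(2) order_refl])
      ultimately have "(c' n, p) \<in> close_rel m \<eta> S ^^ (B + k)" by (rule close_rel_power_trans)
      then show ?thesis using Sn by (rule close_rel_power_mono[OF _ order_refl])
    qed
    then show "\<exists>k. \<forall>p\<in>P (n + N1). (c (n + N1), p) \<in> close_rel m \<eta> (around m {c (n + N1)} e) ^^ k"
      unfolding Q_def c'_def by blast
  qed
qed

lemma shrinking_subseq:
  assumes sh: "shrinking m F c P" and r: "strict_mono r"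
  shows "shrinking m F (c \<circ> r) (P \<circ> r)"
proof -
  have "eventually (\<lambda>n. \<forall>p\<in>P (r n). mdist m (c (r n)) p < \<epsilon>) sequentially" if "\<epsilon> > 0" for \<epsilon>
    using eventually_subseq[OF r shrinkingD(6)[OF sh that]] .
  then show ?thesis using shrinkingD(1-5)[OF sh] unfolding shrinking_def by simp
qed

lemma centres_linked:
  assumes sh: "shrinking m F c P" and e: "e > 0"
  shows "\<exists>n. linked_set m e (c n) (P n)"
proof -
  note c = shrinkingD(1)[OF sh]
  have cm: "c n \<in> mspace m" for n using c Fm by auto
  have sub: ?thesis if "\<exists>n. linked_set m e ((c \<circ> r) n) ((P \<circ> r) n)" for r :: "nat \<Rightarrow> nat"
    using that by auto
  show ?thesis
  proof (rule cauchy_or_separated_subsequence[of c m, OF cm])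
    fix r :: "nat \<Rightarrow> nat" and s :: real assume r: "strict_mono r" and s: "s > 0" "\<And>i j. i \<noteq> j \<Longrightarrow> s \<le> mdist m (c (r i)) (c (r j))"
    show ?thesis
      by (rule sub[of r], rule separated_centres_linked[OF shrinking_subseq[OF sh r] s(1) _ e]) (simp add: s(2))
  next
    fix r :: "nat \<Rightarrow> nat" assume r: "strict_mono r" and cau: "cauchy_seq m (c \<circ> r)"
    show ?thesis
    proof (cases "\<exists>a\<in>mspace m. \<forall>\<epsilon>>0. \<forall>N. \<exists>n\<ge>N. mdist m a (c (r n)) < \<epsilon>")
      case True
      then obtain a where a: "a \<in> mspace m" "\<And>\<epsilon> N. \<epsilon> > 0 \<Longrightarrow> \<exists>n\<ge>N. mdist m a (c (r n)) < \<epsilon>" by blast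
      have "(\<lambda>n. mdist m ((c \<circ> r) n) a) \<longlonglongrightarrow> 0"
        unfolding o_def
      proof (rule LIMSEQ_I)
        fix \<epsilon> :: real assume \<epsilon>: "0 < \<epsilon>"
        then have "\<epsilon>/2 > 0" by simp
        with cau obtain N where N: "\<forall>i\<ge>N. \<forall>j\<ge>N. mdist m ((c \<circ> r) i) ((c \<circ> r) j) < \<epsilon>/2"
          unfolding cauchy_seq_def by blast
        obtain k where k: "k \<ge> N" "mdist m a (c (r k)) < \<epsilon>/2" using a(2)[OF \<open>\<epsilon>/2 > 0\<close>] by blast
        have "mdist m (c (r n)) a < \<epsilon>/2 + \<epsilon>/2" if "n \<ge> N" for n
          using N that k a(1) cm by (intro mdist_triangle_less[of _ _ "c (r k)"]) (auto simp: mdist_commute)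
        then show "\<exists>N. \<forall>n\<ge>N. norm (mdist m (c (r n)) a - 0) < \<epsilon>" by (intro exI[of _ N]) simp
      qed
      moreover have "a \<in> F"
      proof (rule closed_nonempty_limit[OF F a(1)])
        fix \<epsilon> :: real assume "\<epsilon> > 0"
        then obtain n where "mdist m a (c (r n)) < \<epsilon>" using a(2) by blast
        then show "\<exists>y\<in>F. mdist m a y < \<epsilon>" using c by blast
      qed
      ultimately show ?thesis
        by (intro sub[of r] convergent_centres_linked[OF shrinking_subseq[OF sh r] _ _ e])
    next
      case False
      have nc: "\<exists>\<epsilon>>0. \<exists>N. \<forall>n\<ge>N. \<epsilon> \<le> mdist m x (c (r n))" if x: "x \<in> mspace m" for x
      proof -
        have "\<not> (\<forall>\<epsilon>>0. \<forall>N. \<exists>n\<ge>N. mdist m x (c (r n)) < \<epsilon>)" using False x by blast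
        then show ?thesis by (meson not_le)
      qed
      show ?thesis
        by (rule sub[of r], rule cauchy_centres_linked[OF shrinking_subseq[OF sh r] cau _ e]) (simp add: nc)
    qed
  qed
qed

text \<open>Points whose chains to \<open>c\<close> get longer and longer are thinned out to a set that may occur as
  \<open>P n\<close> above. A separated subsequence will do. In a Cauchy subsequence a single point suffices: if it
  were linked to \<open>c\<close> at all, one more step would link all later points.\<close>
lemma unlinked_sequence_to_separated_set:
  assumes c: "c \<in> F" and p: "\<And>l. p l \<in> F" "\<And>l. mdist m c (p l) < s"
    and un: "\<And>l. (c, p l) \<notin> close_rel m \<eta> (around m {c} e) ^^ l"
    and "s \<le> e" "\<eta> > 0"
  shows "\<exists>P. P \<subseteq> F \<and> (\<forall>q\<in>P. mdist m c q < s) \<and> countable P \<and> P \<noteq> {} \<and> (\<exists>t>0. separated m t P) \<and>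
     \<not> (\<exists>k. \<forall>q\<in>P. (c, q) \<in> close_rel m \<eta> (around m {c} e) ^^ k)"
proof -
  have pm: "p l \<in> mspace m" for l using p Fm by auto
  have pe: "p l \<in> around m {c} e" for l using p(2)[of l] pm[of l] \<open>s \<le> e\<close> by (auto simp: around_def)
  have un': "(c, p l) \<notin> close_rel m \<eta> (around m {c} e) ^^ k" if "k \<le> l" for k l
    using un[of l] close_rel_power_pad[OF _ that pe _ \<open>\<eta> > 0\<close>, of c] by auto
  show ?thesis
  proof (rule cauchy_or_separated_subsequence[of p m, OF pm])
    fix r :: "nat \<Rightarrow> nat" and t :: real assume r: "strict_mono r" and t: "t > 0" "\<And>i j. i \<noteq> j \<Longrightarrow> t \<le> mdist m (p (r i)) (p (r j))"
    have "separated m t (range (\<lambda>i. p (r i)))" unfolding separated_def using t(2) by auto metis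
    moreover have "\<exists>q\<in>range (\<lambda>i. p (r i)). (c, q) \<notin> close_rel m \<eta> (around m {c} e) ^^ k" for k
      using un'[of k "r k"] seq_suble[OF r, of k] by blast
    ultimately show ?thesis
      using p t by (intro exI[of _ "range (\<lambda>i. p (r i))"]) auto
  next
    fix r :: "nat \<Rightarrow> nat" assume r: "strict_mono r" and cau: "cauchy_seq m (p \<circ> r)"
    obtain N where N: "\<forall>i\<ge>N. \<forall>j\<ge>N. mdist m ((p \<circ> r) i) ((p \<circ> r) j) < \<eta>"
      using cau \<open>\<eta> > 0\<close> unfolding cauchy_seq_def by blast
    have "(c, p (r N)) \<notin> close_rel m \<eta> (around m {c} e) ^^ k" for k
    proof
      assume k: "(c, p (r N)) \<in> close_rel m \<eta> (around m {c} e) ^^ k"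
      define j where "j = max N (Suc k)"
      have "(p (r N), p (r j)) \<in> close_rel m \<eta> (around m {c} e)"
        using N pe by (auto simp: close_rel_def j_def)
      then have "(c, p (r j)) \<in> close_rel m \<eta> (around m {c} e) ^^ Suc k" using k by auto
      moreover have "Suc k \<le> r j" using seq_suble[OF r, of j] by (simp add: j_def)
      ultimately show False using un' by blast
    qed
    then show ?thesis
      using p by (intro exI[of _ "{p (r N)}"]) (auto simp: separated_def intro!: exI[of _ 1])
  qed
qed

text \<open>If uniformity fails for \<open>\<epsilon>\<close>, there are for each \<open>\<delta>\<close> pairs \<open>x \<delta> l\<close>, \<open>y \<delta> l\<close>
  at distance below \<open>\<delta>\<close> that no chain with at most \<open>l\<close> steps links. Either, for one \<open>s\<close> and
  arbitrarily small \<open>\<delta>\<close>, the points \<open>x \<delta> l\<close> leave all \<open>s\<close>-balls about each other, which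
  \<open>separated_family_linked\<close> excludes. Or, for arbitrarily small \<open>s\<close>, infinitely many pairs lie close to one
  point \<open>c\<close>; then some members of these pairs have no short chains to \<open>c\<close>, and the resulting centres
  and sets contradict \<open>centres_linked\<close>.\<close>
theorem chain_equiconnected: "uniformly_locally_chain_equiconnected_at m F"
proof (rule ccontr)
  assume neg: "\<not> uniformly_locally_chain_equiconnected_at m F"
  let ?L = "chain_linked m"
  from neg have "\<not> (\<forall>\<epsilon>>0. \<exists>\<delta>>0. \<forall>\<eta>>0. \<exists>l. \<forall>x\<in>F. \<forall>y\<in>F. mdist m x y < \<delta> \<longrightarrow> ?L \<epsilon> \<eta> l x y)"
    unfolding equiconnected_iff_chain_linked .
  then obtain \<epsilon> where \<epsilon>: "\<epsilon> > 0"
    and n: "\<not> (\<exists>\<delta>>0. \<forall>\<eta>>0. \<exists>l. \<forall>x\<in>F. \<forall>y\<in>F. mdist m x y < \<delta> \<longrightarrow> ?L \<epsilon> \<eta> l x y)"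
    by (simp only: not_all not_imp) (elim exE conjE)
  have "\<exists>\<eta>. \<delta> > 0 \<longrightarrow> \<eta> > 0 \<and> (\<forall>l. \<exists>x\<in>F. \<exists>y\<in>F. mdist m x y < \<delta> \<and> \<not> ?L \<epsilon> \<eta> l x y)" for \<delta>
  proof (cases "\<delta> > 0")
    case True
    then have "\<not> (\<forall>\<eta>>0. \<exists>l. \<forall>x\<in>F. \<forall>y\<in>F. mdist m x y < \<delta> \<longrightarrow> ?L \<epsilon> \<eta> l x y)"
      using n by (simp only: not_ex de_Morgan_conj) simp
    then show ?thesis by simp
  qed simp
  then have "\<forall>\<delta>. \<exists>\<eta>. \<delta> > 0 \<longrightarrow> \<eta> > 0 \<and> (\<forall>l. \<exists>x\<in>F. \<exists>y\<in>F. mdist m x y < \<delta> \<and> \<not> ?L \<epsilon> \<eta> l x y)"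
    by (rule allI)
  then obtain \<eta> where "\<forall>\<delta>. \<delta> > 0 \<longrightarrow> \<eta> \<delta> > 0 \<and> (\<forall>l. \<exists>x\<in>F. \<exists>y\<in>F. mdist m x y < \<delta> \<and> \<not> ?L \<epsilon> (\<eta> \<delta>) l x y)"
    by (rule choice[THEN exE])
  then have \<eta>: "\<And>\<delta>. \<delta> > 0 \<Longrightarrow> \<eta> \<delta> > 0"
    and ex: "\<And>\<delta> l. \<delta> > 0 \<Longrightarrow> \<exists>x\<in>F. \<exists>y\<in>F. mdist m x y < \<delta> \<and> \<not> ?L \<epsilon> (\<eta> \<delta>) l x y"
    by simp_all
  have "\<forall>\<delta> l. \<exists>x y. \<delta> > 0 \<longrightarrow> x \<in> F \<and> y \<in> F \<and> mdist m x y < \<delta> \<and> \<not> ?L \<epsilon> (\<eta> \<delta>) l x y"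
    using ex by blast
  then obtain x y where "\<forall>\<delta> l. \<delta> > 0 \<longrightarrow> x \<delta> l \<in> F \<and> y \<delta> l \<in> F \<and> mdist m (x \<delta> l) (y \<delta> l) < \<delta> \<and>
      \<not> ?L \<epsilon> (\<eta> \<delta>) l (x \<delta> l) (y \<delta> l)"
    by metis
  then have xy: "\<And>\<delta> l. \<delta> > 0 \<Longrightarrow> x \<delta> l \<in> F" "\<And>\<delta> l. \<delta> > 0 \<Longrightarrow> y \<delta> l \<in> F"
      "\<And>\<delta> l. \<delta> > 0 \<Longrightarrow> mdist m (x \<delta> l) (y \<delta> l) < \<delta>"
    and nochain: "\<And>\<delta> l. \<delta> > 0 \<Longrightarrow> \<not> ?L \<epsilon> (\<eta> \<delta>) l (x \<delta> l) (y \<delta> l)"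
    by simp_all
  define e where "e = \<epsilon>/2"
  have e: "e > 0" using \<epsilon> by (simp add: e_def)
  have unl: "(x \<delta> l, y \<delta> l) \<notin> close_rel m (\<eta> \<delta>) (around m {z} e) ^^ k"
    if \<delta>: "\<delta> > 0" "k \<le> l" and xz: "x \<delta> l \<in> around m {z} e" "z \<in> mspace m" for \<delta> k l z
  proof
    assume k: "(x \<delta> l, y \<delta> l) \<in> close_rel m (\<eta> \<delta>) (around m {z} e) ^^ k"
    have "mdist m p q < \<epsilon>" if "p \<in> around m {z} e" "q \<in> around m {z} e" for p q
    proof -
      have "mdist m p q < e + e"
        using that xz(2) by (intro mdist_triangle_less[of _ _ z]) (auto simp: around_def mdist_commute)
      then show ?thesis by (simp add: e_def)
    qed
    then obtain c where "chain_linking m (\<eta> \<delta>) k c (x \<delta> l) (y \<delta> l)" "chain_diam m k c < \<epsilon>"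
      using close_rel_power_imp_chain[OF k xz(1) around_subset] by metis
    then show False using nochain[OF \<delta>(1), of l] \<delta>(2) unfolding chain_linked_def by blast
  qed
  show False
  proof (cases "\<exists>s>0. \<forall>\<delta>0>0. \<exists>\<delta>>0. \<delta> \<le> \<delta>0 \<and> (\<forall>l0. finite {l. mdist m (x \<delta> l) (x \<delta> l0) < s})")
    case True
    then obtain s where s: "s > 0" "\<And>\<delta>0. \<delta>0 > 0 \<Longrightarrow> \<exists>\<delta>>0. \<delta> \<le> \<delta>0 \<and> (\<forall>l0. finite {l. mdist m (x \<delta> l) (x \<delta> l0) < s})"
      by blast
    have "\<forall>n. \<exists>\<delta>>0. \<delta> \<le> inverse (real (Suc n)) \<and> (\<forall>l0. finite {l. mdist m (x \<delta> l) (x \<delta> l0) < s})"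
      using s(2) by simp
    then obtain \<delta> where \<delta>: "\<And>n. \<delta> n > 0" "\<And>n. \<delta> n \<le> inverse (real (Suc n))"
      "\<And>n l0. finite {l. mdist m (x (\<delta> n) l) (x (\<delta> n) l0) < s}"
      by metis
    have \<delta>0: "\<delta> \<longlonglongrightarrow> 0"
      by (rule tendsto_sandwich[OF _ _ tendsto_const LIMSEQ_inverse_real_of_nat])
        (use \<delta>(1,2) less_imp_le in \<open>auto intro!: always_eventually\<close>)
    have fin: "finite {l. mdist m (x (\<delta> n) l) u < s/2}" if u: "u \<in> mspace m" for n u
    proof (rule ccontr)
      assume inf: "infinite {l. mdist m (x (\<delta> n) l) u < s/2}"
      then obtain l0 where l0: "mdist m (x (\<delta> n) l0) u < s/2" using not_finite_existsD by blast
      have "mdist m (x (\<delta> n) l) (x (\<delta> n) l0) < s/2 + s/2" if "mdist m (x (\<delta> n) l) u < s/2" for l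
        using that l0 u xy(1)[OF \<delta>(1)] Fm by (intro mdist_triangle_less[of _ _ u]) (auto simp: mdist_commute)
      then have "{l. mdist m (x (\<delta> n) l) u < s/2} \<subseteq> {l. mdist m (x (\<delta> n) l) (x (\<delta> n) l0) < s}" by auto
      then show False using inf \<delta>(3) finite_subset by blast
    qed
    have "s/2 > 0" using s by simp
    from separated_family_linked[OF xy(1)[OF \<delta>(1)] xy(2)[OF \<delta>(1)] xy(3)[OF \<delta>(1)] \<delta>0 this fin e]
    obtain n where n: "\<And>\<eta>'. \<eta>' > 0 \<Longrightarrow> \<exists>k. \<exists>l\<ge>k. (x (\<delta> n) l, y (\<delta> n) l) \<in> close_rel m \<eta>' (around m {x (\<delta> n) l} e) ^^ k"
      by blast
    then obtain k l where "l \<ge> k" "(x (\<delta> n) l, y (\<delta> n) l) \<in> close_rel m (\<eta> (\<delta> n)) (around m {x (\<delta> n) l} e) ^^ k"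
      using \<eta>[OF \<delta>(1)] by blast
    moreover have "x (\<delta> n) l \<in> mspace m" using xy(1)[OF \<delta>(1)] Fm by blast
    ultimately show False using unl[OF \<delta>(1)] in_around[of _ "{x (\<delta> n) l}"] e by blast
  next
    case False
    have *: "\<exists>c\<in>F. \<exists>\<delta>>0. \<forall>l. \<exists>p\<in>F. mdist m c p < s \<and> (c, p) \<notin> close_rel m (\<eta> \<delta>) (around m {c} e) ^^ l"
      if s: "s > 0" "s \<le> e" for s
    proof -
      obtain \<delta>0 where \<delta>0: "\<delta>0 > 0" "\<And>\<delta>. \<delta> > 0 \<Longrightarrow> \<delta> \<le> \<delta>0 \<Longrightarrow> \<exists>l0. infinite {l. mdist m (x \<delta> l) (x \<delta> l0) < s/2}"
        using False half_gt_zero[OF s(1)] by meson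
      define \<delta> where "\<delta> = min \<delta>0 (s/2)"
      have \<delta>: "\<delta> > 0" "\<delta> \<le> \<delta>0" "\<delta> \<le> s/2" using \<delta>0 s by (auto simp: \<delta>_def)
      obtain l0 where inf: "infinite {l. mdist m (x \<delta> l) (x \<delta> l0) < s/2}" using \<delta>0(2)[OF \<delta>(1,2)] by blast
      define c where "c = x \<delta> l0"
      have c: "c \<in> F" using xy(1)[OF \<delta>(1)] by (simp add: c_def)
      have cm: "c \<in> mspace m" using c Fm by blast
      have "\<exists>p\<in>F. mdist m c p < s \<and> (c, p) \<notin> close_rel m (\<eta> \<delta>) (around m {c} e) ^^ l" for l
      proof -
        \<comment> \<open>Chains with \<open>l\<close> steps from \<open>c\<close> to both members would give one with \<open>2 * l\<close> steps.\<close>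
        obtain l' where l': "l' \<ge> l + l" "mdist m (x \<delta> l') c < s/2"
          using inf unfolding infinite_nat_iff_unbounded_le c_def by blast
        have ms: "x \<delta> l' \<in> F" "y \<delta> l' \<in> F" "x \<delta> l' \<in> mspace m" "y \<delta> l' \<in> mspace m" using xy[OF \<delta>(1)] Fm by auto
        have x1: "mdist m c (x \<delta> l') < s/2" using l' by (simp add: mdist_commute)
        have "mdist m (x \<delta> l') (y \<delta> l') < s/2" using xy(3)[OF \<delta>(1)] \<delta>(3) by (rule less_le_trans)
        from mdist_triangle_less[OF x1 this cm ms(3,4)] have y1: "mdist m c (y \<delta> l') < s" by simp
        have "x \<delta> l' \<in> around m {c} e" using x1 s ms by (auto simp: around_def)
        then have nl: "(x \<delta> l', y \<delta> l') \<notin> close_rel m (\<eta> \<delta>) (around m {c} e) ^^ (l + l)"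
          using unl[OF \<delta>(1) l'(1) _ cm] by blast
        show ?thesis
        proof (cases "(c, x \<delta> l') \<in> close_rel m (\<eta> \<delta>) (around m {c} e) ^^ l")
          case True
          then have "(c, y \<delta> l') \<notin> close_rel m (\<eta> \<delta>) (around m {c} e) ^^ l"
            using nl close_rel_power_trans[OF close_rel_power_sym[OF True]] by blast
          then show ?thesis using y1 ms by blast
        next
          case False
          then show ?thesis using x1 s ms by (intro bexI[of _ "x \<delta> l'"]) auto
        qed
      qed
      then show ?thesis using c \<delta> by blast
    qed
    define sn where "sn n = min e (inverse (real (Suc n)))" for n
    have sn: "sn n > 0" "sn n \<le> e" for n using e by (auto simp: sn_def)
    have sn0: "sn \<longlonglongrightarrow> 0"
      by (rule tendsto_sandwich[OF _ _ tendsto_const LIMSEQ_inverse_real_of_nat])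
        (use sn less_imp_le in \<open>auto intro!: always_eventually simp: sn_def\<close>)
    have "\<exists>c \<delta> P. c \<in> F \<and> \<delta> > 0 \<and> P \<subseteq> F \<and> (\<forall>q\<in>P. mdist m c q < sn n) \<and> countable P \<and> P \<noteq> {} \<and> (\<exists>t>0. separated m t P) \<and>
        \<not> (\<exists>k. \<forall>q\<in>P. (c, q) \<in> close_rel m (\<eta> \<delta>) (around m {c} e) ^^ k)" for n
    proof -
      obtain c \<delta> where c: "c \<in> F" "\<delta> > 0" and "\<forall>l. \<exists>p\<in>F. mdist m c p < sn n \<and> (c, p) \<notin> close_rel m (\<eta> \<delta>) (around m {c} e) ^^ l"
        using *[OF sn] by blast
      then obtain p where p: "\<And>l. p l \<in> F" "\<And>l. mdist m c (p l) < sn n"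
         "\<And>l. (c, p l) \<notin> close_rel m (\<eta> \<delta>) (around m {c} e) ^^ l" by metis
      from unlinked_sequence_to_separated_set[where p = p, OF c(1) p sn(2) \<eta>[OF c(2)]]
      obtain P where "P \<subseteq> F \<and> (\<forall>q\<in>P. mdist m c q < sn n) \<and> countable P \<and> P \<noteq> {} \<and> (\<exists>t>0. separated m t P) \<and>
        \<not> (\<exists>k. \<forall>q\<in>P. (c, q) \<in> close_rel m (\<eta> \<delta>) (around m {c} e) ^^ k)" by (elim exE)
      then show ?thesis using c by (intro exI[of _ c] exI[of _ \<delta>] exI[of _ P]) simp
    qed
    then obtain c \<delta> P where "\<And>n. c n \<in> F \<and> \<delta> n > (0::real) \<and> P n \<subseteq> F \<and> (\<forall>q\<in>P n. mdist m (c n) q < sn n) \<and>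
        countable (P n) \<and> P n \<noteq> {} \<and> (\<exists>t>0. separated m t (P n)) \<and>
        \<not> (\<exists>k. \<forall>q\<in>P n. (c n, q) \<in> close_rel m (\<eta> (\<delta> n)) (around m {c n} e) ^^ k)" by metis
    then have cP: "\<And>n. c n \<in> F" "\<And>n. \<delta> n > 0" "\<And>n. P n \<subseteq> F" "\<And>n q. q \<in> P n \<Longrightarrow> mdist m (c n) q < sn n"
        "\<And>n. countable (P n)" "\<And>n. P n \<noteq> {}" "\<And>n. \<exists>t>0. separated m t (P n)"
        "\<And>n. \<not> (\<exists>k. \<forall>q\<in>P n. (c n, q) \<in> close_rel m (\<eta> (\<delta> n)) (around m {c n} e) ^^ k)"
      by simp_all
    have "eventually (\<lambda>n. \<forall>p\<in>P n. mdist m (c n) p < \<epsilon>') sequentially" if "\<epsilon>' > 0" for \<epsilon>'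
      using order_tendstoD(2)[OF sn0 that] by eventually_elim (use cP(4) less_trans in blast)
    then have "shrinking m F c P" unfolding shrinking_def using cP(1,3,5-7) by simp
    from centres_linked[OF this e]
    obtain n where "linked_set m e (c n) (P n)" by blast
    then show False using cP(8)[of n] \<eta>[OF cP(2)[of n]] unfolding linked_set_def by blast
  qed
qed

end


section \<open>Lipschitz maps into a dense set\<close>

text \<open>Each \<open>p \<in> A\<close> confines the new value to an open interval about \<open>g p\<close>. Any two of these
  intervals overlap by the Lipschitz bound, hence all of them do, inside \<open>[0, 1]\<close>.\<close>
lemma lipschitz_step:
  fixes g :: "real \<Rightarrow> real"
  assumes A: "finite A" "q \<notin> A" and g: "\<And>p. p \<in> A \<Longrightarrow> 0 \<le> g p \<and> g p \<le> 1"
    and lip: "\<And>p p'. p \<in> A \<Longrightarrow> p' \<in> A \<Longrightarrow> p \<noteq> p' \<Longrightarrow> \<bar>g p - g p'\<bar> < 2 * \<bar>p - p'\<bar>"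
    and E: "\<And>a b. 0 \<le> a \<Longrightarrow> a < b \<Longrightarrow> b \<le> 1 \<Longrightarrow> \<exists>e\<in>E. a < e \<and> e < b"
  shows "\<exists>e\<in>E. \<forall>p\<in>A. \<bar>e - g p\<bar> < 2 * \<bar>q - p\<bar>"
proof -
  define Lo where "Lo = insert 0 ((\<lambda>p. g p - 2 * \<bar>q - p\<bar>) ` A)"
  define Up where "Up = insert 1 ((\<lambda>p. g p + 2 * \<bar>q - p\<bar>) ` A)"
  have fin: "finite Lo" "finite Up" "Lo \<noteq> {}" "Up \<noteq> {}" using A by (auto simp: Lo_def Up_def)
  have ne: "\<bar>q - p\<bar> > 0" if "p \<in> A" for p using that A by auto
  have pair: "g p - 2 * \<bar>q - p\<bar> < g p' + 2 * \<bar>q - p'\<bar>" if "p \<in> A" "p' \<in> A" for p p'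
  proof (cases "p = p'")
    case True then show ?thesis using ne[OF that(1)] by simp
  next
    case False
    have tri: "\<bar>p - p'\<bar> \<le> \<bar>q - p\<bar> + \<bar>q - p'\<bar>" by linarith
    have "g p - g p' < 2 * \<bar>p - p'\<bar>"
      using lip[OF that False] by (rule le_less_trans[OF abs_ge_self])
    also have "\<dots> \<le> 2 * \<bar>q - p\<bar> + 2 * \<bar>q - p'\<bar>" using mult_left_mono[OF tri, of 2] by simp
    finally show ?thesis by (simp add: algebra_simps)
  qed
  have "a < b" if ab: "a \<in> Lo" "b \<in> Up" for a b
  proof -
    consider "a = 0" "b = 1" | p where "p \<in> A" "a = 0" "b = g p + 2 * \<bar>q - p\<bar>"
      | p where "p \<in> A" "a = g p - 2 * \<bar>q - p\<bar>" "b = 1"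
      | p p' where "p \<in> A" "p' \<in> A" "a = g p - 2 * \<bar>q - p\<bar>" "b = g p' + 2 * \<bar>q - p'\<bar>"
      using ab unfolding Lo_def Up_def by blast
    then show ?thesis
    proof cases
      case (2 p)
      have "0 < 2 * \<bar>q - p\<bar>" using ne[OF 2(1)] by simp
      then show ?thesis using g[OF 2(1)] 2 by linarith
    next
      case (3 p)
      have "0 < 2 * \<bar>q - p\<bar>" using ne[OF 3(1)] by simp
      then show ?thesis using g[OF 3(1)] 3 by linarith
    next
      case (4 p p') then show ?thesis using pair by simp
    qed simp
  qed
  then have "Max Lo < Min Up" using fin by simp
  moreover have "0 \<le> Max Lo" "Min Up \<le> 1" using fin by (simp_all add: Lo_def Up_def)
  ultimately obtain e where e: "e \<in> E" "Max Lo < e" "e < Min Up" using E by blast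
  have "\<bar>e - g p\<bar> < 2 * \<bar>q - p\<bar>" if "p \<in> A" for p
  proof -
    have "g p - 2 * \<bar>q - p\<bar> \<le> Max Lo" "Min Up \<le> g p + 2 * \<bar>q - p\<bar>"
      using that fin by (auto simp: Lo_def Up_def)
    then show ?thesis using e unfolding abs_less_iff by linarith
  qed
  then show ?thesis using e by blast
qed

text \<open>The values are chosen one after the other along an enumeration of \<open>Q\<close>. Because the Lipschitz bounds
  between the values already chosen are strict, the admissible values at the next point fill a nondegenerate
  interval, which meets \<open>E\<close>. The prescribed values at 0 and 1 force a constant of at least 1, and 2 leaves
  the room that strict bounds require.\<close>
lemma lipschitz_into_dense:
  fixes Q E :: "real set"
  assumes Q: "countable Q" "Q \<subseteq> {0..1}" and E: "E \<subseteq> {0..1}" "0 \<in> E" "1 \<in> E"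
    and dense: "\<And>a b. 0 \<le> a \<Longrightarrow> a < b \<Longrightarrow> b \<le> 1 \<Longrightarrow> \<exists>e\<in>E. a < e \<and> e < b"
  shows "\<exists>\<phi>. (\<forall>q\<in>Q. \<phi> q \<in> E) \<and> \<phi> 0 = 0 \<and> \<phi> 1 = 1 \<and>
    (\<forall>q\<in>Q. \<forall>q'\<in>Q. \<bar>\<phi> q - \<phi> q'\<bar> \<le> 2 * \<bar>q - q'\<bar>)"
proof -
  define n where "n = to_nat_on Q"
  define ext where "ext f q = (if q = 0 then 0 else if q = 1 then 1 else f q)" for f :: "real \<Rightarrow> real" and q
  define before where "before q = insert 0 (insert 1 {p \<in> Q. n p < n q})" for q
  have n_inj: "p = q" if "p \<in> Q" "q \<in> Q" "n p = n q" for p q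
    using inj_on_to_nat_on[OF Q(1)] that unfolding n_def inj_on_def by blast
  have fin: "finite (before q)" for q
  proof -
    have "finite (n ` {p \<in> Q. n p < n q})" by (rule finite_subset[of _ "{..<n q}"]) auto
    then have "finite {p \<in> Q. n p < n q}"
      by (rule finite_imageD) (use n_inj in \<open>auto simp: inj_on_def\<close>)
    then show ?thesis by (simp add: before_def)
  qed
  define P where "P f q e \<longleftrightarrow> (q \<in> Q - {0, 1} \<longrightarrow> e \<in> E \<and> (\<forall>p\<in>before q. \<bar>e - ext f p\<bar> < 2 * \<bar>q - p\<bar>))" for f q e
  have "\<exists>f. \<forall>q. P f q (f q)"
  proof (rule dependent_wf_choice[where R = "inv_image less_than n"])
    show "wf (inv_image less_than n)" by simp
  next
    fix f g :: "real \<Rightarrow> real" and q r :: real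
    assume eq: "\<And>z. (z, q) \<in> inv_image less_than n \<Longrightarrow> f z = g z"
    have "ext f p = ext g p" if "p \<in> before q" for p
      using that eq by (auto simp: ext_def before_def)
    then show "P f q r = P g q r" by (simp add: P_def)
  next
    fix q :: real and f :: "real \<Rightarrow> real"
    assume IH: "\<And>y. (y, q) \<in> inv_image less_than n \<Longrightarrow> P f y (f y)"
    have IH': "f y \<in> E" "\<And>p. p \<in> before y \<Longrightarrow> \<bar>f y - ext f p\<bar> < 2 * \<bar>y - p\<bar>"
      if "y \<in> Q" "y \<noteq> 0" "y \<noteq> 1" "n y < n q" for y
      using IH[of y] that by (auto simp: P_def)
    show "\<exists>r. P f q r"
    proof (cases "q \<in> Q - {0, 1}")
      case True
      have bound: "0 \<le> ext f p \<and> ext f p \<le> 1" if "p \<in> before q" for p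
      proof (cases "p = 0 \<or> p = 1")
        case False
        then have "f p \<in> E" using IH'(1)[of p] that by (auto simp: before_def)
        then show ?thesis using E False by (auto simp: ext_def)
      qed (auto simp: ext_def)
      have lip1: "\<bar>ext f y - ext f p\<bar> < 2 * \<bar>y - p\<bar>"
        if "y \<in> before q" "y \<noteq> 0" "y \<noteq> 1" "p \<in> before y" for y p
        using IH'(2)[of y p] that by (auto simp: before_def ext_def)
      have "\<bar>ext f p - ext f p'\<bar> < 2 * \<bar>p - p'\<bar>" if pp: "p \<in> before q" "p' \<in> before q" "p \<noteq> p'" for p p'
      proof -
        consider "p \<in> {0, 1}" "p' \<in> {0, 1}" | "p \<notin> {0, 1}" "p' \<in> before p" | "p' \<notin> {0, 1}" "p \<in> before p'"
          using pp n_inj[of p p'] by (cases "n p" "n p'" rule: linorder_cases) (auto simp: before_def)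
        then show ?thesis
        proof cases
          case 1 then show ?thesis using pp by (auto simp: ext_def)
        next
          case 2 then show ?thesis using lip1[of p p'] pp by auto
        next
          case 3 then show ?thesis using lip1[of p' p] pp by (auto simp: abs_minus_commute)
        qed
      qed
      then have "\<exists>e\<in>E. \<forall>p\<in>before q. \<bar>e - ext f p\<bar> < 2 * \<bar>q - p\<bar>"
        using True bound dense by (intro lipschitz_step[OF fin]) (auto simp: before_def)
      then show ?thesis by (auto simp: P_def)
    qed (auto simp: P_def)
  qed
  then obtain f where f: "\<And>q. P f q (f q)" by blast
  have lip1: "\<bar>ext f y - ext f p\<bar> < 2 * \<bar>y - p\<bar>" if "y \<in> Q" "y \<noteq> 0" "y \<noteq> 1" "p \<in> before y" for y p
    using f[of y] that by (auto simp: P_def ext_def)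
  show ?thesis
  proof (intro exI[of _ "ext f"] conjI ballI)
    show "ext f q \<in> E" if "q \<in> Q" for q
      using f[of q] that E by (auto simp: P_def ext_def)
    show "ext f 0 = 0" "ext f 1 = 1" by (auto simp: ext_def)
    fix q q' assume q: "q \<in> Q" "q' \<in> Q"
    consider "q = q'" | "q \<in> {0, 1}" "q' \<in> {0, 1}" | "q \<notin> {0, 1}" "q' \<in> before q" | "q' \<notin> {0, 1}" "q \<in> before q'"
      using q n_inj[of q q'] by (cases "n q" "n q'" rule: linorder_cases) (auto simp: before_def)
    then show "\<bar>ext f q - ext f q'\<bar> \<le> 2 * \<bar>q - q'\<bar>"
    proof cases
      case 2 then show ?thesis by (auto simp: ext_def)
    next
      case 3 then show ?thesis using lip1[of q q'] q by auto
    next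
      case 4 then show ?thesis using lip1[of q' q] q by (auto simp: abs_minus_commute)
    qed simp
  qed
qed

section \<open>Refining chains to traces\<close>

text \<open>At level \<open>n\<close> a pair of points of \<open>G\<close> at distance below \<open>\<delta> n\<close> is linked by a chain
  \<open>P n u v\<close> with exactly \<open>l n\<close> steps, of diameter below \<open>c / 2 ^ n\<close>, whose steps are short enough to be
  refined at level \<open>n + 1\<close>.\<close>
locale chain_refinement =
  fixes m :: "'a metric" and G :: "'a set" and c :: real
    and \<delta> :: "nat \<Rightarrow> real" and l :: "nat \<Rightarrow> nat" and P :: "nat \<Rightarrow> 'a \<Rightarrow> 'a \<Rightarrow> nat \<Rightarrow> 'a"
  assumes c: "c > 0" and G: "G \<subseteq> mspace m"
    and \<delta>: "\<And>n. \<delta> n \<le> c / 2 ^ n"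
    and l: "\<And>n. 2 \<le> l n"
    and P: "\<And>n u v. u \<in> G \<Longrightarrow> v \<in> G \<Longrightarrow> mdist m u v < \<delta> n \<Longrightarrow>
      P n u v 0 = u \<and> P n u v (l n) = v \<and>
      (\<forall>j<l n. mdist m (P n u v j) (P n u v (Suc j)) < \<delta> (Suc n)) \<and>
      (\<forall>j\<le>l n. P n u v j \<in> mspace m \<and> mdist m u (P n u v j) < c / 2 ^ n)"
begin

text \<open>The number of steps after \<open>n\<close> refinements.\<close>
definition L :: "nat \<Rightarrow> nat" where "L n = (\<Prod>i<n. l i)"

lemma L_Suc: "L (Suc n) = L n * l n" by (simp add: L_def)
lemma L_pos: "L n > 0" unfolding L_def using l by (intro prod_pos) (metis gr0I not_numeral_le_zero)
lemma L_ge: "2 ^ n \<le> L n"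
proof (induction n)
  case (Suc n)
  then show ?case using mult_mono[OF Suc l[of n]] by (simp add: L_Suc mult.commute)
qed (simp add: L_def)

text \<open>The chain of level \<open>n\<close> from \<open>x\<close> to \<open>y\<close>, continued beyond its end \<open>L n\<close> by
  chains from \<open>y\<close> to \<open>y\<close>; the index is unrestricted, which spares a distinction at the last
  link.\<close>
fun g :: "'a \<Rightarrow> 'a \<Rightarrow> nat \<Rightarrow> nat \<Rightarrow> 'a" where
  "g x y 0 i = (if i = 0 then x else y)"
| "g x y (Suc n) i = P n (g x y n (i div l n)) (g x y n (Suc (i div l n))) (i mod l n)"

text \<open>The chain of level \<open>n\<close> as a step function on \<open>[0, 1]\<close>.\<close>
definition h :: "'a \<Rightarrow> 'a \<Rightarrow> nat \<Rightarrow> real \<Rightarrow> 'a" where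
  "h x y n t = g x y n (nat \<lfloor>t * L n\<rfloor>)"

definition grid :: "real set" where
  "grid = {t. 0 \<le> t \<and> t \<le> 1 \<and> (\<exists>n i. t * real (L n) = real i)}"

text \<open>At a point of the grid the step functions are eventually constant, and \<open>\<gamma>\<close> is the eventual
  value. Elsewhere they need not converge, since \<open>m\<close> need not be complete.\<close>
definition \<gamma> :: "'a \<Rightarrow> 'a \<Rightarrow> real \<Rightarrow> 'a" where
  "\<gamma> x y t = h x y (LEAST n. \<exists>i. t * real (L n) = real i) t"

context
  fixes x y :: 'a
  assumes near: "\<forall>a\<in>{x, y}. \<forall>z\<in>mspace m. mdist m a z < 2 * c \<longrightarrow> z \<in> G"
    and xy: "x \<in> mspace m" "y \<in> mspace m" "mdist m x y < \<delta> 0"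
begin

text \<open>The chains stay within \<open>c + c/2 + c/4 + \<dots> = 2 * c\<close> of the ends and hence in \<open>G\<close>, where links
  can be refined again.\<close>
lemma g_invariant:
  "(\<forall>i. g x y n i \<in> G \<and> mdist m (g x y n i) (g x y n (Suc i)) < \<delta> n \<and>
      (\<exists>a\<in>{x, y}. mdist m a (g x y n i) \<le> 2 * c - 2 * c / 2 ^ n))"
proof (induction n)
  case 0
  have d: "0 < \<delta> 0" using xy(3) mdist_nonneg[of m x y] by linarith
  have "x \<in> G" "y \<in> G" using near xy c by auto
  then show ?case using xy d by auto
next
  case (Suc n)
  have lpos: "0 < l n" using l[of n] by simp
  show ?case
  proof (intro allI conjI)
    fix i
    define u v j where "u = g x y n (i div l n)" and "v = g x y n (Suc (i div l n))" and "j = i mod l n"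
    have uv: "u \<in> G" "v \<in> G" "mdist m u v < \<delta> n" using Suc by (auto simp: u_def v_def)
    note Puv = P[OF uv]
    have j: "j < l n" using lpos by (simp add: j_def)
    have gi: "g x y (Suc n) i = P n u v j" by (simp add: u_def v_def j_def)
    obtain a where a: "a \<in> {x, y}" "mdist m a u \<le> 2 * c - 2 * c / 2 ^ n" using Suc by (auto simp: u_def)
    have Pj: "P n u v j \<in> mspace m" "mdist m u (P n u v j) < c / 2 ^ n" using Puv j by auto
    have "mdist m a (P n u v j) \<le> mdist m a u + mdist m u (P n u v j)"
      using a(1) xy uv G Pj by (intro mdist_triangle) auto
    also have "\<dots> \<le> 2 * c - 2 * c / 2 ^ n + c / 2 ^ n" using a Pj by linarith
    also have "\<dots> = 2 * c - 2 * c / 2 ^ Suc n" by (simp add: field_simps)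
    finally have le: "mdist m a (g x y (Suc n) i) \<le> 2 * c - 2 * c / 2 ^ Suc n" unfolding gi .
    then show "\<exists>a\<in>{x, y}. mdist m a (g x y (Suc n) i) \<le> 2 * c - 2 * c / 2 ^ Suc n" using a(1) by blast
    have "2 * c / 2 ^ Suc n > 0" using c by simp
    then have "mdist m a (g x y (Suc n) i) < 2 * c" using le by linarith
    then show "g x y (Suc n) i \<in> G" using near a(1) Pj(1) unfolding gi by blast
    have "g x y (Suc n) (Suc i) = P n u v (Suc j)"
    proof (cases "Suc j < l n")
      case True
      then show ?thesis by (simp add: u_def v_def j_def mod_Suc div_Suc)
    next
      case False
      then have eq: "Suc j = l n" using j by simp
      then have "Suc i mod l n = 0" "Suc i div l n = Suc (i div l n)"
        by (auto simp: j_def mod_Suc div_Suc)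
      moreover have "P n v (g x y n (Suc (Suc (i div l n)))) 0 = v"
        using P[of v "g x y n (Suc (Suc (i div l n)))" n] Suc by (auto simp: v_def)
      ultimately have "g x y (Suc n) (Suc i) = v" by (simp add: v_def)
      then show ?thesis using eq Puv by simp
    qed
    then show "mdist m (g x y (Suc n) i) (g x y (Suc n) (Suc i)) < \<delta> (Suc n)"
      using Puv j gi by simp
  qed
qed

lemma g_in: "g x y n i \<in> G" "g x y n i \<in> mspace m" using g_invariant[of n] G by auto

lemma h_in: "h x y n t \<in> mspace m" by (simp add: h_def g_in)

lemma floor_refine:
  assumes "0 \<le> (t::real)" shows "nat \<lfloor>t * L (Suc n)\<rfloor> div l n = nat \<lfloor>t * L n\<rfloor>"
proof -
  have l0: "real (l n) > 0" using l[of n] by simp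
  have "t * real (L (Suc n)) / real_of_int (int (l n)) = t * real (L n)" using l0 by (simp add: L_Suc)
  then have "\<lfloor>t * real (L n)\<rfloor> = \<lfloor>t * real (L (Suc n))\<rfloor> div int (l n)"
    using floor_divide_real_eq_div[of "int (l n)" "t * real (L (Suc n))"] by simp
  then show ?thesis using assms by (simp add: nat_div_distrib)
qed

lemma h_step: assumes "0 \<le> t" shows "mdist m (h x y n t) (h x y (Suc n) t) < c / 2 ^ n"
proof -
  let ?i = "nat \<lfloor>t * L (Suc n)\<rfloor>"
  have "g x y n (?i div l n) = h x y n t" unfolding h_def by (simp only: floor_refine[OF assms])
  moreover have "?i mod l n \<le> l n" using l[of n] by (intro less_imp_le mod_less_divisor) simp
  ultimately show ?thesis
    using P[of "g x y n (?i div l n)" "g x y n (Suc (?i div l n))" n] g_invariant[of n]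
    unfolding h_def[of x y "Suc n"] by (simp only: g.simps) metis
qed

lemma h_chain: assumes "0 \<le> t" "n \<le> p"
  shows "mdist m (h x y n t) (h x y p t) \<le> 2 * c / 2 ^ n - 2 * c / 2 ^ p"
  using assms(2)
proof (induction p rule: dec_induct)
  case base then show ?case using h_in by simp
next
  case (step p)
  have "mdist m (h x y n t) (h x y (Suc p) t) \<le> mdist m (h x y n t) (h x y p t) + mdist m (h x y p t) (h x y (Suc p) t)"
    using h_in by (intro mdist_triangle)
  also have "\<dots> \<le> 2 * c / 2 ^ n - 2 * c / 2 ^ p + c / 2 ^ p" using step.IH h_step[OF assms(1), of p] by linarith
  also have "\<dots> = 2 * c / 2 ^ n - 2 * c / 2 ^ Suc p" by (simp add: field_simps)
  finally show ?case .
qed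

lemma h_stable_step: assumes "t * real (L n) = real i" shows "h x y (Suc n) t = h x y n t"
proof -
  have t: "t * real (L (Suc n)) = real (i * l n)" using assms by (simp add: L_Suc mult.assoc[symmetric])
  have l0: "l n > 0" using l[of n] by simp
  have "h x y (Suc n) t = P n (g x y n i) (g x y n (Suc i)) 0"
    unfolding h_def t floor_of_nat nat_int using l0 by simp
  also have "\<dots> = g x y n i" using P[of "g x y n i" "g x y n (Suc i)" n] g_invariant[of n] by blast
  finally show ?thesis using assms by (simp add: h_def)
qed

lemma h_stable: assumes "t * real (L n) = real i" "n \<le> p" shows "h x y p t = h x y n t"
proof -
  have "h x y p t = h x y n t \<and> (\<exists>j. t * real (L p) = real j)"
    using assms(2)
  proof (induction p rule: dec_induct)
    case base then show ?case using assms by blast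
  next
    case (step p)
    then obtain j where j: "t * real (L p) = real j" by blast
    then have "t * real (L (Suc p)) = real (j * l p)" by (simp add: L_Suc mult.assoc[symmetric])
    then show ?case using h_stable_step[OF j] step by metis
  qed
  then show ?thesis by blast
qed

lemma \<gamma>_eq: assumes "t * real (L n) = real i" shows "\<gamma> x y t = h x y n t"
proof -
  define n0 where "n0 = (LEAST n. \<exists>i. t * real (L n) = real i)"
  have "\<exists>i. t * real (L n0) = real i" unfolding n0_def by (rule LeastI) (use assms in blast)
  then obtain j where j: "t * real (L n0) = real j" by blast
  have "n0 \<le> n" unfolding n0_def by (rule Least_le) (use assms in blast)
  from h_stable[OF j this] show ?thesis by (simp add: \<gamma>_def n0_def)
qed

lemma \<gamma>_ends: "\<gamma> x y 0 = x" "\<gamma> x y 1 = y"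
  using \<gamma>_eq[of 0 0 0] \<gamma>_eq[of 1 0 1] by (simp_all add: h_def L_def)

lemma \<gamma>_in: "\<gamma> x y t \<in> mspace m" by (simp add: \<gamma>_def h_in)

lemma \<gamma>_near_h: assumes "t \<in> grid" shows "mdist m (\<gamma> x y t) (h x y p t) \<le> 2 * c / 2 ^ p"
proof -
  obtain n i where n: "t * real (L n) = real i" and t0: "0 \<le> t" using assms by (auto simp: grid_def)
  show ?thesis
  proof (cases "n \<le> p")
    case True
    then have "h x y p t = \<gamma> x y t" using h_stable[OF n True] \<gamma>_eq[OF n] by simp
    then show ?thesis using \<gamma>_in c by simp
  next
    case False
    then have "mdist m (h x y p t) (\<gamma> x y t) \<le> 2 * c / 2 ^ p - 2 * c / 2 ^ n"
      using h_chain[OF t0, of p n] \<gamma>_eq[OF n] by simp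
    moreover have "2 * c / 2 ^ n > 0" using c by simp
    ultimately show ?thesis by (simp add: mdist_commute)
  qed
qed

text \<open>Points within \<open>1 / L p\<close> of each other lie in the same or in adjacent steps of level \<open>p\<close>.\<close>
lemma \<gamma>_modulus:
  assumes t: "t \<in> grid" "t' \<in> grid" and tt: "\<bar>t - t'\<bar> * real (L p) \<le> 1"
  shows "mdist m (\<gamma> x y t) (\<gamma> x y t') \<le> 5 * c / 2 ^ p"
proof -
  have t0: "0 \<le> t" "0 \<le> t'" using t by (auto simp: grid_def)
  have d: "\<delta> p \<le> c / 2 ^ p" by (rule \<delta>)
  have step: "mdist m (h x y p t) (h x y p t') \<le> c / 2 ^ p" if "t \<le> t'" "0 \<le> t" "\<bar>t - t'\<bar> * real (L p) \<le> 1" for t t'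
  proof -
    have "t * real (L p) \<le> t' * real (L p)" "t' * real (L p) \<le> t * real (L p) + 1"
      using that L_pos[of p] by (auto simp: algebra_simps intro: mult_left_mono)
    then have "\<lfloor>t * real (L p)\<rfloor> \<le> \<lfloor>t' * real (L p)\<rfloor>" "\<lfloor>t' * real (L p)\<rfloor> \<le> \<lfloor>t * real (L p)\<rfloor> + 1" "0 \<le> \<lfloor>t * real (L p)\<rfloor>"
      using that by (auto intro: floor_mono) linarith
    then have "nat \<lfloor>t' * real (L p)\<rfloor> = nat \<lfloor>t * real (L p)\<rfloor> \<or> nat \<lfloor>t' * real (L p)\<rfloor> = Suc (nat \<lfloor>t * real (L p)\<rfloor>)"
      by linarith
    then show ?thesis
    proof
      assume "nat \<lfloor>t' * real (L p)\<rfloor> = nat \<lfloor>t * real (L p)\<rfloor>"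
      then show ?thesis using c g_in by (simp add: h_def)
    next
      assume "nat \<lfloor>t' * real (L p)\<rfloor> = Suc (nat \<lfloor>t * real (L p)\<rfloor>)"
      then have "mdist m (h x y p t) (h x y p t') < \<delta> p" using g_invariant[of p] by (simp add: h_def)
      then show ?thesis using d by linarith
    qed
  qed
  have "mdist m (h x y p t) (h x y p t') \<le> c / 2 ^ p"
  proof (cases "t \<le> t'")
    case True then show ?thesis using step t0 tt by blast
  next
    case False then show ?thesis using step[of t' t] t0 tt by (simp add: mdist_commute abs_minus_commute)
  qed
  moreover have "mdist m (\<gamma> x y t) (\<gamma> x y t') \<le> mdist m (\<gamma> x y t) (h x y p t) + mdist m (h x y p t) (\<gamma> x y t')"
    "mdist m (h x y p t) (\<gamma> x y t') \<le> mdist m (h x y p t) (h x y p t') + mdist m (h x y p t') (\<gamma> x y t')"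
    using \<gamma>_in h_in by (auto intro: mdist_triangle)
  moreover note \<gamma>_near_h[OF t(1), of p] \<gamma>_near_h[OF t(2), of p]
  ultimately have "mdist m (\<gamma> x y t) (\<gamma> x y t') \<le> 2 * c / 2 ^ p + c / 2 ^ p + 2 * c / 2 ^ p"
    by (simp add: mdist_commute[of m "h x y p t'"])
  also have "\<dots> = 5 * c / 2 ^ p" by (simp add: field_simps)
  finally show ?thesis .
qed

end

lemma grid_basic: "grid \<subseteq> {0..1}" "0 \<in> grid" "1 \<in> grid"
proof -
  have "1 * real (L 0) = real 1" by (simp add: L_def)
  then have "\<exists>n i. 1 * real (L n) = real i" by blast
  then show "1 \<in> grid" by (simp add: grid_def)
  have "0 * real (L 0) = real 0" by simp
  then have "\<exists>n i. 0 * real (L n) = real i" by blast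
  then show "0 \<in> grid" by (simp add: grid_def)
qed (auto simp: grid_def)

lemma grid_dense: assumes "0 \<le> a" "a < b" "b \<le> 1" shows "\<exists>e\<in>grid. a < e \<and> e < b"
proof -
  obtain n where n: "(1/2) ^ n < b - a" using real_arch_pow_inv[of "b - a" "1/2"] assms by auto
  have "(2::real) ^ n \<le> real (L n)" using L_ge[of n] by (metis of_nat_le_iff of_nat_numeral of_nat_power)
  then have "1 / real (L n) \<le> 1 / 2 ^ n" by (intro frac_le) auto
  then have Ln: "1 / real (L n) < b - a" using n by (simp add: power_one_over)
  have L0: "real (L n) > 0" using L_pos by simp
  define i where "i = nat (\<lfloor>a * L n\<rfloor> + 1)"
  have i: "real i = \<lfloor>a * L n\<rfloor> + 1" using assms by (simp add: i_def)
  define e where "e = real i / L n"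
  have "a * L n < real i" "real i \<le> a * L n + 1" using i by linarith+
  then have "a < e" "e \<le> a + 1 / real (L n)" using L0 by (simp_all add: e_def field_simps)
  moreover have "e * real (L n) = real i" using L0 by (simp add: e_def)
  ultimately have "e \<in> grid" "a < e" "e < b" using Ln assms by (auto simp: grid_def)
  then show ?thesis by blast
qed

text \<open>The first bound controls the whole trace. It serves the coarse scales, at which the second bound would
  restrict \<open>q\<close> and \<open>q'\<close> to a fraction of \<open>a\<close>.\<close>
lemma trace_on_countable:
  assumes near: "\<forall>a\<in>{x, y}. \<forall>z\<in>mspace m. mdist m a z < 2 * c \<longrightarrow> z \<in> G"
    and xy: "x \<in> mspace m" "y \<in> mspace m" "mdist m x y < \<delta> 0"
    and a: "(a::real) > 0" and Q: "countable Q" "Q \<subseteq> {0..a}"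
  shows "\<exists>f. f 0 = x \<and> f a = y \<and> (\<forall>q. f q \<in> mspace m) \<and>
    (\<forall>q\<in>Q. \<forall>q'\<in>Q. mdist m (f q) (f q') \<le> 5 * c) \<and>
    (\<forall>p. \<forall>q\<in>Q. \<forall>q'\<in>Q. 2 * \<bar>q - q'\<bar> * real (L p) \<le> a \<longrightarrow> mdist m (f q) (f q') \<le> 5 * c / 2 ^ p)"
proof -
  let ?Q = "(\<lambda>q. q / a) ` Q"
  have cQ: "countable ?Q" "?Q \<subseteq> {0..1}" using Q a by (auto simp: field_simps)
  have "\<exists>\<phi>. (\<forall>q\<in>?Q. \<phi> q \<in> grid) \<and> \<phi> 0 = 0 \<and> \<phi> 1 = 1 \<and>
      (\<forall>q\<in>?Q. \<forall>q'\<in>?Q. \<bar>\<phi> q - \<phi> q'\<bar> \<le> 2 * \<bar>q - q'\<bar>)"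
    by (rule lipschitz_into_dense[OF cQ grid_basic]) (rule grid_dense)
  then obtain \<phi> where \<phi>: "\<forall>q\<in>?Q. \<phi> q \<in> grid" "\<phi> 0 = 0" "\<phi> 1 = 1"
    "\<forall>q\<in>?Q. \<forall>q'\<in>?Q. \<bar>\<phi> q - \<phi> q'\<bar> \<le> 2 * \<bar>q - q'\<bar>"
    by (elim exE conjE)
  define f where "f q = \<gamma> x y (\<phi> (q / a))" for q
  note ctx = near xy
  have grid: "\<phi> (q / a) \<in> grid" if "q \<in> Q" for q using \<phi>(1) that by auto
  have "mdist m (f q) (f q') \<le> 5 * c" if "q \<in> Q" "q' \<in> Q" for q q'
  proof -
    have "\<bar>\<phi> (q / a) - \<phi> (q' / a)\<bar> * real (L 0) \<le> 1"
      using grid[OF that(1)] grid[OF that(2)] by (auto simp: L_def grid_def)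
    then show ?thesis
      using \<gamma>_modulus[OF ctx grid[OF that(1)] grid[OF that(2)], where p = 0] by (simp add: f_def)
  qed
  moreover have "mdist m (f q) (f q') \<le> 5 * c / 2 ^ p" if q: "q \<in> Q" "q' \<in> Q" "2 * \<bar>q - q'\<bar> * L p \<le> a" for p q q'
  proof -
    have "\<bar>\<phi> (q / a) - \<phi> (q' / a)\<bar> \<le> 2 * \<bar>q / a - q' / a\<bar>" using \<phi>(4) q by auto
    also have "\<dots> = 2 * \<bar>q - q'\<bar> / a" using a by (simp add: diff_divide_distrib[symmetric])
    finally have "\<bar>\<phi> (q / a) - \<phi> (q' / a)\<bar> * real (L p) \<le> 2 * \<bar>q - q'\<bar> / a * real (L p)"
      by (rule mult_right_mono) simp
    also have "\<dots> \<le> 1" using q(3) a by (simp add: field_simps)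
    finally show ?thesis
      unfolding f_def by (rule \<gamma>_modulus[OF ctx grid[OF q(1)] grid[OF q(2)]])
  qed
  moreover have "f 0 = x" "f a = y" "\<And>q. f q \<in> mspace m"
    using \<gamma>_ends[OF ctx] \<gamma>_in[OF ctx] \<phi> a by (simp_all add: f_def)
  ultimately show ?thesis by (intro exI[of _ f]) auto
qed

end

lemma exact_chain:
  assumes "chain_linking m \<eta> k c x y" "chain_diam m k c < e" "k \<le> l" "\<eta> > 0"
  shows "\<exists>p. p 0 = x \<and> p l = y \<and> (\<forall>j<l. mdist m (p j) (p (Suc j)) < \<eta>) \<and>
    (\<forall>j\<le>l. p j \<in> mspace m \<and> mdist m x (p j) < e)"
proof (intro exI[of _ "\<lambda>j. c (min j k)"] conjI allI impI)
  note c = assms(1)[unfolded chain_linking_def]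
  show "c (min 0 k) = x" using c by simp
  show "c (min l k) = y" using c assms(3) by (simp add: min_absorb2)
  fix j
  show cm: "c (min j k) \<in> mspace m" using c by simp
  show "mdist m x (c (min j k)) < e"
    using assms(2) c unfolding chain_diam_less_iff by (metis le0 min.cobounded2)
  show "mdist m (c (min j k)) (c (min (Suc j) k)) < \<eta>"
  proof (cases "j < k")
    case True
    have "\<forall>i\<in>{1..k}. mdist m (c i) (c (i - 1)) < \<eta>" using c by (elim conjE)
    from bspec[OF this, of "Suc j"] True show ?thesis by (simp add: mdist_commute)
  next
    case False
    then have "min j k = k" "min (Suc j) k = k" by auto
    then show ?thesis using cm assms(4) by simp
  qed
qed

lemma exists_chain_refinement:
  assumes G: "G \<subseteq> mspace m" and eq: "uniformly_locally_chain_equiconnected_at m G" and c: "c > 0"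
  obtains \<delta> l P where "chain_refinement m G c \<delta> l P" "\<And>n. \<delta> n > 0"
proof -
  let ?L = "chain_linked m"
  note eq' = eq[unfolded equiconnected_iff_chain_linked]
  have "\<exists>\<delta>>0. \<forall>\<eta>>0. \<exists>l. \<forall>x\<in>G. \<forall>y\<in>G. mdist m x y < \<delta> \<longrightarrow> ?L (c / 2 ^ n) \<eta> l x y" for n :: nat
    using eq' c by simp
  then obtain \<delta>' where \<delta>': "\<And>n. \<delta>' n > 0"
    "\<And>n \<eta>. \<eta> > 0 \<Longrightarrow> \<exists>l. \<forall>x\<in>G. \<forall>y\<in>G. mdist m x y < \<delta>' n \<longrightarrow> ?L (c / 2 ^ n) \<eta> l x y"
    by metis
  define \<delta> where "\<delta> n = min (\<delta>' n) (c / 2 ^ n)" for n :: nat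
  have \<delta>: "\<delta> n > 0" "\<delta> n \<le> c / 2 ^ n" "\<delta> n \<le> \<delta>' n" for n
    using \<delta>'(1)[of n] c by (auto simp: \<delta>_def)
  have "\<forall>n. \<exists>l. \<forall>x\<in>G. \<forall>y\<in>G. mdist m x y < \<delta>' n \<longrightarrow> ?L (c / 2 ^ n) (\<delta> (Suc n)) l x y"
    using \<delta>'(2) \<delta>(1) by blast
  then obtain l' where l': "\<And>n x y. x \<in> G \<Longrightarrow> y \<in> G \<Longrightarrow> mdist m x y < \<delta>' n \<Longrightarrow> ?L (c / 2 ^ n) (\<delta> (Suc n)) (l' n) x y"
    by metis
  define l where "l n = max 2 (l' n)" for n
  define ok where "ok n u v p \<longleftrightarrow> p 0 = u \<and> p (l n) = v \<and> (\<forall>j<l n. mdist m (p j) (p (Suc j)) < \<delta> (Suc n)) \<and>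
      (\<forall>j\<le>l n. p j \<in> mspace m \<and> mdist m u (p j) < c / 2 ^ n)" for n u v p
  have "\<exists>p. u \<in> G \<longrightarrow> v \<in> G \<longrightarrow> mdist m u v < \<delta> n \<longrightarrow> ok n u v p" for n u v
  proof (cases "u \<in> G \<and> v \<in> G \<and> mdist m u v < \<delta> n")
    case True
    then have "?L (c / 2 ^ n) (\<delta> (Suc n)) (l' n) u v" using l' \<delta>(3)[of n] by (metis less_le_trans)
    then obtain k cc where k: "k \<le> l' n" "chain_linking m (\<delta> (Suc n)) k cc u v" "chain_diam m k cc < c / 2 ^ n"
      unfolding chain_linked_def by (elim exE conjE)
    have "k \<le> l n" using k(1) by (simp add: l_def)
    from exact_chain[OF k(2,3) this \<delta>(1)] show ?thesis unfolding ok_def by blast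
  qed blast
  then have "\<forall>n u v. \<exists>p. u \<in> G \<longrightarrow> v \<in> G \<longrightarrow> mdist m u v < \<delta> n \<longrightarrow> ok n u v p" by (intro allI)
  then obtain P where P: "\<forall>n u v. u \<in> G \<longrightarrow> v \<in> G \<longrightarrow> mdist m u v < \<delta> n \<longrightarrow> ok n u v (P n u v)"
    unfolding choice_iff by (elim exE)
  have "chain_refinement m G c \<delta> l P"
    by (rule chain_refinement.intro) (use c G \<delta> P[unfolded ok_def] in \<open>simp_all add: l_def\<close>)
  then show thesis using \<delta>(1) by (rule that)
qed

lemma chain_refinement_shift:
  assumes "chain_refinement m G c \<delta> l P"
  shows "chain_refinement m G (c / 2 ^ k) (\<lambda>n. \<delta> (n + k)) (\<lambda>n. l (n + k)) (\<lambda>n. P (n + k))"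
proof -
  interpret chain_refinement m G c \<delta> l P by fact
  have e: "c / (2 ^ k * 2 ^ n) = c / 2 ^ (n + k)" for n by (simp add: power_add mult.commute)
  show ?thesis
    by (rule chain_refinement.intro) (use c G \<delta> l P in \<open>simp_all add: e\<close>)
qed

text \<open>A trace is parametrised by the distance \<open>a\<close> of its ends, so for a common modulus the refinement must
  start at a level \<open>k\<close> that fits \<open>a\<close>, namely \<open>\<delta> (k + 1) \<le> a < \<delta> k\<close>. For levels \<open>p > k\<close> the
  factor \<open>1 / a \<le> 1 / \<delta> (k + 1)\<close> from rescaling is then bounded, and for \<open>p \<le> k\<close> the entire trace is
  small enough.\<close>
theorem chain_equiconnected_imp_trace_equiconnected:
  assumes F: "F \<subseteq> mspace m" and G: "G \<subseteq> mspace m" and r: "r > 0"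
    and FG: "\<And>a z. a \<in> F \<Longrightarrow> z \<in> mspace m \<Longrightarrow> mdist m a z < r \<Longrightarrow> z \<in> G"
    and eq: "uniformly_locally_chain_equiconnected_at m G"
  shows "uniformly_locally_trace_equiconnected_at m F"
proof -
  define c where "c = r / 2"
  have c: "c > 0" "2 * c = r" using r by (simp_all add: c_def)
  obtain \<delta> l P where ref: "chain_refinement m G c \<delta> l P" and \<delta>0: "\<And>n. \<delta> n > 0"
    using exists_chain_refinement[OF G eq c(1)] by metis
  interpret R: chain_refinement m G c \<delta> l P by fact
  \<comment> \<open>A scale at which traces of all lengths oscillate by at most \<open>5 * c / 2 ^ p\<close>.\<close>
  define \<tau> where "\<tau> p = Min (insert 1 ((\<lambda>k. \<delta> (Suc k) / (2 * real (R.L p))) ` {..<p}))" for p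
  have \<tau>_pos: "\<tau> p > 0" for p using \<delta>0 R.L_pos by (simp add: \<tau>_def)
  have \<tau>_le: "\<tau> p \<le> \<delta> (Suc k) / (2 * real (R.L p))" if "k < p" for k p
    unfolding \<tau>_def using that by (intro Min_le) auto
  have trace: "\<exists>f. f 0 = x \<and> f (mdist m x y) = y \<and> (\<forall>q. f q \<in> mspace m) \<and>
      (\<forall>q\<in>Q. \<forall>q'\<in>Q. \<forall>p. p = 0 \<or> \<bar>q - q'\<bar> \<le> \<tau> p \<longrightarrow> mdist m (f q) (f q') \<le> 5 * c / 2 ^ p)"
    if xy: "x \<in> F" "y \<in> F" "mdist m x y < \<delta> 0" and Q: "countable Q" "Q \<subseteq> {0..mdist m x y}" for x y Q
  proof (cases "x = y")
    case True
    then show ?thesis using xy F c by (intro exI[of _ "\<lambda>_. x"]) auto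
  next
    case False
    define a where "a = mdist m x y"
    have ms: "x \<in> mspace m" "y \<in> mspace m" using xy F by auto
    have a: "a > 0" "a < \<delta> 0" using False ms xy mdist_zero[OF ms] mdist_nonneg[of m x y] unfolding a_def by linarith+
    have "\<exists>k. \<delta> (Suc k) \<le> a"
    proof -
      obtain n where n: "(1/2) ^ n < a / c" using real_arch_pow_inv[of "a / c" "1/2"] a c by auto
      have "\<delta> (Suc n) \<le> c / 2 ^ Suc n" by (rule R.\<delta>)
      also have "\<dots> \<le> c / 2 ^ n" using c by (intro divide_left_mono) auto
      also have "\<dots> = c * (1/2) ^ n" by (simp add: power_one_over)
      also have "\<dots> < a" using n c by (simp add: field_simps)
      finally show ?thesis by (intro exI[of _ n]) simp
    qed
    define k where "k = (LEAST k. \<delta> (Suc k) \<le> a)"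
    have k1: "\<delta> (Suc k) \<le> a" unfolding k_def by (rule LeastI_ex) fact
    have k2: "a < \<delta> k"
    proof (cases k)
      case (Suc j)
      then have "j < k" by simp
      then have "\<not> \<delta> (Suc j) \<le> a" unfolding k_def by (rule not_less_Least)
      then show ?thesis using Suc by simp
    qed (use a in simp)
    interpret S: chain_refinement m G "c / 2 ^ k" "\<lambda>n. \<delta> (n + k)" "\<lambda>n. l (n + k)" "\<lambda>n. P (n + k)"
      by (rule chain_refinement_shift[OF ref])
    have near: "\<forall>b\<in>{x, y}. \<forall>z\<in>mspace m. mdist m b z < 2 * (c / 2 ^ k) \<longrightarrow> z \<in> G"
    proof (intro ballI impI)
      fix b z assume b: "b \<in> {x, y}" and z: "z \<in> mspace m" "mdist m b z < 2 * (c / 2 ^ k)"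
      have "2 * c / 2 ^ k \<le> 2 * c / 1" using c(1) by (intro divide_left_mono) auto
      then have "2 * (c / 2 ^ k) \<le> r" using c(2) by simp
      then show "z \<in> G" using FG[of b z] b xy z by auto
    qed
    have S_le: "S.L p \<le> R.L (p + k)" for p
    proof (induction p)
      case 0 then show ?case using R.L_pos[of k] by (simp add: S.L_def)
    next
      case (Suc p) then show ?case by (simp add: S.L_Suc R.L_Suc)
    qed
    have "mdist m x y < \<delta> (0 + k)" "Q \<subseteq> {0..a}" using k2 Q by (simp_all add: a_def)
    from S.trace_on_countable[OF near ms this(1) a(1) Q(1) this(2)]
    obtain f where f: "f 0 = x" "f a = y" "\<forall>q. f q \<in> mspace m"
      and f1: "\<forall>q\<in>Q. \<forall>q'\<in>Q. mdist m (f q) (f q') \<le> 5 * (c / 2 ^ k)"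
      and f2: "\<forall>p. \<forall>q\<in>Q. \<forall>q'\<in>Q. 2 * \<bar>q - q'\<bar> * S.L p \<le> a \<longrightarrow> mdist m (f q) (f q') \<le> 5 * (c / 2 ^ k) / 2 ^ p"
      by (elim exE conjE)
    have "mdist m (f q) (f q') \<le> 5 * c / 2 ^ p" if q: "q \<in> Q" "q' \<in> Q" "p = 0 \<or> \<bar>q - q'\<bar> \<le> \<tau> p" for p q q'
    proof (cases "p \<le> k")
      case True
      have "5 * (c / 2 ^ k) \<le> 5 * c / 2 ^ p" using True c by (simp add: divide_left_mono power_increasing)
      then show ?thesis using bspec[OF bspec[OF f1 q(1)] q(2)] by linarith
    next
      case False
      then have kp: "k < p" by simp
      have "2 * \<bar>q - q'\<bar> * S.L (p - k) \<le> 2 * \<tau> p * real (R.L p)"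
        using q(3) kp S_le[of "p - k"] \<tau>_pos[of p] by (intro mult_mono) auto
      also have "\<dots> \<le> 2 * (\<delta> (Suc k) / (2 * real (R.L p))) * real (R.L p)"
        using \<tau>_le[OF kp] by (intro mult_right_mono) auto
      also have "\<dots> = \<delta> (Suc k)" using R.L_pos[of p] by simp
      finally have "mdist m (f q) (f q') \<le> 5 * (c / 2 ^ k) / 2 ^ (p - k)"
        using f2[THEN spec, THEN bspec, OF q(1), THEN bspec, OF q(2), THEN mp] k1 by (meson order_trans)
      also have "\<dots> = 5 * c / 2 ^ p" using kp by (simp add: power_add[symmetric])
      finally show ?thesis .
    qed
    then show ?thesis using f unfolding a_def by blast
  qed
  \<comment> \<open>The modulus is the best of these bounds available at \<open>t\<close>; adding \<open>t\<close> makes it positive.\<close>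
  define V where "V t = {5 * c / 2 ^ p | p. p = 0 \<or> t \<le> \<tau> p}" for t
  define \<omega> where "\<omega> t = t + Inf (V t)" for t
  have V: "V t \<noteq> {}" "bdd_below (V t)" for t
    using c by (auto simp: V_def intro!: bdd_belowI[of _ 0])
  have Inf_V: "0 \<le> Inf (V t)" for t
    using c V by (intro cInf_greatest) (auto simp: V_def)
  have "continuity_modulus \<omega>"
    unfolding continuity_modulus_def
  proof (intro conjI allI impI)
    show "\<omega> t > 0" if "t > 0" for t using that Inf_V[of t] by (simp add: \<omega>_def)
    show "mono_on {0<..} \<omega>"
    proof (rule mono_onI)
      fix t u :: real assume "t \<le> u"
      then have "V u \<subseteq> V t" unfolding V_def by force
      then have "Inf (V t) \<le> Inf (V u)" using V by (intro cInf_superset_mono)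
      then show "\<omega> t \<le> \<omega> u" using \<open>t \<le> u\<close> by (simp add: \<omega>_def)
    qed
    show "(\<omega> \<longlongrightarrow> 0) (at_right 0)"
    proof (rule tendstoI)
      fix e :: real assume e: "e > 0"
      obtain p where p: "(1/2) ^ p < e / (10 * c)" using real_arch_pow_inv[of "e / (10 * c)" "1/2"] e c by auto
      have "5 * c / 2 ^ p = 5 * c * (1/2) ^ p" by (simp add: power_one_over)
      then have p2: "5 * c / 2 ^ p < e / 2" using p c by (simp add: field_simps)
      have "dist (\<omega> t) 0 < e" if t: "0 < t" "t < min (\<tau> p) (e / 2)" for t
      proof -
        have "5 * c / 2 ^ p \<in> V t" using t by (auto simp: V_def)
        then have "Inf (V t) \<le> 5 * c / 2 ^ p" using V by (intro cInf_lower)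
        then show ?thesis using t p2 Inf_V[of t] by (simp add: \<omega>_def)
      qed
      moreover have "min (\<tau> p) (e / 2) > 0" using \<tau>_pos e by simp
      ultimately show "eventually (\<lambda>t. dist (\<omega> t) 0 < e) (at_right 0)"
        unfolding eventually_at_right_field by blast
    qed
  qed
  moreover have "\<exists>f. uniformly_continuous_map (submetric euclidean_metric Q) m f \<and>
      f 0 = x \<and> f (mdist m x y) = y \<and>
      (\<forall>t>0. modulus_of (submetric euclidean_metric Q) m f t \<le> ennreal (\<omega> t))"
    if xy: "x \<in> F" "y \<in> F" "mdist m x y < \<delta> 0"
      and Q: "countable Q \<and> {0, mdist m x y} \<subseteq> Q \<and> Q \<subseteq> {0..mdist m x y} \<and> {0..mdist m x y} \<subseteq> closure Q"
    for x y and Q :: "real set"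
  proof -
    obtain f where f: "f 0 = x" "f (mdist m x y) = y" "\<forall>q. f q \<in> mspace m"
      and f1: "\<And>p q q'. q \<in> Q \<Longrightarrow> q' \<in> Q \<Longrightarrow> p = 0 \<or> \<bar>q - q'\<bar> \<le> \<tau> p \<Longrightarrow> mdist m (f q) (f q') \<le> 5 * c / 2 ^ p"
      using trace[OF xy, of Q] Q by metis
    have mod: "mdist m (f q) (f q') \<le> \<omega> t" if q: "q \<in> Q" "q' \<in> Q" "\<bar>q - q'\<bar> \<le> t" "t > 0" for q q' t
    proof -
      have "mdist m (f q) (f q') \<le> Inf (V t)"
      proof (rule cInf_greatest[OF V(1)])
        fix v assume "v \<in> V t"
        then obtain p where "v = 5 * c / 2 ^ p" "p = 0 \<or> t \<le> \<tau> p" by (auto simp: V_def)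
        then show "mdist m (f q) (f q') \<le> v" using f1[OF q(1,2), of p] q(3) by auto
      qed
      then show ?thesis using q(4) by (simp add: \<omega>_def)
    qed
    have "uniformly_continuous_map (submetric euclidean_metric Q) m f"
      unfolding uniformly_continuous_map_def
    proof (intro conjI allI impI)
      fix e :: real assume e: "e > 0"
      obtain p where p: "(1/2) ^ p < e / (5 * c)" using real_arch_pow_inv[of "e / (5 * c)" "1/2"] e c by auto
      have "5 * c / 2 ^ p = 5 * c * (1/2) ^ p" by (simp add: power_one_over)
      then have p2: "5 * c / 2 ^ p < e" using p c by (simp add: field_simps)
      have "mdist m (f q') (f q) < e" if "q \<in> Q" "q' \<in> Q" "dist q' q < \<tau> p" for q q'
      proof -
        have "mdist m (f q') (f q) \<le> 5 * c / 2 ^ p" using that by (intro f1) (auto simp: dist_real_def)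
        then show ?thesis using p2 by simp
      qed
      then show "\<exists>d>0. \<forall>x\<in>mspace (submetric euclidean_metric Q). \<forall>y\<in>mspace (submetric euclidean_metric Q).
          mdist (submetric euclidean_metric Q) y x < d \<longrightarrow> mdist m (f y) (f x) < e"
        using \<tau>_pos[of p] by (intro exI[of _ "\<tau> p"]) auto
    qed (use f in auto)
    moreover have "modulus_of (submetric euclidean_metric Q) m f t \<le> ennreal (\<omega> t)" if "t > 0" for t
      unfolding modulus_of_def
    proof (rule SUP_least)
      fix z assume "z \<in> {(x, x'). x \<in> mspace (submetric euclidean_metric Q) \<and> x' \<in> mspace (submetric euclidean_metric Q) \<and>
          mdist (submetric euclidean_metric Q) x x' \<le> t}"
      then obtain q q' where z: "z = (q, q')" "q \<in> Q" "q' \<in> Q" "\<bar>q - q'\<bar> \<le> t" by (auto simp: dist_real_def)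
      then show "(case z of (x, x') \<Rightarrow> ennreal (mdist m (f x) (f x'))) \<le> ennreal (\<omega> t)"
        using mod[OF z(2-4) \<open>t > 0\<close>] by (simp add: ennreal_leI)
    qed
    ultimately show ?thesis using f by blast
  qed
  ultimately show ?thesis
    unfolding uniformly_locally_trace_equiconnected_at_def
    using \<delta>0[of 0] by (intro exI[of _ "\<delta> 0"] conjI exI[of _ \<omega>]) simp_all
qed


section \<open>Locally finite choices in a metric space\<close>

text \<open>Every point can be assigned a covering ball such that only finitely many balls are used near each
  point. The construction is that of Stone's theorem on the paracompactness of metric spaces. Well-order the
  balls and let \<open>a y\<close> be the first one that contains \<open>y\<close>. Let \<open>E n \<alpha>\<close> be the set of points
  with first ball \<open>\<alpha>\<close> that lie at depth at least \<open>3 / 2 ^ n\<close> in it. For fixed \<open>n\<close> these sets are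
  \<open>3 / 2 ^ n\<close> apart. A point \<open>w\<close> takes the least \<open>n\<close> such that some \<open>E n \<alpha>\<close> comes within
  \<open>1 / 2 ^ n\<close> of \<open>w\<close>, and the ball \<open>\<alpha>\<close>. Near a given point only finitely many \<open>n\<close>
  occur, and each contributes at most one ball.\<close>
lemma locally_finite_choice:
  fixes Y :: "'b metric" and r :: "'b \<Rightarrow> real"
  assumes r: "\<And>y. y \<in> mspace Y \<Longrightarrow> r y > 0"
  shows "\<exists>c. (\<forall>y\<in>mspace Y. c y \<in> mspace Y \<and> mdist Y (c y) y < r (c y)) \<and>
    (\<forall>y0\<in>mspace Y. \<exists>\<rho>>0. finite (c ` {y \<in> mspace Y. mdist Y y0 y < \<rho>}))"
proof -
  obtain R :: "'b rel" where R: "well_order_on UNIV R" using well_order_on by blast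
  define W where "W = R - Id"
  have wf: "wf W" using R by (simp add: W_def well_order_on_def)
  have tot: "(\<alpha>, \<beta>) \<in> W \<or> (\<beta>, \<alpha>) \<in> W" if "\<alpha> \<noteq> \<beta>" for \<alpha> \<beta>
    using R that unfolding W_def well_order_on_def linear_order_on_def total_on_def by blast
  define cov where "cov y = {\<alpha> \<in> mspace Y. mdist Y \<alpha> y < r \<alpha>}" for y
  have "\<exists>\<alpha>\<in>cov y. \<forall>\<beta>. (\<beta>, \<alpha>) \<in> W \<longrightarrow> \<beta> \<notin> cov y" if y: "y \<in> mspace Y" for y
  proof -
    have "y \<in> cov y" using y r by (simp add: cov_def)
    then show ?thesis using wf unfolding wf_eq_minimal by blast
  qed
  then obtain a where a: "\<And>y. y \<in> mspace Y \<Longrightarrow> a y \<in> cov y"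
    "\<And>y \<beta>. y \<in> mspace Y \<Longrightarrow> (\<beta>, a y) \<in> W \<Longrightarrow> \<beta> \<notin> cov y" by metis
  define E where "E n \<alpha> = {y \<in> mspace Y. a y = \<alpha> \<and> 3 / 2 ^ n \<le> r \<alpha> - mdist Y \<alpha> y}" for n :: nat and \<alpha>
  have sep1: "3 / 2 ^ n \<le> mdist Y y z" if "y \<in> E n \<alpha>" "z \<in> E n \<beta>" "(\<alpha>, \<beta>) \<in> W" for n y z \<alpha> \<beta>
  proof -
    have yz: "y \<in> mspace Y" "z \<in> mspace Y" "a y = \<alpha>" "a z = \<beta>" "3 / 2 ^ n \<le> r \<alpha> - mdist Y \<alpha> y"
      using that by (auto simp: E_def)
    have \<alpha>: "\<alpha> \<in> mspace Y" using a(1)[OF yz(1)] yz by (auto simp: cov_def)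
    have "\<alpha> \<notin> cov z" using a(2)[OF yz(2), of \<alpha>] that(3) yz(4) by simp
    then have "r \<alpha> \<le> mdist Y \<alpha> z" using \<alpha> by (simp add: cov_def)
    also have "\<dots> \<le> mdist Y \<alpha> y + mdist Y y z" using yz \<alpha> by (intro mdist_triangle)
    finally show ?thesis using yz(5) by linarith
  qed
  have sep: "\<alpha> = \<beta>" if "y \<in> E n \<alpha>" "z \<in> E n \<beta>" "mdist Y y z < 3 / 2 ^ n" for n y z \<alpha> \<beta>
    using sep1[OF that(1,2)] sep1[OF that(2,1)] tot[of \<alpha> \<beta>] that(3) by (auto simp: mdist_commute)
  define V where "V n \<alpha> w \<longleftrightarrow> (\<exists>y\<in>E n \<alpha>. mdist Y y w < 1 / 2 ^ n)" for n \<alpha> w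
  have ex: "\<exists>n \<alpha>. V n \<alpha> w" if w: "w \<in> mspace Y" for w
  proof -
    have "r (a w) - mdist Y (a w) w > 0" using a(1)[OF w] by (auto simp: cov_def)
    then obtain n where "(1/2) ^ n < (r (a w) - mdist Y (a w) w) / 3"
      using real_arch_pow_inv[of "(r (a w) - mdist Y (a w) w) / 3" "1/2"] by auto
    then have "3 / 2 ^ n \<le> r (a w) - mdist Y (a w) w" by (simp add: power_one_over)
    then have "w \<in> E n (a w)" using w by (simp add: E_def)
    moreover have "mdist Y w w < 1 / 2 ^ n" using w by simp
    ultimately show ?thesis unfolding V_def by blast
  qed
  define N where "N w = (LEAST n. \<exists>\<alpha>. V n \<alpha> w)" for w
  define c where "c w = (SOME \<alpha>. V (N w) \<alpha> w)" for w
  have Vc: "V (N w) (c w) w" if w: "w \<in> mspace Y" for w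
  proof -
    have "\<exists>\<alpha>. V (N w) \<alpha> w" unfolding N_def by (rule LeastI_ex[OF ex[OF w]])
    then show ?thesis unfolding c_def by (rule someI_ex)
  qed
  have "c w \<in> mspace Y \<and> mdist Y (c w) w < r (c w)" if w: "w \<in> mspace Y" for w
  proof -
    obtain y where y: "y \<in> E (N w) (c w)" "mdist Y y w < 1 / 2 ^ N w" using Vc[OF w] by (auto simp: V_def)
    then have ym: "y \<in> mspace Y" "a y = c w" "3 / 2 ^ N w \<le> r (c w) - mdist Y (c w) y" by (auto simp: E_def)
    have cm: "c w \<in> mspace Y" using a(1)[OF ym(1)] ym by (auto simp: cov_def)
    have "mdist Y (c w) w \<le> mdist Y (c w) y + mdist Y y w" using w ym cm by (intro mdist_triangle)
    moreover have "(1::real) / 2 ^ N w < 3 / 2 ^ N w" by (simp add: divide_strict_right_mono)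
    ultimately show ?thesis using y ym cm by linarith
  qed
  moreover have "\<exists>\<rho>>0. finite (c ` {w \<in> mspace Y. mdist Y w0 w < \<rho>})" if w0: "w0 \<in> mspace Y" for w0
  proof -
    define n0 where "n0 = N w0"
    obtain y0 where y0: "y0 \<in> E n0 (c w0)" "mdist Y y0 w0 < 1 / 2 ^ n0" using Vc[OF w0] by (auto simp: V_def n0_def)
    have y0m: "y0 \<in> mspace Y" using y0 by (simp add: E_def)
    define \<rho> where "\<rho> = min (1 / 2 ^ n0 - mdist Y y0 w0) (1 / 2 / 2 ^ n0)"
    have \<rho>: "\<rho> > 0" "\<rho> \<le> 1 / 2 ^ n0 - mdist Y y0 w0" "\<rho> \<le> 1 / 2 / 2 ^ n0" using y0 by (auto simp: \<rho>_def)
    define B where "B = {w \<in> mspace Y. mdist Y w0 w < \<rho>}"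
    have N_le: "N w \<le> n0" if "w \<in> B" for w
    proof -
      have w: "w \<in> mspace Y" "mdist Y w0 w < \<rho>" using that by (auto simp: B_def)
      have "mdist Y y0 w \<le> mdist Y y0 w0 + mdist Y w0 w" using w w0 y0m by (intro mdist_triangle)
      then have "mdist Y y0 w < 1 / 2 ^ n0" using \<rho> w by linarith
      then have "\<exists>\<alpha>. V n0 \<alpha> w" using y0 by (auto simp: V_def)
      then show ?thesis unfolding N_def by (rule Least_le)
    qed
    have same: "c w = c w'" if ww: "w \<in> B" "w' \<in> B" "N w = N w'" for w w'
    proof -
      have w: "w \<in> mspace Y" "w' \<in> mspace Y" "mdist Y w0 w < \<rho>" "mdist Y w0 w' < \<rho>" using ww by (auto simp: B_def)
      obtain y where y: "y \<in> E (N w) (c w)" "mdist Y y w < 1 / 2 ^ N w" using Vc[OF w(1)] by (auto simp: V_def)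
      obtain y' where y': "y' \<in> E (N w) (c w')" "mdist Y y' w' < 1 / 2 ^ N w" using Vc[OF w(2)] ww by (auto simp: V_def)
      have ym: "y \<in> mspace Y" "y' \<in> mspace Y" using y y' by (auto simp: E_def)
      have "(1::real) / 2 ^ n0 \<le> 1 / 2 ^ N w" using N_le[OF ww(1)] by (intro divide_left_mono power_increasing) auto
      then have "2 * \<rho> \<le> 1 / 2 ^ N w" using \<rho>(3) by simp
      moreover have "mdist Y y y' \<le> mdist Y y w + mdist Y w y'" "mdist Y w y' \<le> mdist Y w w' + mdist Y w' y'"
         "mdist Y w w' \<le> mdist Y w w0 + mdist Y w0 w'"
        using ym w w0 by (auto intro: mdist_triangle)
      moreover have "mdist Y w' y' < 1 / 2 ^ N w" "mdist Y w w0 < \<rho>" using y' w by (simp_all add: mdist_commute)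
      ultimately have "mdist Y y y' < 1 / 2 ^ N w + 1 / 2 ^ N w + 1 / 2 ^ N w" using y w by linarith
      then have "mdist Y y y' < 3 / 2 ^ N w" by simp
      then show ?thesis using sep y(1) y'(1) by blast
    qed
    have "c ` B = (\<Union>n\<in>{..n0}. c ` {w \<in> B. N w = n})" using N_le by auto
    moreover have "finite (c ` {w \<in> B. N w = n})" for n
    proof (cases "{w \<in> B. N w = n} = {}")
      case False
      then obtain v where "v \<in> B" "N v = n" by blast
      then have "c w = c v" if "w \<in> B" "N w = n" for w using same[of w v] that by simp
      then have "c ` {w \<in> B. N w = n} \<subseteq> {c v}" by auto
      then show ?thesis by (rule finite_subset) simp
    next
      case True then show ?thesis by (simp only: image_empty finite.emptyI)
    qed
    ultimately have "finite (c ` B)" by simp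
    then show ?thesis using \<rho>(1) unfolding B_def by blast
  qed
  ultimately show ?thesis by blast
qed

section \<open>Growing one closed set towards another along traces\<close>

text \<open>One domain for the traces over each distance \<open>a\<close>.\<close>
definition grid_points :: "real \<Rightarrow> real set" where
  "grid_points a = insert a (\<rat> \<inter> {0..a})"

lemma grid_points_dense:
  assumes "0 \<le> s" "s \<le> a" "t > 0"
  shows "\<exists>q\<in>grid_points a. q \<le> s \<and> s - q < t"
proof (cases "s = 0")
  case True
  then show ?thesis using assms by (intro bexI[of _ 0]) (auto simp: grid_points_def)
next
  case False
  then have "max 0 (s - t) < s" using assms by simp
  then obtain q where "q \<in> \<rat>" "max 0 (s - t) < q" "q < s" using Rats_dense_in_real by blast
  then show ?thesis using assms by (intro bexI[of _ q]) (auto simp: grid_points_def)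
qed

text \<open>A choice of one trace for each pair of points, with a common modulus for close pairs in \<open>G\<close>. The trace
  starts at its first point for every pair, so that growth at parameter 0 adds no points.\<close>
definition trace_choice :: "'a metric \<Rightarrow> 'a set \<Rightarrow> real \<Rightarrow> ('a \<Rightarrow> 'a \<Rightarrow> real \<Rightarrow> 'a) \<Rightarrow> bool" where
  "trace_choice m G \<epsilon> g \<longleftrightarrow> (\<forall>a b. g a b 0 = a) \<and>
    (\<forall>a\<in>G. \<forall>b\<in>G. mdist m a b < \<epsilon> \<longrightarrow> g a b (mdist m a b) = b \<and>
       (\<forall>q\<in>grid_points (mdist m a b). g a b q \<in> mspace m)) \<and>
    (\<forall>e>0. \<exists>t>0. \<forall>a\<in>G. \<forall>b\<in>G. mdist m a b < \<epsilon> \<longrightarrow>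
       (\<forall>q\<in>grid_points (mdist m a b). \<forall>q'\<in>grid_points (mdist m a b). \<bar>q - q'\<bar> \<le> t \<longrightarrow>
          mdist m (g a b q) (g a b q') < e))"

lemma trace_choice_exists:
  assumes G: "G \<subseteq> mspace m" and tr: "uniformly_locally_trace_equiconnected_at m G"
  shows "\<exists>\<epsilon>>0. \<exists>g. trace_choice m G \<epsilon> g"
proof -
  from tr obtain \<epsilon> \<omega> where \<epsilon>: "\<epsilon> > 0" and \<omega>: "continuity_modulus \<omega>"
    and f: "\<forall>x\<in>G. \<forall>y\<in>G. mdist m x y < \<epsilon> \<longrightarrow>
          (\<forall>Q. countable Q \<and> {0, mdist m x y} \<subseteq> Q \<and> Q \<subseteq> {0..mdist m x y} \<and>
               {0..mdist m x y} \<subseteq> closure Q \<longrightarrow>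
             (\<exists>f. uniformly_continuous_map (submetric euclidean_metric Q) m f \<and>
                  f 0 = x \<and> f (mdist m x y) = y \<and>
                  (\<forall>t>0. modulus_of (submetric euclidean_metric Q) m f t \<le> ennreal (\<omega> t))))"
    unfolding uniformly_locally_trace_equiconnected_at_def by (elim exE conjE)
  define ok where "ok a b f \<longleftrightarrow> f 0 = a \<and> (a \<in> G \<and> b \<in> G \<and> mdist m a b < \<epsilon> \<longrightarrow> f (mdist m a b) = b \<and>
      (\<forall>q\<in>grid_points (mdist m a b). f q \<in> mspace m) \<and>
      (\<forall>t>0. \<forall>q\<in>grid_points (mdist m a b). \<forall>q'\<in>grid_points (mdist m a b). \<bar>q - q'\<bar> \<le> t \<longrightarrow>
          mdist m (f q) (f q') \<le> \<omega> t))" for a b f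
  have "\<exists>f. ok a b f" for a b
  proof (cases "a \<in> G \<and> b \<in> G \<and> mdist m a b < \<epsilon>")
    case True
    let ?Q = "grid_points (mdist m a b)"
    have "countable ?Q" unfolding grid_points_def using countable_rat by (intro countable_insert countable_Int1)
    moreover have "{0, mdist m a b} \<subseteq> ?Q" "?Q \<subseteq> {0..mdist m a b}" by (auto simp: grid_points_def)
    moreover have "{0..mdist m a b} \<subseteq> closure ?Q"
    proof
      fix s assume "s \<in> {0..mdist m a b}"
      then have s: "0 \<le> s" "s \<le> mdist m a b" by auto
      have "\<exists>q\<in>?Q. dist q s < t" if t: "t > 0" for t
      proof -
        obtain q where "q \<in> ?Q" "q \<le> s" "s - q < t" using grid_points_dense[OF s t] by blast
        then show ?thesis by (intro bexI[of _ q]) (auto simp: dist_real_def)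
      qed
      then show "s \<in> closure ?Q" by (simp add: closure_approachable)
    qed
    ultimately obtain f where f: "uniformly_continuous_map (submetric euclidean_metric ?Q) m f"
      "f 0 = a" "f (mdist m a b) = b"
      "\<forall>t>0. modulus_of (submetric euclidean_metric ?Q) m f t \<le> ennreal (\<omega> t)"
      using f True by meson
    have ms: "\<forall>q\<in>?Q. f q \<in> mspace m"
      using uniformly_continuous_map_funspace[OF f(1)] by auto
    have "mdist m (f q) (f q') \<le> \<omega> t" if "t > 0" "q \<in> ?Q" "q' \<in> ?Q" "\<bar>q - q'\<bar> \<le> t" for t q q'
    proof -
      have "ennreal (mdist m (f q) (f q')) \<le> modulus_of (submetric euclidean_metric ?Q) m f t"
        unfolding modulus_of_def using that by (intro SUP_upper2[of "(q, q')"]) (auto simp: dist_real_def)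
      also have "\<dots> \<le> ennreal (\<omega> t)" using f(4) that by blast
      finally have "ennreal (mdist m (f q) (f q')) \<le> ennreal (\<omega> t)" .
      moreover have "\<omega> t > 0" using \<omega> that(1) by (simp add: continuity_modulus_def)
      ultimately show ?thesis by (simp add: ennreal_le_iff)
    qed
    then show ?thesis unfolding ok_def using f ms by (intro exI[of _ f]) auto
  next
    case False then show ?thesis unfolding ok_def by (intro exI[of _ "\<lambda>_. a"]) auto
  qed
  then obtain g where "\<And>a b. ok a b (g a b)" by metis
  note g = this[unfolded ok_def]
  have small: "\<exists>t>0. \<omega> t < e" if "e > 0" for e
  proof -
    have "eventually (\<lambda>t. \<omega> t < e) (at_right 0)"
      using \<omega> that unfolding continuity_modulus_def by (intro order_tendstoD(2)) auto
    then obtain b where "b > 0" "\<forall>y>0. y < b \<longrightarrow> \<omega> y < e" unfolding eventually_at_right_field by blast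
    then show ?thesis by (intro exI[of _ "b/2"]) auto
  qed
  have "\<exists>t>0. \<forall>a\<in>G. \<forall>b\<in>G. mdist m a b < \<epsilon> \<longrightarrow>
       (\<forall>q\<in>grid_points (mdist m a b). \<forall>q'\<in>grid_points (mdist m a b). \<bar>q - q'\<bar> \<le> t \<longrightarrow>
          mdist m (g a b q) (g a b q') < e)" if "e > 0" for e
  proof -
    obtain t where t: "t > 0" "\<omega> t < e" using small[OF \<open>e > 0\<close>] by blast
    have "mdist m (g a b q) (g a b q') < e"
      if "a \<in> G" "b \<in> G" "mdist m a b < \<epsilon>" "q \<in> grid_points (mdist m a b)" "q' \<in> grid_points (mdist m a b)" "\<bar>q - q'\<bar> \<le> t" for a b q q'
    proof -
      have "mdist m (g a b q) (g a b q') \<le> \<omega> t" using g that t(1) by simp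
      then show ?thesis using t(2) by simp
    qed
    then show ?thesis using t(1) by blast
  qed
  then show ?thesis
    unfolding trace_choice_def using g by (intro exI[of _ \<epsilon>] conjI exI[of _ g] \<epsilon>) simp_all
qed

definition growth_reach :: "'a set set \<Rightarrow> ('a set \<Rightarrow> 'a set \<Rightarrow> real \<Rightarrow> 'a set) \<Rightarrow> bool" where
  "growth_reach K T \<longleftrightarrow> (\<forall>y\<in>K. \<forall>z\<in>K. z \<subseteq> T y z 1)"

definition growth_cont :: "'a metric \<Rightarrow> 'a set set \<Rightarrow> ('a set \<Rightarrow> 'a set \<Rightarrow> real \<Rightarrow> 'a set) \<Rightarrow> real \<Rightarrow> real \<Rightarrow> bool" where
  "growth_cont m K T e \<delta> \<longleftrightarrow> (\<forall>y\<in>K. \<forall>z\<in>K. \<forall>\<theta>\<in>{0..1}. \<forall>\<theta>'\<in>{0..1}. \<bar>\<theta> - \<theta>'\<bar> < \<delta> \<longrightarrow>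
      (\<forall>p\<in>T y z \<theta>. \<exists>p'\<in>T y z \<theta>'. mdist m p p' < e))"

definition growth_local :: "'a metric \<Rightarrow> 'a set set \<Rightarrow> ('a set \<Rightarrow> 'a set \<Rightarrow> real \<Rightarrow> 'a set) \<Rightarrow> real \<Rightarrow> real \<Rightarrow> bool" where
  "growth_local m K T e \<delta> \<longleftrightarrow> (\<forall>y\<in>K. \<forall>z\<in>K. mdist (hyperspace m) y z < \<delta> \<longrightarrow>
      (\<forall>\<theta>\<in>{0..1}. \<forall>p\<in>T y z \<theta>. \<exists>a\<in>y. mdist m a p < e))"

definition hball :: "'a metric \<Rightarrow> 'a set set \<Rightarrow> 'a set \<Rightarrow> real \<Rightarrow> 'a set set" where
  "hball m H Y0 \<rho> = {y \<in> H. mdist (hyperspace m) Y0 y < \<rho>}"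

text \<open>\<open>T y z \<theta>\<close> grows with \<open>\<theta>\<close> from \<open>y\<close> to a set containing \<open>z\<close>. The reach and
  the moduli of continuity are required only locally: the constants for the members of \<open>H\<close> have no common
  bound in general.\<close>
definition growth :: "'a metric \<Rightarrow> 'a set set \<Rightarrow> ('a set \<Rightarrow> 'a set \<Rightarrow> real \<Rightarrow> 'a set) \<Rightarrow> bool" where
  "growth m H T \<longleftrightarrow>
    (\<forall>y\<in>H. \<forall>z\<in>H. T y z 0 = y \<and> (\<forall>\<theta>. y \<subseteq> T y z \<theta> \<and> T y z \<theta> \<subseteq> mspace m)) \<and>
    (\<forall>Y0\<in>H. \<exists>\<rho>>0. growth_reach (hball m H Y0 \<rho>) T \<and>
      (\<forall>e>0. \<exists>\<delta>>0. growth_cont m (hball m H Y0 \<rho>) T e \<delta> \<and> growth_local m (hball m H Y0 \<rho>) T e \<delta>))"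

lemma growth_near:
  assumes "growth m H T" "Y0 \<in> H"
  shows "\<exists>\<rho>>0. growth_reach (hball m H Y0 \<rho>) T \<and>
      (\<forall>e>0. \<exists>\<delta>>0. growth_cont m (hball m H Y0 \<rho>) T e \<delta> \<and> growth_local m (hball m H Y0 \<rho>) T e \<delta>)"
  using assms(1)[unfolded growth_def, THEN conjunct2, THEN bspec, OF assms(2)] .

text \<open>\<open>T y z \<theta>\<close> adds to \<open>y\<close> the initial parts, up to the fraction \<open>\<theta>\<close>, of the traces
  from points \<open>a \<in> y\<close> to points \<open>b \<in> z\<close> with \<open>mdist m a b\<close> at most twice the distance of
  \<open>y\<close> and \<open>z\<close>. Each point of \<open>z\<close> is the end of such a trace. The traces are those chosen for a
  closed neighbourhood \<open>G (c y)\<close> of the member \<open>c y\<close> of \<open>H\<close> assigned to \<open>y\<close>. As only finitely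
  many \<open>c y\<close> occur near \<open>Y0\<close>, the constants of their traces have positive minima there.\<close>
lemma growth_exists:
  assumes H: "openin (mtopology_of (hyperspace m)) H"
    and tr: "\<And>F. F \<in> H \<Longrightarrow> uniformly_locally_trace_equiconnected_at m F"
  shows "\<exists>T. growth m H T"
proof -
  let ?d = "mdist (hyperspace m)"
  have Hc: "F \<in> closed_nonempty m" if "F \<in> H" for F
    using H that openin_subset by fastforce
  have dtri: "?d A C \<le> ?d A B + ?d B C" if "A \<in> H" "B \<in> H" "C \<in> H" for A B C
    using that Hc by (intro mdist_triangle) auto
  have "\<exists>r G. F \<in> H \<longrightarrow> r > 0 \<and> r \<le> 1 \<and> G \<in> H \<and> (\<forall>a\<in>F. \<forall>x\<in>mspace m. mdist m a x < r \<longrightarrow> x \<in> G)" for F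
  proof (cases "F \<in> H")
    case True
    show ?thesis by (rule closed_neighbourhood_in_open[OF H True]) blast
  qed simp
  then obtain r G where rG: "\<And>F. F \<in> H \<Longrightarrow> r F > 0" "\<And>F. F \<in> H \<Longrightarrow> r F \<le> 1" "\<And>F. F \<in> H \<Longrightarrow> G F \<in> H"
    "\<And>F a x. F \<in> H \<Longrightarrow> a \<in> F \<Longrightarrow> x \<in> mspace m \<Longrightarrow> mdist m a x < r F \<Longrightarrow> x \<in> G F"
    by metis
  have Gm: "G F \<subseteq> mspace m" if "F \<in> H" for F using rG(3)[OF that] Hc closed_nonempty_subset by blast
  have GF: "a \<in> G F" if F: "F \<in> H" and y: "y \<in> H" "?d F y < r F" and a: "a \<in> y" for F y a
  proof -
    have yF: "?d y F < r F" using y(2) by (simp add: mdist_commute)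
    obtain b where b: "b \<in> F" "mdist m a b < r F"
      by (rule hyperspace_point_near[OF Hc[OF y(1)] Hc[OF F] yF rG(2)[OF F] a])
    then show ?thesis
      using rG(4)[OF F b(1)] closed_nonemptyD[OF Hc[OF y(1)] a] by (simp add: mdist_commute)
  qed
  have "\<exists>\<epsilon> g. F \<in> H \<longrightarrow> \<epsilon> > 0 \<and> trace_choice m (G F) \<epsilon> g" for F
  proof (cases "F \<in> H")
    case True
    from trace_choice_exists[OF Gm[OF True] tr[OF rG(3)[OF True]]] show ?thesis by blast
  qed simp
  then obtain \<epsilon> g where \<epsilon>: "\<And>F. F \<in> H \<Longrightarrow> \<epsilon> F > 0" and good: "\<And>F. F \<in> H \<Longrightarrow> trace_choice m (G F) (\<epsilon> F) (g F)"
    by metis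
  have g0: "g F a b 0 = a" if "F \<in> H" for F a b using good[OF that] by (simp add: trace_choice_def)
  have g1: "g F a b (mdist m a b) = b" "\<And>q. q \<in> grid_points (mdist m a b) \<Longrightarrow> g F a b q \<in> mspace m"
    if "F \<in> H" "a \<in> G F" "b \<in> G F" "mdist m a b < \<epsilon> F" for F a b
    using good[OF that(1)] that by (simp_all add: trace_choice_def)
  have gmod: "\<exists>t>0. \<forall>a\<in>G F. \<forall>b\<in>G F. mdist m a b < \<epsilon> F \<longrightarrow>
       (\<forall>q\<in>grid_points (mdist m a b). \<forall>q'\<in>grid_points (mdist m a b). \<bar>q - q'\<bar> \<le> t \<longrightarrow>
          mdist m (g F a b q) (g F a b q') < e)" if "F \<in> H" "e > 0" for F e
    using good[OF that(1)] that(2) unfolding trace_choice_def by blast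
  define Y where "Y = submetric (hyperspace m) H"
  have Y: "mspace Y = H" "mdist Y = ?d" using Hc by (auto simp: Y_def)
  have "\<exists>c. (\<forall>y\<in>mspace Y. c y \<in> mspace Y \<and> mdist Y (c y) y < r (c y) / 2) \<and>
    (\<forall>y0\<in>mspace Y. \<exists>\<rho>>0. finite (c ` {y \<in> mspace Y. mdist Y y0 y < \<rho>}))"
    by (rule locally_finite_choice) (use rG(1) Y in simp)
  then obtain c where c': "\<forall>y\<in>H. c y \<in> H \<and> ?d (c y) y < r (c y) / 2"
    and cfin: "\<forall>y0\<in>H. \<exists>\<rho>>0. finite (c ` {y \<in> H. ?d y0 y < \<rho>})"
    unfolding Y by (elim exE conjE)
  have c: "\<And>y. y \<in> H \<Longrightarrow> c y \<in> H" "\<And>y. y \<in> H \<Longrightarrow> ?d (c y) y < r (c y) / 2"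
    using c' by simp_all
  define adm where "adm y z a b \<longleftrightarrow> a \<in> y \<and> b \<in> z \<and> a \<in> G (c y) \<and> b \<in> G (c y) \<and> mdist m a b < \<epsilon> (c y) \<and>
      mdist m a b \<le> 2 * ?d y z" for y z a b
  define T where "T y z \<theta> = y \<union> {g (c y) a b q | a b q. adm y z a b \<and> q \<in> grid_points (mdist m a b) \<and> q \<le> \<theta> * mdist m a b}"
    for y z \<theta>
  have T_mem: "p \<in> y \<or> (\<exists>a b q. adm y z a b \<and> q \<in> grid_points (mdist m a b) \<and> q \<le> \<theta> * mdist m a b \<and> p = g (c y) a b q)"
    if "p \<in> T y z \<theta>" for p y z \<theta> using that by (auto simp: T_def)
  have T_I: "g (c y) a b q \<in> T y z \<theta>" if "adm y z a b" "q \<in> grid_points (mdist m a b)" "q \<le> \<theta> * mdist m a b" for y z a b q \<theta>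
    using that unfolding T_def by blast
  have gp: "0 \<le> q" "q \<le> a" if "q \<in> grid_points a" "0 \<le> a" for q a using that by (auto simp: grid_points_def)
  have gp0: "0 \<in> grid_points a" if "0 \<le> a" for a using that by (auto simp: grid_points_def)
  have gpa: "a \<in> grid_points a" for a by (auto simp: grid_points_def)
  have T0: "T y z 0 = y" if y: "y \<in> H" for y z
  proof -
    have "g (c y) a b q \<in> y" if "adm y z a b" "q \<in> grid_points (mdist m a b)" "q \<le> 0 * mdist m a b" for a b q
    proof -
      have "q = 0" using that gp(1)[OF that(2)] by simp
      then show ?thesis using that(1) g0[OF c(1)[OF y]] by (simp add: adm_def)
    qed
    then show ?thesis unfolding T_def by blast
  qed
  have Tsub: "y \<subseteq> T y z \<theta> \<and> T y z \<theta> \<subseteq> mspace m" if y: "y \<in> H" for y z \<theta>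
  proof -
    have "g (c y) a b q \<in> mspace m" if "adm y z a b" "q \<in> grid_points (mdist m a b)" for a b q
      using that g1(2)[OF c(1)[OF y]] by (simp add: adm_def)
    then show ?thesis using closed_nonempty_subset[OF Hc[OF y]] unfolding T_def by blast
  qed
  \<comment> \<open>The radius \<open>\<rho>\<close> is small enough that all traces between sets near \<open>Y0\<close> are within the
    range of the trace choices in use.\<close>
  have loc: "\<exists>\<rho>>0. growth_reach (hball m H Y0 \<rho>) T \<and>
      (\<forall>e>0. \<exists>\<delta>>0. growth_cont m (hball m H Y0 \<rho>) T e \<delta> \<and> growth_local m (hball m H Y0 \<rho>) T e \<delta>)"
    if Y0: "Y0 \<in> H" for Y0
  proof -
    obtain \<rho>1 where \<rho>1: "\<rho>1 > 0" "finite (c ` {y \<in> H. ?d Y0 y < \<rho>1})" using bspec[OF cfin Y0] by (elim exE conjE)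
    define C where "C = c ` {y \<in> H. ?d Y0 y < \<rho>1}"
    have C: "finite C" "C \<subseteq> H" using \<rho>1 c(1) by (auto simp: C_def)
    define K where "K = insert \<rho>1 (insert (1/8) ((\<lambda>F. min (r F / 4) (\<epsilon> F / 8)) ` C))"
    define \<rho> where "\<rho> = Min K"
    have K: "finite K" "K \<noteq> {}" "\<rho>1 \<in> K" "1/8 \<in> K" "\<And>F. F \<in> C \<Longrightarrow> min (r F / 4) (\<epsilon> F / 8) \<in> K"
      using C by (auto simp: K_def)
    have "k > 0" if "k \<in> K" for k using that C(2) \<rho>1 rG(1) \<epsilon> by (auto simp: K_def)
    then have \<rho>: "\<rho> > 0" "\<rho> \<le> \<rho>1" "\<rho> \<le> 1/8" using K Min_le[OF K(1,3)] Min_le[OF K(1,4)] by (simp_all add: \<rho>_def)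
    have \<rho>C: "\<rho> \<le> r F / 4" "\<rho> \<le> \<epsilon> F / 8" if "F \<in> C" for F
    proof -
      have "\<rho> \<le> min (r F / 4) (\<epsilon> F / 8)" unfolding \<rho>_def by (rule Min_le[OF K(1) K(5)[OF that]])
      then show "\<rho> \<le> r F / 4" "\<rho> \<le> \<epsilon> F / 8" by auto
    qed
    have cC: "c y \<in> C" if "y \<in> H" "?d Y0 y < \<rho>" for y using that \<rho> by (auto simp: C_def)
    have yz: "?d y z < 2 * \<rho>" if "y \<in> H" "z \<in> H" "?d Y0 y < \<rho>" "?d Y0 z < \<rho>" for y z
      using dtri[of y Y0 z] that Y0 mdist_commute[of "hyperspace m" y Y0] by simp
    have full: "z \<subseteq> T y z 1" if y: "y \<in> H" "z \<in> H" "?d Y0 y < \<rho>" "?d Y0 z < \<rho>" for y z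
    proof
      fix b assume b: "b \<in> z"
      show "b \<in> T y z 1"
      proof (cases "y = z")
        case True then show ?thesis using b by (simp add: T_def)
      next
        case False
        have ms: "y \<in> mspace (hyperspace m)" "z \<in> mspace (hyperspace m)" using Hc y by auto
        have pos: "0 < ?d y z" using mdist_zero[OF ms] False mdist_nonneg[of "hyperspace m" y z] by linarith
        have zy: "?d z y < 2 * ?d y z" "2 * ?d y z \<le> 1"
          using pos yz[OF y] \<rho>(3) by (simp_all add: mdist_commute)
        obtain a where a: "a \<in> y" "mdist m b a < 2 * ?d y z"
          by (rule hyperspace_point_near[OF Hc[OF y(2)] Hc[OF y(1)] zy b])
        note cy = cC[OF y(1,3)]
        have dcy: "?d (c y) y < r (c y) / 2" by (rule c(2)[OF y(1)])
        have "?d (c y) z \<le> ?d (c y) y + ?d y z" using dtri c(1) y by blast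
        then have dcz: "?d (c y) z < r (c y)" using dcy yz[OF y] \<rho>C(1)[OF cy] by linarith
        have "a \<in> G (c y)" using GF[OF c(1)[OF y(1)] y(1) _ a(1)] dcy rG(1)[OF c(1)[OF y(1)]] by simp
        moreover have "b \<in> G (c y)" using GF[OF c(1)[OF y(1)] y(2) dcz b] .
        moreover have ab: "mdist m a b < 2 * ?d y z" using a(2) by (simp add: mdist_commute)
        moreover have "mdist m a b < \<epsilon> (c y)" using ab yz[OF y] \<rho>C(2)[OF cy] \<rho>(1) by linarith
        ultimately have adm: "adm y z a b" using a b by (simp add: adm_def)
        then have "g (c y) a b (mdist m a b) = b" using g1(1)[OF c(1)[OF y(1)]] by (simp add: adm_def)
        then show ?thesis using T_I[OF adm gpa, of 1] by simp
      qed
    qed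
    have cont: "\<exists>\<delta>>0. growth_cont m (hball m H Y0 \<rho>) T e \<delta> \<and> growth_local m (hball m H Y0 \<rho>) T e \<delta>"
      if e: "e > 0" for e
    proof -
      have "\<exists>tF. \<forall>F\<in>C. tF F > 0 \<and> (\<forall>a\<in>G F. \<forall>b\<in>G F. mdist m a b < \<epsilon> F \<longrightarrow>
       (\<forall>q\<in>grid_points (mdist m a b). \<forall>q'\<in>grid_points (mdist m a b). \<bar>q - q'\<bar> \<le> tF F \<longrightarrow>
          mdist m (g F a b q) (g F a b q') < e))"
        by (rule bchoice) (use gmod[OF _ e] C in blast)
      then obtain tF where tF: "\<And>F. F \<in> C \<Longrightarrow> tF F > 0"
        "\<And>F a b q q'. F \<in> C \<Longrightarrow> a \<in> G F \<Longrightarrow> b \<in> G F \<Longrightarrow> mdist m a b < \<epsilon> F \<Longrightarrow> q \<in> grid_points (mdist m a b) \<Longrightarrow>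
           q' \<in> grid_points (mdist m a b) \<Longrightarrow> \<bar>q - q'\<bar> \<le> tF F \<Longrightarrow> mdist m (g F a b q) (g F a b q') < e"
        by blast
      define t where "t = Min (insert 1 (tF ` C))"
      have t: "t > 0" "\<And>F. F \<in> C \<Longrightarrow> t \<le> tF F" using C tF(1) by (auto simp: t_def)
      show ?thesis
        unfolding growth_cont_def growth_local_def
      proof (intro exI[of _ "t/2"] conjI ballI impI)
        show "t / 2 > 0" using t by simp
        fix y z assume "y \<in> hball m H Y0 \<rho>" "z \<in> hball m H Y0 \<rho>"
        then have y: "y \<in> H" "z \<in> H" "?d Y0 y < \<rho>" "?d Y0 z < \<rho>" by (auto simp: hball_def)
        note cy = cC[OF y(1,3)]
        have ab1: "mdist m a b \<le> 1" if "adm y z a b" for a b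
          using that yz[OF y] \<rho>(3) unfolding adm_def by linarith
        have ym: "p \<in> mspace m" if "p \<in> y" for p using closed_nonemptyD[OF Hc[OF y(1)] that] .
        have gd: "mdist m (g (c y) a b q) (g (c y) a b q') < e"
          if "adm y z a b" "q \<in> grid_points (mdist m a b)" "q' \<in> grid_points (mdist m a b)" "\<bar>q - q'\<bar> \<le> t" for a b q q'
        proof (rule tF(2)[OF cy])
          show "\<bar>q - q'\<bar> \<le> tF (c y)" using that(4) t(2)[OF cy] by linarith
        qed (use that in \<open>simp_all add: adm_def\<close>)
        {
          fix \<theta> \<theta>' p assume \<theta>: "\<theta> \<in> {0..1}" "\<theta>' \<in> {0..1}" "\<bar>\<theta> - \<theta>'\<bar> < t / 2" and p: "p \<in> T y z \<theta>"
          from T_mem[OF p] show "\<exists>p'\<in>T y z \<theta>'. mdist m p p' < e"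
          proof
            assume "p \<in> y"
            then show ?thesis using e ym[of p] by (intro bexI[of _ p]) (auto simp: T_def)
          next
            assume "\<exists>a b q. adm y z a b \<and> q \<in> grid_points (mdist m a b) \<and> q \<le> \<theta> * mdist m a b \<and> p = g (c y) a b q"
            then obtain a b q where q: "adm y z a b" "q \<in> grid_points (mdist m a b)" "q \<le> \<theta> * mdist m a b" "p = g (c y) a b q"
              by blast
            let ?D = "mdist m a b"
            have D: "0 \<le> ?D" "?D \<le> 1" using ab1[OF q(1)] by auto
            have "\<exists>q'\<in>grid_points ?D. q' \<le> \<theta>' * ?D \<and> \<bar>q - q'\<bar> \<le> t"
            proof (cases "q \<le> \<theta>' * ?D")
              case True then show ?thesis using q t by (intro bexI[of _ q]) auto
            next
              case False
              have "\<theta>' * ?D \<le> ?D" "0 \<le> \<theta>' * ?D" using \<theta>(2) D by (auto simp: mult_left_le_one_le)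
              then obtain q' where q': "q' \<in> grid_points ?D" "q' \<le> \<theta>' * ?D" "\<theta>' * ?D - q' < t / 2"
                using grid_points_dense[of "\<theta>' * ?D" ?D "t/2"] t by auto
              have "(\<theta> - \<theta>') * ?D \<le> \<bar>\<theta> - \<theta>'\<bar> * 1" using D by (intro mult_mono) auto
              then have "q - \<theta>' * ?D < t / 2" using q(3) \<theta>(3) by (simp add: algebra_simps)
              then have "\<bar>q - q'\<bar> \<le> t" using q' False by linarith
              then show ?thesis using q' by blast
            qed
            then obtain q' where q': "q' \<in> grid_points ?D" "q' \<le> \<theta>' * ?D" "\<bar>q - q'\<bar> \<le> t" by blast
            then show ?thesis using gd[OF q(1,2) q'(1,3)] T_I[OF q(1) q'(1,2)] q(4) by blast
          qed
        }
        fix \<theta> p assume \<theta>: "?d y z < t / 2" "\<theta> \<in> {0..1}" and p: "p \<in> T y z \<theta>"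
        from T_mem[OF p] show "\<exists>a\<in>y. mdist m a p < e"
        proof
          assume "p \<in> y"
          then show ?thesis using e ym[of p] by (intro bexI[of _ p]) auto
        next
          assume "\<exists>a b q. adm y z a b \<and> q \<in> grid_points (mdist m a b) \<and> q \<le> \<theta> * mdist m a b \<and> p = g (c y) a b q"
          then obtain a b q where q: "adm y z a b" "q \<in> grid_points (mdist m a b)" "p = g (c y) a b q"
            by blast
          have "\<bar>0 - q\<bar> \<le> t" using gp[OF q(2)] q(1) \<theta>(1) by (simp add: adm_def)
          then have "mdist m (g (c y) a b 0) p < e" using gd[OF q(1) gp0 q(2)] q(3) by simp
          then show ?thesis using g0[OF c(1)[OF y(1)]] q(1) by (auto simp: adm_def)
        qed
      qed
    qed
    have "growth_reach (hball m H Y0 \<rho>) T" unfolding growth_reach_def hball_def using full by simp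
    then show ?thesis using \<rho>(1) cont by blast
  qed
  have "growth m H T"
    unfolding growth_def
  proof (intro conjI ballI)
    show "T y z 0 = y" if "y \<in> H" for y z using T0[OF that] .
    show "\<forall>\<theta>. y \<subseteq> T y z \<theta> \<and> T y z \<theta> \<subseteq> mspace m" if "y \<in> H" for y z
      using Tsub[OF that] by (intro allI)
  qed (rule loc)
  then show ?thesis by blast
qed


section \<open>The retraction\<close>

text \<open>A ratio \<open>A / B\<close> is equicontinuous in \<open>A\<close> and \<open>B\<close> only where it is bounded, hence the cut-off at 5.\<close>
lemma ratio_close:
  fixes A B A' B' \<kappa> :: real
  assumes "\<bar>A - A'\<bar> \<le> \<kappa>" "\<bar>B - B'\<bar> \<le> \<kappa>" "0 < B" "B \<le> 2 * B'" "0 \<le> A" "0 \<le> A'"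
  shows "\<bar>min 5 (A / B) - min 5 (A' / B')\<bar> \<le> 12 * \<kappa> / B"
proof -
  have B': "B' > 0" and \<kappa>: "0 \<le> \<kappa>" using assms by auto
  have main: "\<bar>A / B - A' / B'\<bar> \<le> 12 * \<kappa> / B" if "A / B < 5 \<or> A' / B' < 5"
  proof -
    have ab: "\<bar>A * B' - A' * B\<bar> \<le> 6 * \<kappa> * max B B'"
      using that
    proof
      assume "A / B < 5"
      then have A: "A \<le> 5 * B" using assms(3) by (simp add: field_simps)
      have "A * B' - A' * B = A * (B' - B) + (A - A') * B" by (simp add: algebra_simps)
      then have "\<bar>A * B' - A' * B\<bar> \<le> \<bar>A * (B' - B)\<bar> + \<bar>(A - A') * B\<bar>" by (simp only: abs_triangle_ineq)
      also have "\<dots> = A * \<bar>B' - B\<bar> + \<bar>A - A'\<bar> * B" using assms by (simp add: abs_mult)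
      also have "\<dots> \<le> (5 * B) * \<kappa> + \<kappa> * B"
        using A assms \<kappa> by (intro add_mono mult_mono) auto
      also have "\<dots> = 6 * \<kappa> * B" by simp
      also have "\<dots> \<le> 6 * \<kappa> * max B B'" using \<kappa> by (intro mult_left_mono) auto
      finally show ?thesis .
    next
      assume "A' / B' < 5"
      then have A: "A' \<le> 5 * B'" using B' by (simp add: field_simps)
      have "A * B' - A' * B = A' * (B' - B) + (A - A') * B'" by (simp add: algebra_simps)
      then have "\<bar>A * B' - A' * B\<bar> \<le> \<bar>A' * (B' - B)\<bar> + \<bar>(A - A') * B'\<bar>" by (simp only: abs_triangle_ineq)
      also have "\<dots> = A' * \<bar>B' - B\<bar> + \<bar>A - A'\<bar> * B'" using assms B' by (simp add: abs_mult)
      also have "\<dots> \<le> (5 * B') * \<kappa> + \<kappa> * B'"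
        using A assms \<kappa> B' by (intro add_mono mult_mono) auto
      also have "\<dots> = 6 * \<kappa> * B'" by simp
      also have "\<dots> \<le> 6 * \<kappa> * max B B'" using \<kappa> by (intro mult_left_mono) auto
      finally show ?thesis .
    qed
    have "max B B' \<le> 2 * B'" using assms B' by simp
    then have "6 * \<kappa> * max B B' \<le> 6 * \<kappa> * (2 * B')" using \<kappa> by (intro mult_left_mono) auto
    then have ab': "\<bar>A * B' - A' * B\<bar> \<le> 12 * \<kappa> * B'" using ab by linarith
    have eq: "A / B - A' / B' = (A * B' - A' * B) / (B * B')" using assms(3) B' by (simp add: field_simps)
    have pos: "B * B' > 0" using assms(3) B' by simp
    have "\<bar>A / B - A' / B'\<bar> = \<bar>A * B' - A' * B\<bar> / (B * B')"
      unfolding eq abs_divide abs_of_pos[OF pos] ..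
    also have "\<dots> \<le> 12 * \<kappa> * B' / (B * B')" using ab' pos by (intro divide_right_mono) auto
    finally have "\<bar>A / B - A' / B'\<bar> \<le> 12 * \<kappa> * B' / (B * B')" .
    then show ?thesis using B' by simp
  qed
  have nonneg: "0 \<le> 12 * \<kappa> / B" using \<kappa> assms(3) by simp
  show ?thesis
  proof (cases "A / B < 5 \<or> A' / B' < 5")
    case True
    have "\<bar>min 5 x - min 5 y\<bar> \<le> \<bar>x - y\<bar>" for x y :: real by (simp add: min_def)
    then show ?thesis using main[OF True] by (meson order_trans)
  next
    case False
    then have "min 5 (A / B) = 5" "min 5 (A' / B') = 5" by (auto simp: min_def)
    then show ?thesis using nonneg by simp
  qed
qed

text \<open>Equal to 1 below \<open>k - 1\<close>, to 0 above \<open>k\<close>, and linear between.\<close>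
definition fade :: "real \<Rightarrow> real \<Rightarrow> real" where
  "fade k s = max 0 (min 1 (k - s))"

lemma fade_bounds: "0 \<le> fade k s" "fade k s \<le> 1" by (auto simp: fade_def)

lemma fade_min5: "k \<le> 4 \<Longrightarrow> fade k (min 5 s) = fade k s" by (auto simp: fade_def min_def max_def)

lemma fade_lipschitz: "\<bar>fade k s - fade k t\<bar> \<le> \<bar>s - t\<bar>"
  by (auto simp: fade_def min_def max_def)

locale extension_setup =
  fixes m :: "'a metric" and H :: "'a set set" and T :: "'a set \<Rightarrow> 'a set \<Rightarrow> real \<Rightarrow> 'a set"
    and M :: "'u metric" and e :: "'a set \<Rightarrow> 'u"
  assumes H: "openin (mtopology_of (hyperspace m)) H"
    and T: "growth m H T"
    and e: "e ` H \<subseteq> mspace M"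
    and iso: "\<And>x y. x \<in> H \<Longrightarrow> y \<in> H \<Longrightarrow> mdist M (e x) (e y) = mdist (hyperspace m) x y"
    and closed: "closedin (mtopology_of M) (e ` H)"
    and Hne: "H \<noteq> {}"
begin

abbreviation d where "d \<equiv> mdist (hyperspace m)"

lemma Hc: "F \<in> H \<Longrightarrow> F \<in> closed_nonempty m"
  using H openin_subset by fastforce

lemma em: "y \<in> H \<Longrightarrow> e y \<in> mspace M" using e by blast

lemma T_simps: "y \<in> H \<Longrightarrow> z \<in> H \<Longrightarrow> T y z 0 = y" "y \<in> H \<Longrightarrow> z \<in> H \<Longrightarrow> y \<subseteq> T y z \<theta>"
  "y \<in> H \<Longrightarrow> z \<in> H \<Longrightarrow> T y z \<theta> \<subseteq> mspace m"
  using T unfolding growth_def by simp_all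

definition D :: "'u \<Rightarrow> real" where "D x = (INF y\<in>H. mdist M x (e y))"

lemma D_le: "y \<in> H \<Longrightarrow> D x \<le> mdist M x (e y)"
  unfolding D_def by (intro cINF_lower bdd_belowI2[of _ 0]) auto

lemma D_less: assumes "D x < s" obtains y where "y \<in> H" "mdist M x (e y) < s"
proof -
  have "\<exists>y\<in>H. mdist M x (e y) < s"
    using assms unfolding D_def by (subst (asm) cINF_less_iff) (auto intro: bdd_belowI2[of _ 0] simp: Hne)
  then show thesis using that by blast
qed

lemma D_lipschitz: assumes "x \<in> mspace M" "x' \<in> mspace M" shows "D x \<le> D x' + mdist M x x'"
proof (rule field_le_epsilon)
  fix s :: real assume "s > 0"
  then have "D x' < D x' + s" by simp
  then obtain y where y: "y \<in> H" "mdist M x' (e y) < D x' + s" by (rule D_less)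
  have "D x \<le> mdist M x (e y)" using D_le y by blast
  also have "\<dots> \<le> mdist M x x' + mdist M x' (e y)" using assms em y by (intro mdist_triangle)
  finally show "D x \<le> D x' + mdist M x x' + s" using y by linarith
qed

lemma D_pos: assumes "x \<in> mspace M" "x \<notin> e ` H" shows "D x > 0"
proof -
  have "openin (mtopology_of M) (mspace M - e ` H)" using closed by (simp add: closedin_def)
  then obtain r where r: "r > 0" "\<forall>y\<in>mspace M. mdist M x y < r \<longrightarrow> y \<in> mspace M - e ` H"
    using assms unfolding openin_mtopology_of_iff by (metis DiffI)
  have "r \<le> D x" unfolding D_def
  proof (rule cINF_greatest[OF Hne])
    fix y assume "y \<in> H"
    then have "e y \<in> mspace M" "e y \<in> e ` H" using em by auto
    then show "r \<le> mdist M x (e y)" using r(2) by (meson DiffD2 not_le)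
  qed
  then show ?thesis using r by simp
qed

text \<open>The distance from \<open>x\<close> to \<open>y\<close> in units of the distance from \<open>x\<close> to \<open>H\<close>.\<close>
definition u :: "'a set \<Rightarrow> 'u \<Rightarrow> real" where "u y x = mdist M x (e y) / D x"

text \<open>A set \<open>y\<close> is a source of growth if \<open>u y x < 3\<close>, and a set \<open>z\<close> is a target if
  \<open>u z x < 4\<close>. When \<open>y\<close> ceases to be a source, its growths have shrunk back to \<open>y\<close>, and \<open>y\<close> itself is
  not lost: at \<open>u y x = 3\<close> it is still a target of weight 1 for every source \<open>w\<close> with
  \<open>u w x \<le> 2\<close>, and such sources always exist. This makes the union below continuous.\<close>
definition weight :: "'a set \<Rightarrow> 'a set \<Rightarrow> 'u \<Rightarrow> real" where
  "weight y z x = fade 3 (u y x) * fade 4 (u z x)"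

definition R :: "'u \<Rightarrow> 'a set" where
  "R x = \<Union>{T y z (weight y z x) | y z. y \<in> H \<and> z \<in> H \<and> u y x < 3}"

lemma R_I: "p \<in> T y z (weight y z x) \<Longrightarrow> y \<in> H \<Longrightarrow> z \<in> H \<Longrightarrow> u y x < 3 \<Longrightarrow> p \<in> R x"
  unfolding R_def by blast

lemma R_E: assumes "p \<in> R x" obtains y z where "y \<in> H" "z \<in> H" "u y x < 3" "p \<in> T y z (weight y z x)"
  using assms unfolding R_def by blast

lemma R_sub: "R x \<subseteq> mspace m" unfolding R_def using T_simps(3) by blast

lemma weight_01: "weight y z x \<in> {0..1}"
  unfolding weight_def using fade_bounds[of 3 "u y x"] fade_bounds[of 4 "u z x"]
  by (simp add: mult_le_one)

lemma weight_far: "3 \<le> u y x \<Longrightarrow> weight y z x = 0" "4 \<le> u z x \<Longrightarrow> weight y z x = 0"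
  by (simp_all add: weight_def fade_def)

lemma weight_close:
  assumes "\<bar>min 5 (u y x) - min 5 (u y x')\<bar> \<le> \<tau>" "\<bar>min 5 (u z x) - min 5 (u z x')\<bar> \<le> \<tau>"
  shows "\<bar>weight y z x - weight y z x'\<bar> \<le> 2 * \<tau>"
proof -
  let ?a = "fade 3 (u y x)" and ?b = "fade 4 (u z x)" and ?a' = "fade 3 (u y x')" and ?b' = "fade 4 (u z x')"
  have a: "\<bar>?a - ?a'\<bar> \<le> \<tau>" using fade_lipschitz[of 3 "min 5 (u y x)" "min 5 (u y x')"] assms(1) by (simp add: fade_min5)
  have b: "\<bar>?b - ?b'\<bar> \<le> \<tau>" using fade_lipschitz[of 4 "min 5 (u z x)" "min 5 (u z x')"] assms(2) by (simp add: fade_min5)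
  have "?a * ?b - ?a' * ?b' = ?a * (?b - ?b') + (?a - ?a') * ?b'" by (simp add: algebra_simps)
  then have "\<bar>?a * ?b - ?a' * ?b'\<bar> \<le> \<bar>?a * (?b - ?b')\<bar> + \<bar>(?a - ?a') * ?b'\<bar>" by (simp only: abs_triangle_ineq)
  also have "\<dots> = ?a * \<bar>?b - ?b'\<bar> + \<bar>?a - ?a'\<bar> * ?b'" by (simp add: abs_mult abs_of_nonneg fade_bounds)
  also have "\<dots> \<le> 1 * \<tau> + \<tau> * 1" using a b by (intro add_mono mult_mono) (auto simp: fade_bounds)
  finally show ?thesis by (simp add: weight_def)
qed

lemma ex_u_less_2: assumes "D x > 0" obtains y where "y \<in> H" "u y x < 2"
proof -
  have "D x < 2 * D x" using assms by simp
  then obtain y where "y \<in> H" "mdist M x (e y) < 2 * D x" by (rule D_less)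
  then show thesis using that assms by (simp add: u_def field_simps)
qed

lemma u_near:
  assumes "x \<in> mspace M" "D x > 0" "Y0 \<in> H" "mdist M x (e Y0) < \<kappa>" "y \<in> H" "u y x < 4"
  shows "d Y0 y < 5 * \<kappa>"
proof -
  have "mdist M x (e y) < 4 * D x" using assms(2,6) by (simp add: u_def field_simps)
  also have "\<dots> \<le> 4 * mdist M x (e Y0)" using D_le[OF assms(3), of x] by simp
  also have "\<dots> < 4 * \<kappa>" using assms(4) by simp
  finally have "mdist M x (e y) < 4 * \<kappa>" .
  moreover have "d Y0 y = mdist M (e Y0) (e y)" using iso assms by simp
  moreover have "mdist M (e Y0) (e y) \<le> mdist M (e Y0) x + mdist M x (e y)" using assms em by (intro mdist_triangle)
  ultimately show ?thesis using assms(4) by (simp add: mdist_commute)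
qed

lemma d_triangle: "A \<in> H \<Longrightarrow> B \<in> H \<Longrightarrow> C \<in> H \<Longrightarrow> d A C \<le> d A B + d B C"
  using Hc by (intro mdist_triangle) auto

text \<open>Near \<open>e Y0\<close> all sets that contribute to \<open>R x\<close> are near \<open>Y0\<close>, and their growths add only points
  that are near them.\<close>
lemma R_near:
  assumes Y0: "Y0 \<in> H" and \<epsilon>: "\<epsilon> > 0"
  shows "\<exists>\<kappa>>0. \<forall>x\<in>mspace M - e ` H. mdist M x (e Y0) < \<kappa> \<longrightarrow>
    R x \<noteq> {} \<and> d (mtopology_of m closure_of R x) Y0 \<le> \<epsilon>"
proof -
  obtain \<rho> where \<rho>: "\<rho> > 0" and Tc: "\<forall>e>0. \<exists>\<delta>>0. growth_cont m (hball m H Y0 \<rho>) T e \<delta> \<and> growth_local m (hball m H Y0 \<rho>) T e \<delta>"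
    using growth_near[OF T Y0] by (elim exE conjE)
  have "\<epsilon>/2 > 0" using \<epsilon> by simp
  then obtain \<delta> where \<delta>: "\<delta> > 0" and Td: "growth_local m (hball m H Y0 \<rho>) T (\<epsilon>/2) \<delta>"
    using Tc by blast
  define \<kappa> where "\<kappa> = Min {\<rho> / 5, \<delta> / 10, \<epsilon> / 10, 1 / 5}"
  have \<kappa>: "\<kappa> > 0" "5 * \<kappa> \<le> \<rho>" "10 * \<kappa> \<le> \<delta>" "5 * \<kappa> \<le> \<epsilon> / 2" "5 * \<kappa> \<le> 1"
    using \<rho> \<delta> \<epsilon> by (auto simp: \<kappa>_def)
  show ?thesis
  proof (intro exI[of _ \<kappa>] conjI ballI impI \<kappa>(1))
    fix x assume "x \<in> mspace M - e ` H" and xY: "mdist M x (e Y0) < \<kappa>"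
    then have x: "x \<in> mspace M" and Dx: "D x > 0" using D_pos by auto
    note near = u_near[OF x Dx Y0 xY]
    obtain w where w: "w \<in> H" "u w x < 2" using ex_u_less_2[OF Dx] .
    have wR: "w \<subseteq> R x" using T_simps(2)[OF w(1) w(1)] R_I[of _ w w x] w by auto
    have wne: "w \<noteq> {}" using Hc[OF w(1)] by (simp add: closed_nonempty_def)
    then show "R x \<noteq> {}" using wR by blast
    have pt: "\<exists>b\<in>B. mdist m a b < 5 * \<kappa>" if AB: "A \<in> H" "B \<in> H" "d A B < 5 * \<kappa>" "a \<in> A" for A B a
      by (rule hyperspace_point_near[OF Hc[OF AB(1)] Hc[OF AB(2)] AB(3) \<kappa>(5) AB(4)]) blast
    show "d (mtopology_of m closure_of R x) Y0 \<le> \<epsilon>"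
    proof (rule hyperspace_dist_closure_le_left[OF R_sub Hc[OF Y0]])
      fix p assume "p \<in> R x"
      then obtain y z where yz: "y \<in> H" "z \<in> H" "u y x < 3" "p \<in> T y z (weight y z x)" by (rule R_E)
      have y: "d Y0 y < 5 * \<kappa>" using near[OF yz(1)] yz(3) by simp
      have pm: "p \<in> mspace m" using T_simps(3)[OF yz(1,2)] yz(4) by blast
      have "\<exists>a\<in>y. mdist m a p < \<epsilon>/2"
      proof (cases "u z x < 4")
        case True
        then have z: "d Y0 z < 5 * \<kappa>" using near[OF yz(2)] by simp
        have "d y z \<le> d y Y0 + d Y0 z" using d_triangle yz Y0 by blast
        then have "d y z < \<delta>" using y z \<kappa>(3) by (simp add: mdist_commute)
        moreover have "d Y0 y < \<rho>" "d Y0 z < \<rho>" using y z \<kappa>(2) by linarith+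
        then have "y \<in> hball m H Y0 \<rho>" "z \<in> hball m H Y0 \<rho>" using yz by (simp_all add: hball_def)
        ultimately show ?thesis using Td yz(4) weight_01 unfolding growth_local_def by blast
      next
        case False
        then have "p \<in> y" using yz weight_far(2)[of z x y] T_simps(1) by simp
        then show ?thesis using \<epsilon> pm by (intro bexI[of _ p]) auto
      qed
      then obtain a where a: "a \<in> y" "mdist m a p < \<epsilon>/2" by blast
      have "d y Y0 < 5 * \<kappa>" using y by (simp add: mdist_commute)
      from pt[OF yz(1) Y0 this a(1)] obtain b where b: "b \<in> Y0" "mdist m a b < 5 * \<kappa>" by blast
      have "mdist m p b \<le> mdist m p a + mdist m a b"
        using pm closed_nonemptyD[OF Hc[OF yz(1)] a(1)] closed_nonemptyD[OF Hc[OF Y0] b(1)] by (intro mdist_triangle)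
      then show "\<exists>b\<in>Y0. mdist m p b \<le> \<epsilon>" using a b \<kappa>(4) by (intro bexI[of _ b]) (auto simp: mdist_commute[of m p a])
    next
      fix b assume b: "b \<in> Y0"
      have "d Y0 w < 5 * \<kappa>" using near[OF w(1)] w(2) by simp
      from pt[OF Y0 w(1) this b] show "\<exists>a\<in>R x. mdist m b a \<le> \<epsilon>" using wR \<kappa>(4) \<epsilon> by force
    qed (use \<epsilon> in simp)
  qed
qed

text \<open>A growth present at \<open>x\<close> is present at \<open>x'\<close> with almost the same parameter, unless its source has just
  been switched off. In that case the point is close to the source, and the source is covered by the almost
  complete growth from some \<open>w\<close> with \<open>u w x' < 2\<close>.\<close>
lemma R_transfer:
  assumes Y0: "Y0 \<in> H" and x: "x \<in> mspace M" "D x > 0" "mdist M x (e Y0) < \<kappa>"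
    and x': "x' \<in> mspace M" "D x' > 0" "mdist M x' (e Y0) < \<kappa>"
    and \<rho>: "5 * \<kappa> \<le> \<rho>" and \<epsilon>: "\<epsilon> > 0" and \<tau>: "2 * \<tau> < \<delta>" "\<tau> < 1"
    and reach: "growth_reach (hball m H Y0 \<rho>) T"
    and cont: "growth_cont m (hball m H Y0 \<rho>) T \<epsilon> \<delta>"
    and close: "\<And>y. y \<in> H \<Longrightarrow> \<bar>min 5 (u y x) - min 5 (u y x')\<bar> \<le> \<tau>"
    and p: "p \<in> R x"
  shows "\<exists>p'\<in>R x'. mdist m p p' \<le> 2 * \<epsilon>"
proof -
  have near: "y \<in> hball m H Y0 \<rho>" if "y \<in> H" "u y x < 4 \<or> u y x' < 4" for y
    unfolding hball_def using that(1) u_near[OF x(1,2) Y0 x(3) that(1)] u_near[OF x'(1,2) Y0 x'(3) that(1)] that(2) \<rho> by fastforce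
  have ym: "q \<in> mspace m" if "y \<in> H" "q \<in> y" for y q using closed_nonemptyD[OF Hc[OF that(1)] that(2)] .
  have base: "\<exists>p'\<in>R x'. mdist m q p' < \<epsilon>" if y: "y \<in> H" "u y x < 3" and q: "q \<in> y" for y q
  proof (cases "u y x' < 3")
    case True
    then have "q \<in> R x'" using T_simps(2)[OF y(1) y(1)] q by (intro R_I[of q y y]) (auto simp: y)
    then show ?thesis using \<epsilon> ym[OF y(1) q] by (intro bexI[of _ q]) auto
  next
    case False
    obtain w where w: "w \<in> H" "u w x' < 2" using ex_u_less_2[OF x'(2)] .
    have \<tau>0: "0 \<le> \<tau>" using close[OF y(1)] by linarith
    have "min 5 (u y x') \<le> 3 + \<tau>" using close[OF y(1)] y(2) by linarith
    then have "1 - \<tau> \<le> fade 4 (u y x')" using \<tau>(2) \<tau>0 by (auto simp: fade_def min_def split: if_splits)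
    moreover have "fade 3 (u w x') = 1" using w(2) by (simp add: fade_def)
    ultimately have "1 - \<tau> \<le> weight w y x'" by (simp add: weight_def)
    moreover have "weight w y x' \<le> 1" using weight_01[of w y x'] by simp
    ultimately have c: "\<bar>1 - weight w y x'\<bar> < \<delta>" using \<tau>(1) \<tau>0 by linarith
    have n: "w \<in> hball m H Y0 \<rho>" "y \<in> hball m H Y0 \<rho>" using near w y by auto
    then have "q \<in> T w y 1" using reach q unfolding growth_reach_def by blast
    then have "\<exists>p'\<in>T w y (weight w y x'). mdist m q p' < \<epsilon>"
      using cont[unfolded growth_cont_def, THEN bspec, OF n(1), THEN bspec, OF n(2), THEN bspec, of 1,
          THEN bspec, OF _ weight_01[of w y x'], THEN mp, OF _ c] by simp
    then show ?thesis using R_I[of _ w y x'] w y by fastforce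
  qed
  obtain y z where yz: "y \<in> H" "z \<in> H" "u y x < 3" "p \<in> T y z (weight y z x)" using p by (rule R_E)
  have pm: "p \<in> mspace m" using R_sub p by blast
  show ?thesis
  proof (cases "u z x < 4")
    case False
    then have "p \<in> y" using yz weight_far(2)[of z x y] T_simps(1) by simp
    from base[OF yz(1,3) this] obtain p' where "p' \<in> R x'" "mdist m p p' < \<epsilon>" by blast
    then show ?thesis using \<epsilon> by (intro bexI[of _ p']) auto
  next
    case True
    have "u y x < 4" using yz(3) by simp
    then have n: "y \<in> hball m H Y0 \<rho>" "z \<in> hball m H Y0 \<rho>" using near[OF yz(1) disjI1] near[OF yz(2) disjI1] True by simp_all
    have c: "\<bar>weight y z x - weight y z x'\<bar> < \<delta>"
      using weight_close[OF close[OF yz(1)] close[OF yz(2)]] \<tau>(1) by linarith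
    from cont[unfolded growth_cont_def, THEN bspec, OF n(1), THEN bspec, OF n(2), THEN bspec, OF weight_01[of y z x],
          THEN bspec, OF weight_01[of y z x'], THEN mp, OF c, THEN bspec, OF yz(4)]
    obtain q where q: "q \<in> T y z (weight y z x')" "mdist m p q < \<epsilon>" by blast
    show ?thesis
    proof (cases "u y x' < 3")
      case True
      then show ?thesis using R_I[OF q(1) yz(1,2)] q(2) \<epsilon> by (intro bexI[of _ q]) auto
    next
      case False
      then have "q \<in> y" using q(1) weight_far(1)[of y x' z] T_simps(1) yz by simp
      from base[OF yz(1,3) this] obtain p' where p': "p' \<in> R x'" "mdist m q p' < \<epsilon>" by blast
      have "mdist m p p' < \<epsilon> + \<epsilon>"
        using q p' pm ym[OF yz(1) \<open>q \<in> y\<close>] R_sub[of x'] mdist_triangle[of p m q p'] by fastforce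
      then show ?thesis using p' by (intro bexI[of _ p']) auto
    qed
  qed
qed

text \<open>On the complement of \<open>e ` H\<close> continuity comes from \<open>R_transfer\<close> in both directions, and at points
  of \<open>e ` H\<close> from \<open>R_near\<close>. The latter also shows, as \<open>H\<close> is open, that the closure of \<open>R x\<close>
  belongs to \<open>H\<close> for \<open>x\<close> in a neighbourhood of \<open>e ` H\<close>.\<close>
theorem neighbourhood_retract:
  "\<exists>U. openin (mtopology_of M) U \<and> e ` H \<subseteq> U \<and> e ` H retract_of_space subtopology (mtopology_of M) U"
proof -
  let ?cl = "\<lambda>x. mtopology_of m closure_of R x"
  \<comment> \<open>Within \<open>\<kappa>\<close> of \<open>e Y0\<close> the closure of \<open>R x\<close> lies in \<open>H\<close>, and all sets that
    contribute to \<open>R x\<close> lie in the ball about \<open>Y0\<close> on which the growths are controlled.\<close>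
  let ?B = "hball m H"
  define good where "good Y0 \<kappa> \<longleftrightarrow> \<kappa> > 0 \<and>
    (\<forall>x\<in>mspace M - e ` H. mdist M x (e Y0) < \<kappa> \<longrightarrow> ?cl x \<in> H) \<and>
    (\<exists>\<rho>. 5 * \<kappa> \<le> \<rho> \<and> growth_reach (?B Y0 \<rho>) T \<and> (\<forall>\<epsilon>>0. \<exists>\<delta>>0. growth_cont m (?B Y0 \<rho>) T \<epsilon> \<delta>))" for Y0 and \<kappa> :: real
  have "\<exists>\<kappa>. good Y0 \<kappa>" if Y0: "Y0 \<in> H" for Y0
  proof -
    obtain \<rho> where \<rho>: "\<rho> > 0" "growth_reach (?B Y0 \<rho>) T" "\<forall>\<epsilon>>0. \<exists>\<delta>>0. growth_cont m (?B Y0 \<rho>) T \<epsilon> \<delta>"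
      using growth_near[OF T Y0] by meson
    obtain r where r: "r > 0" "\<And>G. G \<in> closed_nonempty m \<Longrightarrow> d Y0 G < r \<Longrightarrow> G \<in> H"
      using H Y0 unfolding openin_mtopology_of_iff by auto
    have "r / 2 > 0" using r by simp
    from R_near[OF Y0 this] obtain \<kappa> where \<kappa>: "\<kappa> > 0"
      "\<forall>x\<in>mspace M - e ` H. mdist M x (e Y0) < \<kappa> \<longrightarrow> R x \<noteq> {} \<and> d (?cl x) Y0 \<le> r / 2" by (elim exE conjE)
    have "?cl x \<in> H" if "x \<in> mspace M - e ` H" "mdist M x (e Y0) < min \<kappa> (\<rho> / 5)" for x
    proof (rule r(2))
      have "R x \<noteq> {}" "d (?cl x) Y0 \<le> r / 2" using \<kappa>(2) that by auto
      then show "?cl x \<in> closed_nonempty m" "d Y0 (?cl x) < r"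
        using r(1) closed_nonempty_closure[OF R_sub] by (simp_all add: mdist_commute)
    qed
    then have "good Y0 (min \<kappa> (\<rho> / 5))"
      unfolding good_def using \<kappa>(1) \<rho> by (intro conjI exI[of _ \<rho>]) auto
    then show ?thesis by blast
  qed
  then obtain \<kappa> where \<kappa>: "\<And>Y0. Y0 \<in> H \<Longrightarrow> good Y0 (\<kappa> Y0)" by metis
  define U where "U = {x \<in> mspace M. \<exists>Y0\<in>H. mdist M x (e Y0) < \<kappa> Y0}"
  define ret where "ret x = (if x \<in> e ` H then x else e (?cl x))" for x
  have U_sub: "U \<subseteq> mspace M" by (auto simp: U_def)
  have U_open: "openin (mtopology_of M) U"
    unfolding openin_mtopology_of_iff
  proof (intro conjI U_sub ballI)
    fix x assume "x \<in> U"
    then obtain Y0 where Y0: "x \<in> mspace M" "Y0 \<in> H" "mdist M x (e Y0) < \<kappa> Y0" by (auto simp: U_def)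
    have "y \<in> U" if y: "y \<in> mspace M" "mdist M x y < \<kappa> Y0 - mdist M x (e Y0)" for y
    proof -
      have "mdist M y (e Y0) \<le> mdist M y x + mdist M x (e Y0)" using y Y0 em by (intro mdist_triangle)
      then have "mdist M y (e Y0) < \<kappa> Y0" using y(2) by (simp add: mdist_commute)
      then show ?thesis using y Y0(2) by (auto simp: U_def)
    qed
    then show "\<exists>r>0. \<forall>y\<in>mspace M. mdist M x y < r \<longrightarrow> y \<in> U"
      using Y0(3) by (intro exI[of _ "\<kappa> Y0 - mdist M x (e Y0)"]) auto
  qed
  have HU: "e ` H \<subseteq> U"
  proof
    fix x assume "x \<in> e ` H"
    then obtain Y0 where "Y0 \<in> H" "x = e Y0" by blast
    then show "x \<in> U" using em[of Y0] \<kappa>[of Y0] by (auto simp: U_def good_def intro!: bexI[of _ Y0])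
  qed
  have cl_H: "?cl x \<in> H" if "x \<in> U" "x \<notin> e ` H" for x
    using that \<kappa> unfolding U_def good_def by blast
  have ret_in: "ret x \<in> e ` H" if "x \<in> U" for x
    using that cl_H by (auto simp: ret_def)
  have continuous: "\<exists>r>0. \<forall>y\<in>U. mdist M x y < r \<longrightarrow> mdist M (ret x) (ret y) < \<epsilon>" if x: "x \<in> U" and \<epsilon>: "\<epsilon> > 0" for x \<epsilon>
  proof (cases "x \<in> e ` H")
    case True
    then obtain Y1 where Y1: "Y1 \<in> H" "x = e Y1" by blast
    have "\<epsilon> / 2 > 0" using \<epsilon> by simp
    from R_near[OF Y1(1) this] obtain \<kappa>1 where \<kappa>1: "\<kappa>1 > 0"
      "\<forall>x\<in>mspace M - e ` H. mdist M x (e Y1) < \<kappa>1 \<longrightarrow> R x \<noteq> {} \<and> d (?cl x) Y1 \<le> \<epsilon> / 2" by (elim exE conjE)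
    have "mdist M (ret x) (ret y) < \<epsilon>" if y: "y \<in> U" "mdist M x y < min \<kappa>1 \<epsilon>" for y
    proof (cases "y \<in> e ` H")
      case True
      then show ?thesis using y \<open>x \<in> e ` H\<close> by (simp add: ret_def)
    next
      case False
      then have "d (?cl y) Y1 \<le> \<epsilon> / 2" using \<kappa>1(2) y U_sub Y1(2) by (auto simp: mdist_commute)
      moreover have "mdist M (ret x) (ret y) = d Y1 (?cl y)"
        using iso[OF Y1(1) cl_H[OF y(1) False]] False \<open>x \<in> e ` H\<close> by (simp add: ret_def Y1(2))
      ultimately show ?thesis using \<epsilon> by (simp add: mdist_commute)
    qed
    then show ?thesis using \<kappa>1(1) \<epsilon> by (intro exI[of _ "min \<kappa>1 \<epsilon>"]) auto
  next
    case False
    then obtain Y0 where Y0: "x \<in> mspace M" "Y0 \<in> H" "mdist M x (e Y0) < \<kappa> Y0" using x by (auto simp: U_def)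
    have Dx: "D x > 0" using D_pos[OF Y0(1) False] .
    obtain \<rho> where \<rho>: "5 * \<kappa> Y0 \<le> \<rho>" "growth_reach (?B Y0 \<rho>) T" "\<forall>\<epsilon>>0. \<exists>\<delta>>0. growth_cont m (?B Y0 \<rho>) T \<epsilon> \<delta>"
      using \<kappa>[OF Y0(2)] unfolding good_def by blast
    have \<epsilon>4: "\<epsilon> / 4 > 0" using \<epsilon> by simp
    obtain \<delta> where \<delta>: "\<delta> > 0" "growth_cont m (?B Y0 \<rho>) T (\<epsilon> / 4) \<delta>" using \<rho>(3) \<epsilon>4 by blast
    define \<tau> where "\<tau> = min (\<delta> / 4) (1 / 2)"
    have \<tau>: "\<tau> > 0" "2 * \<tau> < \<delta>" "\<tau> < 1" using \<delta>(1) by (auto simp: \<tau>_def)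
    define r where "r = min (D x / 2) (min (\<tau> * D x / 12) (\<kappa> Y0 - mdist M x (e Y0)))"
    have r: "r > 0" "r \<le> D x / 2" "r \<le> \<tau> * D x / 12" "r \<le> \<kappa> Y0 - mdist M x (e Y0)"
    proof -
      show "r > 0" using Dx \<tau>(1) Y0(3) by (simp add: r_def)
      show "r \<le> D x / 2" unfolding r_def by (rule min.cobounded1)
      show "r \<le> \<tau> * D x / 12" unfolding r_def by (rule min.coboundedI2[OF min.cobounded1])
      show "r \<le> \<kappa> Y0 - mdist M x (e Y0)" unfolding r_def by (rule min.coboundedI2[OF min.cobounded2])
    qed
    have "mdist M (ret x) (ret y) < \<epsilon>" if y: "y \<in> U" "mdist M x y < r" for y
    proof -
      have ym: "y \<in> mspace M" using y U_sub by blast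
      have Dxy: "D x \<le> D y + mdist M x y" "D y \<le> D x + mdist M x y"
        using D_lipschitz[OF Y0(1) ym] D_lipschitz[OF ym Y0(1)] by (simp_all add: mdist_commute)
      then have Dy: "D y > 0" "D x \<le> 2 * D y" using y(2) r(2) Dx by linarith+
      have yC: "y \<notin> e ` H"
      proof
        assume "y \<in> e ` H"
        then obtain z where "z \<in> H" "y = e z" by blast
        then have "D y \<le> 0" using D_le[of z y] ym by simp
        then show False using Dy by simp
      qed
      have "mdist M y (e Y0) \<le> mdist M y x + mdist M x (e Y0)" using ym Y0 em by (intro mdist_triangle)
      then have yY0: "mdist M y (e Y0) < \<kappa> Y0" using y(2) r(4) by (simp add: mdist_commute)
      have close: "\<bar>min 5 (u z x) - min 5 (u z y)\<bar> \<le> \<tau>" if z: "z \<in> H" for z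
      proof -
        have "mdist M x (e z) \<le> mdist M x y + mdist M y (e z)" "mdist M y (e z) \<le> mdist M y x + mdist M x (e z)"
          using ym Y0(1) em[OF z] by (auto intro: mdist_triangle)
        then have "\<bar>mdist M x (e z) - mdist M y (e z)\<bar> \<le> mdist M x y" by (simp add: mdist_commute[of M y x] abs_le_iff)
        moreover have "\<bar>D x - D y\<bar> \<le> mdist M x y" using Dxy by (simp add: abs_le_iff)
        ultimately have "\<bar>min 5 (u z x) - min 5 (u z y)\<bar> \<le> 12 * mdist M x y / D x"
          unfolding u_def using Dx Dy(2) by (intro ratio_close) auto
        also have "\<dots> \<le> \<tau>" using y(2) r(3) Dx by (simp add: field_simps)
        finally show ?thesis .
      qed
      then have close': "\<bar>min 5 (u z y) - min 5 (u z x)\<bar> \<le> \<tau>" if "z \<in> H" for z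
        using that by (simp add: abs_minus_commute)
      note tr1 = R_transfer[OF Y0(2) Y0(1) Dx Y0(3) ym Dy(1) yY0 \<rho>(1) \<epsilon>4 \<tau>(2,3) \<rho>(2) \<delta>(2)]
      note tr2 = R_transfer[OF Y0(2) ym Dy(1) yY0 Y0(1) Dx Y0(3) \<rho>(1) \<epsilon>4 \<tau>(2,3) \<rho>(2) \<delta>(2)]
      have "d (?cl x) (?cl y) \<le> 2 * (\<epsilon> / 4)"
      proof (rule hyperspace_dist_closure_le[OF R_sub R_sub])
        show "\<exists>b\<in>R y. mdist m a b \<le> 2 * (\<epsilon> / 4)" if "a \<in> R x" for a
          by (rule tr1[OF _ that]) (rule close)
        show "\<exists>a\<in>R x. mdist m b a \<le> 2 * (\<epsilon> / 4)" if "b \<in> R y" for b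
          by (rule tr2[OF _ that]) (rule close')
      qed (use \<epsilon> in simp)
      moreover have "mdist M (ret x) (ret y) = d (?cl x) (?cl y)"
        using iso[OF cl_H[OF x False] cl_H[OF y(1) yC]] False yC by (simp add: ret_def)
      ultimately show ?thesis using \<epsilon> by simp
    qed
    then show ?thesis using r(1) by blast
  qed
  have eHm: "e ` H \<subseteq> mspace M" using e .
  have "continuous_map (subtopology (mtopology_of M) U) (subtopology (mtopology_of M) (e ` H)) ret"
    unfolding continuous_map_metric_iff[OF U_sub eHm] using ret_in continuous by (intro conjI ballI allI impI) auto
  moreover have "subtopology (subtopology (mtopology_of M) U) (e ` H) = subtopology (mtopology_of M) (e ` H)"
    using HU by (simp add: subtopology_subtopology Int_absorb1)
  ultimately have "e ` H retract_of_space subtopology (mtopology_of M) U"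
    unfolding retract_of_space_def using HU eHm
    by (intro conjI exI[of _ ret]) (auto simp: ret_def)
  then show ?thesis using U_open HU by blast
qed

end

theorem trace_equiconnected_imp_ANR:
  assumes H: "openin (mtopology_of (hyperspace m)) H"
    and tr: "\<And>F. F \<in> H \<Longrightarrow> uniformly_locally_trace_equiconnected_at m F"
  shows "metric_ANR TYPE('u) (submetric (hyperspace m) H)"
  unfolding metric_ANR_def
proof (intro allI impI)
  fix M :: "'u metric" and e :: "'a set \<Rightarrow> 'u"
  have HY: "mspace (submetric (hyperspace m) H) = H"
    using openin_subset[OF H] by auto
  assume "e ` mspace (submetric (hyperspace m) H) \<subseteq> mspace M \<and>
        (\<forall>x\<in>mspace (submetric (hyperspace m) H). \<forall>y\<in>mspace (submetric (hyperspace m) H).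
            mdist M (e x) (e y) = mdist (submetric (hyperspace m) H) x y) \<and>
        closedin (mtopology_of M) (e ` mspace (submetric (hyperspace m) H))"
  then have a: "e ` H \<subseteq> mspace M" "\<And>x y. x \<in> H \<Longrightarrow> y \<in> H \<Longrightarrow> mdist M (e x) (e y) = mdist (hyperspace m) x y"
    "closedin (mtopology_of M) (e ` H)" unfolding HY by simp_all
  obtain T where T: "growth m H T" using growth_exists[OF H tr] by blast
  show "\<exists>U. openin (mtopology_of M) U \<and> e ` mspace (submetric (hyperspace m) H) \<subseteq> U \<and>
             e ` mspace (submetric (hyperspace m) H) retract_of_space subtopology (mtopology_of M) U"
    unfolding HY
  proof (cases "H = {}")
    case True
    then show "\<exists>U. openin (mtopology_of M) U \<and> e ` H \<subseteq> U \<and> e ` H retract_of_space subtopology (mtopology_of M) U"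
      by (intro exI[of _ "{}"]) (auto simp: retract_of_space_def)
  next
    case False
    interpret extension_setup m H T M e
      by (rule extension_setup.intro) (use H T a False in simp_all)
    show "\<exists>U. openin (mtopology_of M) U \<and> e ` H \<subseteq> U \<and> e ` H retract_of_space subtopology (mtopology_of M) U"
      by (rule neighbourhood_retract)
  qed
qed

section \<open>The equivalence\<close>

theorem theorem3:
  fixes X :: "'a metric" and H :: "'a set set"
  assumes "openin (mtopology_of (hyperspace X)) H"
    and "\<And>F. F \<in> H \<Longrightarrow> D0_in X F \<subseteq> H"
  shows
    "(metric_ANR TYPE(('a set \<Rightarrow> real) + 'u) (submetric (hyperspace X) H) \<longleftrightarrow>
        locally_path_connected_space (mtopology_of (submetric (hyperspace X) H))) \<and>
     (locally_path_connected_space (mtopology_of (submetric (hyperspace X) H)) \<longleftrightarrow>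
        locally_chain_connected (submetric (hyperspace X) H)) \<and>
     (locally_chain_connected (submetric (hyperspace X) H) \<longleftrightarrow>
        (\<forall>F\<in>H. locally_chain_connected_at (hyperspace X) (D0_in X F))) \<and>
     ((\<forall>F\<in>H. locally_chain_connected_at (hyperspace X) (D0_in X F)) \<longleftrightarrow>
        (\<forall>F\<in>H. uniformly_locally_chain_equiconnected_at X F)) \<and>
     ((\<forall>F\<in>H. uniformly_locally_chain_equiconnected_at X F) \<longleftrightarrow>
        (\<forall>F\<in>H. uniformly_locally_trace_equiconnected_at X F))"
proof -
  let ?Y = "submetric (hyperspace X) H"
  note H = assms(1)
  have Hc: "H \<subseteq> closed_nonempty X" using openin_subset[OF H] by simp
  have 1: "locally_path_connected_space (mtopology_of ?Y)"
    if "metric_ANR TYPE(('a set \<Rightarrow> real) + 'u) ?Y"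
  proof -
    interpret bounded_metric ?Y
      by (rule bounded_metric.intro) (simp add: hyperspace_dist_le_1)
    show ?thesis using that by (rule metric_ANR_imp_locally_path_connected)
  qed
  have 2: "locally_chain_connected ?Y" if "locally_path_connected_space (mtopology_of ?Y)"
    using that by (rule locally_path_connected_imp_locally_chain_connected)
  have 3: "\<forall>F\<in>H. locally_chain_connected_at (hyperspace X) (D0_in X F)" if "locally_chain_connected ?Y"
    using locally_chain_connected_at_of_submetric[OF that assms(2)] Hc by simp
  have 4: "\<forall>F\<in>H. uniformly_locally_chain_equiconnected_at X F"
    if "\<forall>F\<in>H. locally_chain_connected_at (hyperspace X) (D0_in X F)"
  proof
    fix F assume "F \<in> H"
    then have "F \<in> closed_nonempty X" "locally_chain_connected_at (hyperspace X) (D0_in X F)"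
      using Hc that by auto
    then interpret lcc_hyperspace X F by (rule lcc_hyperspace.intro)
    show "uniformly_locally_chain_equiconnected_at X F" by (rule chain_equiconnected)
  qed
  have 5: "\<forall>F\<in>H. uniformly_locally_trace_equiconnected_at X F"
    if eq: "\<forall>F\<in>H. uniformly_locally_chain_equiconnected_at X F"
  proof
    fix F assume F: "F \<in> H"
    show "uniformly_locally_trace_equiconnected_at X F"
    proof (rule closed_neighbourhood_in_open[OF H F])
      fix r G assume r: "0 < r" "G \<in> H"
        and FG: "\<And>a x. a \<in> F \<Longrightarrow> x \<in> mspace X \<Longrightarrow> mdist X a x < r \<Longrightarrow> x \<in> G"
      have sub: "F \<subseteq> mspace X" "G \<subseteq> mspace X" using F r(2) Hc closed_nonempty_subset by auto
      have "uniformly_locally_chain_equiconnected_at X G" using eq r(2) by blast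
      then show ?thesis
        by (rule chain_equiconnected_imp_trace_equiconnected[OF sub r(1), rotated]) (rule FG)
    qed
  qed
  have 6: "metric_ANR TYPE(('a set \<Rightarrow> real) + 'u) ?Y"
    if "\<forall>F\<in>H. uniformly_locally_trace_equiconnected_at X F"
    by (rule trace_equiconnected_imp_ANR[OF H]) (use that in blast)
  show ?thesis using 1 2 3 4 5 6 by argo
qed

end
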